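(* Let $p\geqslant q>1$ and let $\Omega\subset\mathbb{R}^N$, $N\geqslant1$, be a domain of finite Lebesgue measure. Then there exists $C=C(p,q,\Omega)>0$ such that $$\|\nabla u\|_p^p-\lambda_1\|u\|_q^p\geqslant C\,\frac{\|u\|_q^p}{\|\varphi_1\|_q^p}\,\max_{t\in[0,1]}\left[t(1-t)\int_\Omega\mathcal{R}_p\left(\frac{\|\varphi_1\|_q}{\|u\|_q}|u|,\varphi_1;t\right)dx\right]$$ for any $u\in W_0^{1,p}(\Omega)$ (for $u=0$ the right-hand side is understood as $0$). Moreover, in the homogeneous case $p=q$, there exists $C=C(p,\Omega)>0$ such that $$\int_\Omega|\nabla u|^p\,dx-\lambda_1\int_\Omega|u|^p\,dx\geqslant C\int_\Omega\mathcal{R}_p(|u|,\varphi_1;1)\,dx$$ for any $u\in W_0^{1,p}(\Omega)$. In particular, if $p=q\geqslant2$, then there exists $C=C(p,\Omega)>0$ such that $$\int_\Omega|\nabla u|^p\,dx-\lambda_1\int_\Omega|u|^p\,dx\geqslant C\int_\Omega\left|\nabla\left(\frac{u}{\varphi_1}\right)\right|^p\varphi_1^p\,dx$$ for any $u\in W_0^{1,p}(\Omega)$.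
   Context: All functions are real-valued, and $\|\cdot\|_r$ is the norm of $L^r(\Omega)$. Set $$\lambda_1=\inf\left\{\frac{\int_\Omega|\nabla u|^p\,dx}{\left(\int_\Omega|u|^q\,dx\right)^{p/q}}:\ u\in W_0^{1,p}(\Omega)\setminus\{0\}\right\}.$$ It is known that $\lambda_1>0$, that it is attained, and that (since $p\geqslant q$) its minimizer is unique up to multiplication by nonzero constants and can be chosen positive. $\varphi_1$ denotes a fixed minimizer of $\lambda_1$ with $\varphi_1>0$ in $\Omega$. For nonnegative $v,w\in W_0^{1,p}(\Omega)$ and $t\in[0,1]$, $$\mathcal{R}_p(v,w;t)=\begin{cases}\dfrac{|w\nabla v-v\nabla w|^p}{(1-t)v^p+tw^p},&\text{if }p\geqslant2,\\[3mm]\dfrac{\left(|w\nabla v|^2+|v\nabla w|^2\right)^{\frac{p-2}{2}}|w\nabla v-v\nabla w|^2}{(1-t)v^p+tw^p},&\text{if }1<p<2.\end{cases}$$ This is a function defined a.e. in $\Omega$, understood as $0$ at points where $w\nabla v=v\nabla w=0$. *)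

theory Defs
  imports "HOL-Analysis.Analysis"
begin

text \<open>Functions on \<open>\<Omega>\<close> are total functions on the ambient space; only their values on \<open>\<Omega>\<close>, up to
  Lebesgue null sets, matter.\<close>

primrec Ck :: "nat \<Rightarrow> ('a::euclidean_space \<Rightarrow> real) \<Rightarrow> bool" where
  "Ck 0 f \<longleftrightarrow> continuous_on UNIV f"
| "Ck (Suc k) f \<longleftrightarrow> (\<forall>x. f differentiable (at x)) \<and>
     (\<forall>i\<in>Basis. Ck k (\<lambda>x. frechet_derivative f (at x) i))"

definition test_function :: "'a::euclidean_space set \<Rightarrow> ('a \<Rightarrow> real) \<Rightarrow> bool" where
  "test_function \<Omega> \<psi> \<longleftrightarrow>
     (\<forall>k. Ck k \<psi>) \<and> compact (closure {x. \<psi> x \<noteq> 0}) \<and> closure {x. \<psi> x \<noteq> 0} \<subseteq> \<Omega>"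

definition Lspace :: "'a::euclidean_space set \<Rightarrow> real \<Rightarrow> ('a \<Rightarrow> 'b::euclidean_space) set" where
  "Lspace \<Omega> r = {f \<in> borel_measurable (lebesgue_on \<Omega>).
     integrable (lebesgue_on \<Omega>) (\<lambda>x. norm (f x) powr r)}"

definition Lnorm :: "'a::euclidean_space set \<Rightarrow> real \<Rightarrow> ('a \<Rightarrow> 'b::euclidean_space) \<Rightarrow> real" where
  "Lnorm \<Omega> r f = (\<integral>x. norm (f x) powr r \<partial>lebesgue_on \<Omega>) powr (1 / r)"

definition loc_integrable :: "'a::euclidean_space set \<Rightarrow> ('a \<Rightarrow> 'b::euclidean_space) \<Rightarrow> bool" where
  "loc_integrable \<Omega> f \<longleftrightarrow> (\<forall>K. compact K \<and> K \<subseteq> \<Omega> \<longrightarrow> set_integrable lebesgue K f)"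

definition has_weak_grad ::
    "'a::euclidean_space set \<Rightarrow> ('a \<Rightarrow> real) \<Rightarrow> ('a \<Rightarrow> 'a) \<Rightarrow> bool" where
  "has_weak_grad \<Omega> u g \<longleftrightarrow> loc_integrable \<Omega> u \<and> loc_integrable \<Omega> g \<and>
     (\<forall>\<psi>. test_function \<Omega> \<psi> \<longrightarrow> (\<forall>i\<in>Basis.
        (\<integral>x. u x * frechet_derivative \<psi> (at x) i \<partial>lebesgue_on \<Omega>) =
        - (\<integral>x. (g x \<bullet> i) * \<psi> x \<partial>lebesgue_on \<Omega>)))"

text \<open>A weak gradient is unique only up to null sets; \<open>weak_grad\<close> picks a representative.\<close>

definition weak_grad :: "'a::euclidean_space set \<Rightarrow> ('a \<Rightarrow> real) \<Rightarrow> 'a \<Rightarrow> 'a" where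
  "weak_grad \<Omega> u = (SOME g. has_weak_grad \<Omega> u g)"

definition W1 :: "'a::euclidean_space set \<Rightarrow> real \<Rightarrow> ('a \<Rightarrow> real) set" where
  "W1 \<Omega> p = {u \<in> Lspace \<Omega> p. (\<exists>g. has_weak_grad \<Omega> u g) \<and> weak_grad \<Omega> u \<in> Lspace \<Omega> p}"

definition W1norm :: "'a::euclidean_space set \<Rightarrow> real \<Rightarrow> ('a \<Rightarrow> real) \<Rightarrow> real" where
  "W1norm \<Omega> p u = (Lnorm \<Omega> p u powr p + Lnorm \<Omega> p (weak_grad \<Omega> u) powr p) powr (1 / p)"

definition W1_0 :: "'a::euclidean_space set \<Rightarrow> real \<Rightarrow> ('a \<Rightarrow> real) set" where
  "W1_0 \<Omega> p = {u \<in> W1 \<Omega> p. \<exists>\<psi>. (\<forall>n. test_function \<Omega> (\<psi> n)) \<and>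
     (\<lambda>n. W1norm \<Omega> p (\<lambda>x. \<psi> n x - u x)) \<longlonglongrightarrow> 0}"

definition W1_0_nonzero :: "'a::euclidean_space set \<Rightarrow> real \<Rightarrow> ('a \<Rightarrow> real) set" where
  "W1_0_nonzero \<Omega> p = {u \<in> W1_0 \<Omega> p. \<not> (AE x in lebesgue_on \<Omega>. u x = 0)}"

definition rayleigh :: "'a::euclidean_space set \<Rightarrow> real \<Rightarrow> real \<Rightarrow> ('a \<Rightarrow> real) \<Rightarrow> real" where
  "rayleigh \<Omega> p q u = (\<integral>x. norm (weak_grad \<Omega> u x) powr p \<partial>lebesgue_on \<Omega>) /
     (\<integral>x. \<bar>u x\<bar> powr q \<partial>lebesgue_on \<Omega>) powr (p / q)"

definition lambda1 :: "'a::euclidean_space set \<Rightarrow> real \<Rightarrow> real \<Rightarrow> real" where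
  "lambda1 \<Omega> p q = (INF u\<in>W1_0_nonzero \<Omega> p. rayleigh \<Omega> p q u)"

definition positive_minimizer ::
    "'a::euclidean_space set \<Rightarrow> real \<Rightarrow> real \<Rightarrow> ('a \<Rightarrow> real) \<Rightarrow> bool" where
  "positive_minimizer \<Omega> p q \<phi> \<longleftrightarrow> \<phi> \<in> W1_0_nonzero \<Omega> p \<and>
     rayleigh \<Omega> p q \<phi> = lambda1 \<Omega> p q \<and> (AE x in lebesgue_on \<Omega>. 0 < \<phi> x)"

text \<open>Since \<open>0 powr a = 0\<close> (also for \<open>a < 0\<close>) and \<open>y / 0 = 0\<close>, the function below vanishes wherever
  both \<open>w \<nabla>v\<close> and \<open>v \<nabla>w\<close> do.\<close>

definition Rp :: "'a::euclidean_space set \<Rightarrow> real \<Rightarrow> ('a \<Rightarrow> real) \<Rightarrow> ('a \<Rightarrow> real) \<Rightarrow> real \<Rightarrow> 'a \<Rightarrow> real"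
  where
  "Rp \<Omega> p v w t x =
     (let a = w x *\<^sub>R weak_grad \<Omega> v x; b = v x *\<^sub>R weak_grad \<Omega> w x;
          d = (1 - t) * v x powr p + t * w x powr p
      in if p \<ge> 2 then norm (a - b) powr p / d
         else ((norm a)\<^sup>2 + (norm b)\<^sup>2) powr ((p - 2) / 2) * (norm (a - b))\<^sup>2 / d)"

text \<open>The integral over \<open>\<Omega>\<close> of a nonnegative function, with value \<open>\<infinity>\<close> allowed, so that an upper
  bound on it contains the claim that it is finite. It lives in \<^typ>\<open>ereal\<close> because the quantities
  it is compared with are differences of reals, which \<^typ>\<open>ennreal\<close> would truncate at \<open>0\<close>.\<close>

definition pos_integral :: "'a::euclidean_space set \<Rightarrow> ('a \<Rightarrow> real) \<Rightarrow> ereal" where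
  "pos_integral \<Omega> f = enn2ereal (\<integral>\<^sup>+x. ennreal (f x) \<partial>lebesgue_on \<Omega>)"

end

theory Submission
  imports Defs
begin

text \<open>The powers \<open>v\<^sup>p\<close> and \<open>w\<^sup>p\<close> are joined by a segment: with \<open>\<sigma> = ((1 - t) v\<^sup>p + t w\<^sup>p)\<^bsup>1/p\<^esup>\<close>,
  uniform convexity of \<open>\<bar>\<cdot>\<bar>\<^sup>p\<close> gives the pointwise bound
  \<open>\<bar>\<nabla>\<sigma>\<bar>\<^sup>p + C t (1 - t) R(v, w; t) \<le> (1 - t) \<bar>\<nabla>v\<bar>\<^sup>p + t \<bar>\<nabla>w\<bar>\<^sup>p\<close>. Take \<open>v\<close> to be the multiple of \<open>\<bar>u\<bar>\<close>
  with the same \<open>L\<^sup>q\<close> norm as \<open>w = \<phi>\<close>. Since \<open>q \<le> p\<close>, the \<open>L\<^sup>q\<close> norm of \<open>\<sigma>\<close> is at least that of \<open>\<phi>\<close>, so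
  integrating and using \<open>\<sigma>\<close> as a competitor for \<open>\<lambda>\<^sub>1\<close> gives \<open>C t \<integral>R(v, w; t) \<le> \<integral>\<bar>\<nabla>v\<bar>\<^sup>p - \<lambda>\<^sub>1 \<parallel>v\<parallel>\<^sup>p\<close>; Fatou's
  lemma yields \<open>t = 1\<close>, and \<open>t R(t) \<le> R(1)\<close> makes the integrals continuous in \<open>t\<close>.

  For \<open>p \<ge> 2\<close> the integrands of \<open>R(\<bar>u\<bar>, \<phi>; 1)\<close> and \<open>\<bar>\<nabla>(u/\<phi>)\<bar>\<^sup>p \<phi>\<^sup>p\<close> agree almost everywhere, once \<open>u/\<phi>\<close> is known to
  have a weak gradient. This holds because \<open>\<phi>\<close> is locally bounded away from \<open>0\<close>: \<open>\<phi>\<close> minimises the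
  energy among larger functions, and De Giorgi iteration starts from the sets \<open>{\<phi> < k}\<close>, whose
  measure tends to \<open>0\<close> with \<open>k\<close> because \<open>\<phi> > 0\<close> almost everywhere.\<close>

section \<open>Smooth functions and bump functions\<close>

text \<open>The estimate keeps a factor t but loses 1 - t, which is what lets t reach 1: \<phi> has
  zero deficit, so after inserting the competitor everything left carries a factor 1 - t, and this
  cancels. Equal L^q norms are imposed because raising a convex combination of integrals to the
  power p/q goes the wrong way; for p = q that power is 1 and |u| needs no normalisation. The
  constant is 2 * 2^(-p) for p \<ge> 2, from Clarkson's midpoint inequality, and p (p - 1) / 2 for p
  < 2, from a second derivative. The obstacle is that \<open>weak_grad\<close> is an arbitrary
  choice and \<open>W1_0\<close> a closure: absolute values, truncations, power means and quotients
  must each be exhibited as limits, together with their gradients. One chain rule for smooth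
  functions of two Sobolev functions provides all of them. The iteration rests on no Sobolev
  embedding: the L^1 norm of an increment is at most the length of the shift times the L^1 norm of
  the gradient, and averaging over the shifts in a ball gives the necessary gain in every
  dimension.\<close>

lemma Ck_SucI:
  fixes f :: "'a::euclidean_space \<Rightarrow> real"
  assumes "\<And>x. (f has_derivative f' x) (at x)" "\<And>i. i \<in> Basis \<Longrightarrow> Ck k (\<lambda>x. f' x i)"
  shows "Ck (Suc k) f"
proof -
  have "frechet_derivative f (at x) = f' x" for x
    using assms(1) frechet_derivative_at by metis
  then show ?thesis
    using assms by (auto simp: differentiable_def)
qed

lemma Ck_continuous: "Ck k f \<Longrightarrow> continuous_on UNIV f"
  by (cases k) (auto intro!: differentiable_imp_continuous_on simp: differentiable_on_def)

lemma Ck_Suc_imp: "Ck (Suc k) f \<Longrightarrow> Ck k f"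
proof (induction k arbitrary: f)
  case 0 then show ?case using Ck_continuous by (metis Ck.simps(1))
next
  case (Suc k)
  then show ?case by (metis Ck.simps(2))
qed

lemma Ck_has_derivative:
  "Ck (Suc k) f \<Longrightarrow> (f has_derivative frechet_derivative f (at x)) (at x)"
  by (simp add: frechet_derivative_works)

lemma Ck_const [simp]: "Ck k (\<lambda>x. c)"
proof (induction k arbitrary: c)
  case (Suc k)
  show ?case by (rule Ck_SucI[where f' = "\<lambda>x y. 0"]) (auto simp: Suc)
qed simp

lemma Ck_inner: "Ck k (\<lambda>x. x \<bullet> a)"
proof (cases k)
  case (Suc k)
  have "Ck (Suc m) (\<lambda>x. x \<bullet> a)" for m
    by (rule Ck_SucI[where f' = "\<lambda>x y. y \<bullet> a"])
      (auto intro!: bounded_linear_imp_has_derivative bounded_linear_inner_left)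
  with Suc show ?thesis by simp
qed (auto intro!: continuous_intros)

lemma Ck_add: "Ck k f \<Longrightarrow> Ck k g \<Longrightarrow> Ck k (\<lambda>x. f x + g x)"
proof (induction k arbitrary: f g)
  case 0 then show ?case by (auto intro!: continuous_intros)
next
  case (Suc k)
  show ?case
  proof (rule Ck_SucI)
    show "((\<lambda>x. f x + g x) has_derivative
      (\<lambda>y. frechet_derivative f (at x) y + frechet_derivative g (at x) y)) (at x)" for x
      using Suc.prems by (intro derivative_intros Ck_has_derivative)
    show "Ck k (\<lambda>x. frechet_derivative f (at x) i + frechet_derivative g (at x) i)"
      if "i \<in> Basis" for i
      using Suc that by auto
  qed
qed

lemma Ck_mult: "Ck k f \<Longrightarrow> Ck k g \<Longrightarrow> Ck k (\<lambda>x. f x * g x)"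
proof (induction k arbitrary: f g)
  case 0 then show ?case by (auto intro!: continuous_intros)
next
  case (Suc k)
  show ?case
  proof (rule Ck_SucI)
    show "((\<lambda>x. f x * g x) has_derivative
      (\<lambda>y. f x * frechet_derivative g (at x) y + frechet_derivative f (at x) y * g x)) (at x)" for x
      using Suc.prems by (intro derivative_intros Ck_has_derivative)
    show "Ck k (\<lambda>x. f x * frechet_derivative g (at x) i + frechet_derivative f (at x) i * g x)"
      if "i \<in> Basis" for i
      using Suc.prems Ck_Suc_imp[OF Suc.prems(1)] Ck_Suc_imp[OF Suc.prems(2)] that
      by (intro Ck_add Suc.IH) auto
  qed
qed

lemma Ck_cmult: "Ck k f \<Longrightarrow> Ck k (\<lambda>x. c * f x)"
  by (intro Ck_mult) auto

lemma Ck_diff: "Ck k f \<Longrightarrow> Ck k g \<Longrightarrow> Ck k (\<lambda>x. f x - g x)"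
  using Ck_add[of k f "\<lambda>x. (-1) * g x"] Ck_cmult[of k g "-1"] by simp

lemma Ck_power: "Ck k f \<Longrightarrow> Ck k (\<lambda>x. f x ^ n)"
  by (induction n) (auto intro: Ck_mult)

lemma Ck_prod: "(\<And>i. i \<in> I \<Longrightarrow> Ck k (f i)) \<Longrightarrow> Ck k (\<lambda>x. \<Prod>i\<in>I. f i x)"
  by (induction I rule: infinite_finite_induct) (auto intro: Ck_mult)

text \<open>The family \<open>h\<close> is closed under differentiation, so that a single induction on \<open>k\<close> treats a
  function together with all its derivatives.\<close>

lemma Ck_compose_family:
  fixes h :: "'i \<Rightarrow> real \<Rightarrow> real"
  assumes "\<And>m s. s \<in> S \<Longrightarrow> (h m has_real_derivative (c m * h (d m) s + c' m * h (d' m) s)) (at s)"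
    and "\<And>m. continuous_on S (h m)" and "\<And>x. f x \<in> S"
  shows "Ck k f \<Longrightarrow> Ck k (\<lambda>x. h m (f x))"
proof (induction k arbitrary: m)
  case 0
  then show ?case
    using continuous_on_compose2[OF assms(2), of UNIV f] assms(3) by auto
next
  case (Suc k)
  show ?case
  proof (rule Ck_SucI)
    show "((\<lambda>x. h m (f x)) has_derivative
      (\<lambda>y. (c m * h (d m) (f x) + c' m * h (d' m) (f x)) * frechet_derivative f (at x) y)) (at x)" for x
      using has_derivative_compose[OF Ck_has_derivative[OF Suc.prems], of "h m"]
        assms(1)[OF assms(3)] by (auto simp: has_field_derivative_def)
    show "Ck k (\<lambda>x. (c m * h (d m) (f x) + c' m * h (d' m) (f x)) * frechet_derivative f (at x) i)"
      if "i \<in> Basis" for i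
      using Suc.prems Ck_Suc_imp[OF Suc.prems] that
      by (intro Ck_mult Ck_add Suc.IH Ck_const) auto
  qed
qed

lemma Ck_powr:
  assumes "\<And>x. f x > 0" "Ck k f" shows "Ck k (\<lambda>x. f x powr a)"
proof (rule Ck_compose_family[where S = "{0<..}" and h = "\<lambda>a s. s powr a"
      and c = "\<lambda>a. a" and d = "\<lambda>a. a - 1" and c' = "\<lambda>a. 0" and d' = "\<lambda>a. a"])
  show "((\<lambda>s. s powr a) has_real_derivative a * s powr (a - 1) + 0 * s powr a) (at s)"
    if "s \<in> {0<..}" for a s :: real
    using that by (auto intro!: derivative_eq_intros simp: powr_diff field_simps)
qed (use assms in \<open>auto intro!: continuous_intros\<close>)

text \<open>Dividing exp (-1/s) by powers of s gives a family closed under differentiation up to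
  linear combinations: the derivative of index m involves the indices m + 2 and m + 1. This is the
  shape that \<open>Ck_compose_family\<close> asks for.\<close>

definition flat_exp :: "nat \<Rightarrow> real \<Rightarrow> real" where
  "flat_exp m s = (if s > 0 then exp (- 1 / s) / s ^ m else 0)"

lemma flat_exp_lim: "((flat_exp m) \<longlongrightarrow> 0) (at 0)"
proof -
  have "((\<lambda>s::real. inverse s ^ m / exp (inverse s)) \<longlongrightarrow> 0) (at_right 0)"
    by (rule filterlim_compose[OF tendsto_power_div_exp_0 filterlim_inverse_at_top_right])
  moreover have "\<forall>\<^sub>F s in at_right 0. flat_exp m s = inverse s ^ m / exp (inverse s)"
    by (auto simp: eventually_at_right_field flat_exp_def exp_minus field_simps intro!: exI[of _ 1])
  ultimately have "((flat_exp m) \<longlongrightarrow> 0) (at_right 0)"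
    using tendsto_cong by force
  moreover have "((flat_exp m) \<longlongrightarrow> 0) (at_left 0)"
    by (rule tendsto_eventually)
      (auto simp: eventually_at_left_field flat_exp_def intro!: exI[of _ "-1"])
  ultimately show ?thesis by (simp add: filterlim_split_at_real)
qed

lemma flat_exp_deriv:
  "(flat_exp m has_real_derivative flat_exp (m + 2) s + (- real m) * flat_exp (m + 1) s) (at s)"
proof -
  consider "s < 0" | "s = 0" | "s > 0" by linarith
  then show ?thesis
  proof cases
    case 1
    have "((\<lambda>s::real. 0) has_real_derivative 0) (at s)" by simp
    then have "(flat_exp m has_real_derivative 0) (at s)"
      by (rule has_field_derivative_transform_within_open[where S = "{..<0}"])
        (use 1 in \<open>auto simp: flat_exp_def\<close>)
    then show ?thesis using 1 by (simp add: flat_exp_def)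
  next
    case 2
    \<comment> \<open>The difference quotient at 0 is the next member of the family, also at h = 0
      because division by 0 yields 0; the derivative at 0 is thus a limit already computed.\<close>
    have "flat_exp (m+1) = (\<lambda>h. (flat_exp m (0 + h) - flat_exp m 0) / h)"
      by (auto simp: flat_exp_def fun_eq_iff)
    with flat_exp_lim[of "m+1"] have "(flat_exp m has_real_derivative 0) (at 0)"
      unfolding DERIV_def by simp
    then show ?thesis using 2 by (simp add: flat_exp_def)
  next
    case 3
    have "((\<lambda>s. exp (- 1 / s) / s ^ m) has_real_derivative
        (exp (- 1 / s) * (1 / s\<^sup>2) * s ^ m - exp (- 1 / s) * (real m * s ^ (m - 1))) / (s ^ m * s ^ m)) (at s)"
      using 3 by (auto intro!: derivative_eq_intros simp: power2_eq_square)
    moreover have "(exp (- 1 / s) * (1 / s\<^sup>2) * s ^ m - exp (- 1 / s) * (real m * s ^ (m - 1))) / (s ^ m * s ^ m)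
      = flat_exp (m + 2) s + (- real m) * flat_exp (m + 1) s"
      using 3 by (cases m) (auto simp: flat_exp_def field_simps power2_eq_square)
    ultimately have "((\<lambda>s. exp (- 1 / s) / s ^ m) has_real_derivative
        flat_exp (m + 2) s + (- real m) * flat_exp (m + 1) s) (at s)" by simp
    then show ?thesis
      by (rule has_field_derivative_transform_within_open[where S = "{0<..}"])
        (use 3 in \<open>auto simp: flat_exp_def\<close>)
  qed
qed

lemma Ck_flat_exp: "Ck k f \<Longrightarrow> Ck k (\<lambda>x. flat_exp m (f x))"
proof (rule Ck_compose_family[where S = UNIV and h = flat_exp
      and c = "\<lambda>m. 1" and d = "\<lambda>m. m + 2" and c' = "\<lambda>m. - real m" and d' = "\<lambda>m. m + 1"])
  show "(flat_exp m has_real_derivative 1 * flat_exp (m + 2) s + (- real m) * flat_exp (m + 1) s) (at s)"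
    for m s using flat_exp_deriv[of m s] by simp
  show "continuous_on UNIV (flat_exp m)" for m
    by (rule DERIV_continuous_on) (rule has_field_derivative_at_within[OF flat_exp_deriv])
qed auto

text \<open>A product of flat exponentials of the distances to the faces, hence smooth and nonzero
  exactly on the open box. The factor \<open>Suc n\<close> stretches the distances, so that the
  values tend to 1 inside and the sequence approximates the indicator of the box.\<close>

definition bump :: "nat \<Rightarrow> 'a::euclidean_space \<Rightarrow> 'a \<Rightarrow> 'a \<Rightarrow> real" where
  "bump n a b x = (\<Prod>i\<in>Basis. flat_exp 0 (real (Suc n) * ((x - a) \<bullet> i)) * flat_exp 0 (real (Suc n) * ((b - x) \<bullet> i)))"

lemma bump_nonneg: "bump n a b x \<ge> 0"
  unfolding bump_def by (intro prod_nonneg) (auto simp: flat_exp_def)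

lemma bump_le_1: "bump n a b x \<le> 1"
  unfolding bump_def
  by (intro prod_le_1 conjI mult_le_one) (auto simp: flat_exp_def)

lemma bump_pos_iff: "bump n a b x \<noteq> 0 \<longleftrightarrow> x \<in> box a b"
  by (auto simp: bump_def flat_exp_def box_def inner_diff_left zero_less_mult_iff)

lemma test_function_bump:
  assumes "cbox a b \<subseteq> \<Omega>" shows "test_function \<Omega> (bump n a b)"
proof -
  have "Ck k (bump n a b)" for k
    unfolding bump_def inner_diff_left
    by (intro Ck_prod Ck_mult Ck_flat_exp Ck_diff Ck_const Ck_inner)
  moreover have "closure {x. bump n a b x \<noteq> 0} \<subseteq> cbox a b"
    by (rule closure_minimal) (auto simp: bump_pos_iff box_subset_cbox[THEN subsetD] closed_cbox)
  moreover have "compact (closure {x. bump n a b x \<noteq> 0})"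
    by (simp add: bump_pos_iff)
  ultimately show ?thesis using assms by (auto simp: test_function_def)
qed

lemma bump_tendsto: "(\<lambda>n. bump n a b x) \<longlonglongrightarrow> indicator (box a b) x"
proof (cases "x \<in> box a b")
  case True
  have *: "(\<lambda>n. flat_exp 0 (real (Suc n) * s)) \<longlonglongrightarrow> 1" if "s > 0" for s :: real
  proof -
    have "(\<lambda>n. exp (- (inverse s * inverse (real (Suc n))))) \<longlonglongrightarrow> exp (- (inverse s * 0))"
      by (intro tendsto_intros LIMSEQ_inverse_real_of_nat)
    moreover have "flat_exp 0 (real (Suc n) * s) = exp (- (inverse s * inverse (real (Suc n))))" for n
      using that by (simp add: flat_exp_def inverse_eq_divide mult.commute del: of_nat_Suc)
    ultimately show ?thesis by simp
  qed
  have "(\<lambda>n. bump n a b x) \<longlonglongrightarrow> (\<Prod>i\<in>(Basis::'a set). 1 * 1)"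
    unfolding bump_def
    by (intro tendsto_prod tendsto_mult *) (use True in \<open>auto simp: box_def inner_diff_left\<close>)
  then show ?thesis using True by simp
next
  case False
  then have "bump n a b x = 0" for n using bump_pos_iff by blast
  then show ?thesis using False by simp
qed

section \<open>Weak gradients\<close>

definition grad :: "('a::euclidean_space \<Rightarrow> real) \<Rightarrow> 'a \<Rightarrow> 'a" where
  "grad f x = (\<Sum>i\<in>Basis. frechet_derivative f (at x) i *\<^sub>R i)"

lemma grad_inner: "i \<in> Basis \<Longrightarrow> grad f x \<bullet> i = frechet_derivative f (at x) i"
  unfolding grad_def by (simp add: inner_sum_left inner_Basis if_distrib cong: if_cong)

lemma grad_has_derivative:
  assumes "f differentiable (at x)" shows "(f has_derivative (\<lambda>h. grad f x \<bullet> h)) (at x)"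
proof -
  have "frechet_derivative f (at x) h = grad f x \<bullet> h" for h
  proof -
    interpret linear "frechet_derivative f (at x)" using assms by (rule linear_frechet_derivative)
    have "frechet_derivative f (at x) h = frechet_derivative f (at x) (\<Sum>i\<in>Basis. (h \<bullet> i) *\<^sub>R i)"
      by (simp add: euclidean_representation)
    also have "\<dots> = grad f x \<bullet> h"
      unfolding grad_def inner_sum_left by (simp add: sum scale inner_commute[of h] mult.commute)
    finally show ?thesis .
  qed
  then have "frechet_derivative f (at x) = (\<lambda>h. grad f x \<bullet> h)" by (rule ext)
  with assms show ?thesis by (simp add: frechet_derivative_works)
qed

lemma grad_eqI:
  assumes "(f has_derivative (\<lambda>h. g \<bullet> h)) (at x)" shows "grad f x = g"
proof (rule euclidean_eqI)
  fix i :: 'a assume "i \<in> Basis"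
  then show "grad f x \<bullet> i = g \<bullet> i"
    using assms by (simp add: grad_inner frechet_derivative_at[OF assms, symmetric])
qed

lemma test_function_Ck: "test_function \<Omega> f \<Longrightarrow> Ck k f"
  by (simp add: test_function_def)

lemma test_function_differentiable: "test_function \<Omega> f \<Longrightarrow> f differentiable (at x)"
  using test_function_Ck[of \<Omega> f 1] by simp

lemma test_function_has_derivative:
  "test_function \<Omega> f \<Longrightarrow> (f has_derivative (\<lambda>h. grad f x \<bullet> h)) (at x)"
  by (intro grad_has_derivative test_function_differentiable)

lemma test_function_continuous: "test_function \<Omega> f \<Longrightarrow> continuous_on A f"
  using test_function_Ck[of \<Omega> f 0] continuous_on_subset by fastforce

lemma continuous_grad:
  assumes "\<And>k. Ck k f" shows "continuous_on A (grad f)"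
proof -
  have "continuous_on UNIV (\<lambda>x. frechet_derivative f (at x) i)" if "i \<in> Basis" for i
    using assms[of "Suc 0"] that by simp
  then show ?thesis unfolding grad_def
    by (intro continuous_intros) (metis continuous_on_subset subset_UNIV)
qed

text \<open>The gradient vanishes off the closed support because the complement is open and f is
  constant there; a single compact set thus serves for f and its gradient.\<close>

lemma test_function_support:
  assumes "test_function \<Omega> f"
  obtains K where "compact K" "K \<subseteq> \<Omega>" "\<And>x. x \<notin> K \<Longrightarrow> f x = 0" "\<And>x. x \<notin> K \<Longrightarrow> grad f x = 0"
proof -
  define K where "K = closure {x. f x \<noteq> 0}"
  have K: "compact K" "K \<subseteq> \<Omega>" using assms by (auto simp: test_function_def K_def)
  have "x \<in> K" if "f x \<noteq> 0" for x
    unfolding K_def by (rule subsetD[OF closure_subset]) (use that in simp)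
  then have z: "f x = 0" if "x \<notin> K" for x
    using that by blast
  have "grad f x = 0" if "x \<notin> K" for x
  proof (rule grad_eqI)
    have "((\<lambda>x. 0) has_derivative (\<lambda>h. 0 \<bullet> h)) (at x)" by simp
    then show "(f has_derivative (\<lambda>h. 0 \<bullet> h)) (at x)"
    proof (rule has_derivative_transform_within_open)
      show "open (- K)" using K by (simp add: compact_imp_closed open_Compl)
      show "x \<in> - K" using that by simp
      show "0 = f y" if "y \<in> - K" for y using z[of y] that by simp
    qed
  qed
  with K z show ?thesis by (rule that)
qed

lemma continuous_compact_support_bounded:
  fixes f :: "'a::euclidean_space \<Rightarrow> 'b::real_normed_vector"
  assumes "compact K" "\<And>x. x \<notin> K \<Longrightarrow> f x = 0" "continuous_on UNIV f"
  shows "\<exists>B>0. \<forall>x. norm (f x) \<le> B"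
proof -
  have "compact (f ` K)" using assms by (meson compact_continuous_image continuous_on_subset subset_UNIV)
  then obtain B where B: "B > 0" "\<forall>y\<in>f ` K. norm y \<le> B"
    using compact_imp_bounded bounded_pos by metis
  have "norm (f x) \<le> B" for x
    using B assms(2)[of x] by (cases "x \<in> K") auto
  with B show ?thesis by blast
qed

lemma test_function_bounded:
  assumes "test_function \<Omega> f"
  obtains B where "B > 0" "\<And>x. \<bar>f x\<bar> \<le> B" "\<And>x. norm (grad f x) \<le> B"
proof -
  obtain K where K: "compact K" "\<And>x. x \<notin> K \<Longrightarrow> f x = 0" "\<And>x. x \<notin> K \<Longrightarrow> grad f x = 0"
    using test_function_support[OF assms] by metis
  have cont: "continuous_on UNIV f" "continuous_on UNIV (grad f)"
    by (rule test_function_continuous[OF assms]) (rule continuous_grad[OF test_function_Ck[OF assms]])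
  obtain B where B: "B > 0" "\<forall>x. norm (f x) \<le> B"
    using continuous_compact_support_bounded[OF K(1,2) cont(1)] by blast
  obtain B' where B': "B' > 0" "\<forall>x. norm (grad f x) \<le> B'"
    using continuous_compact_support_bounded[OF K(1,3) cont(2)] by blast
  show ?thesis
    by (rule that[of "max B B'"]) (use B B' in \<open>auto simp: le_max_iff_disj\<close>)
qed

lemma test_function_lipschitz:
  assumes "test_function \<Omega> f" "\<And>x. norm (grad f x) \<le> B"
  shows "\<bar>f x - f y\<bar> \<le> B * norm (x - y)"
proof -
  have "norm (f x - f y) \<le> B * norm (x - y)"
  proof (rule differentiable_bound[of UNIV])
    show "(f has_derivative (\<lambda>h. grad f x \<bullet> h)) (at x within UNIV)" for x
      using test_function_has_derivative[OF assms(1)] by simp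
    show "onorm (\<lambda>h. grad f x \<bullet> h) \<le> B" for x
    proof (rule onorm_bound)
      show "0 \<le> B" using assms(2) norm_ge_zero order_trans by blast
      show "norm (grad f x \<bullet> h) \<le> B * norm h" for h
        using Cauchy_Schwarz_ineq2[of "grad f x" h] mult_right_mono[OF assms(2), of "norm h" x] by simp
    qed
  qed auto
  then show ?thesis by simp
qed

lemma borel_measurable_test_function [measurable]:
  "test_function \<Omega> f \<Longrightarrow> f \<in> borel_measurable borel"
  "test_function \<Omega> f \<Longrightarrow> grad f \<in> borel_measurable borel"
  using continuous_grad[of f] test_function_continuous[of \<Omega> f]
  by (auto intro!: borel_measurable_continuous_onI simp: test_function_def)

lemma borel_measurable_lebesgue_onI:
  "f \<in> borel_measurable borel \<Longrightarrow> f \<in> borel_measurable (lebesgue_on S)"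
  by (intro measurable_restrict_space1 measurable_completion) simp

lemma test_function_mult:
  assumes "\<And>k. Ck k f" "test_function \<Omega> \<psi>" shows "test_function \<Omega> (\<lambda>x. f x * \<psi> x)"
proof -
  have "closure {x. f x * \<psi> x \<noteq> 0} \<subseteq> closure {x. \<psi> x \<noteq> 0}"
    by (intro closure_mono) auto
  with assms(2) have "closure {x. f x * \<psi> x \<noteq> 0} \<subseteq> \<Omega>" "compact (closure {x. f x * \<psi> x \<noteq> 0})"
    by (auto simp: test_function_def compact_eq_bounded_closed intro: bounded_subset)
  then show ?thesis
    using assms by (auto simp: test_function_def intro!: Ck_mult)
qed

section \<open>Integration by parts and uniqueness of weak gradients\<close>

lemma integral_translation:
  fixes f :: "'a::euclidean_space \<Rightarrow> real"
  assumes "f \<in> borel_measurable borel"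
  shows "(\<integral>x. f (x + h) \<partial>lborel) = (\<integral>x. f x \<partial>lborel)"
proof -
  have "(\<integral>x. f x \<partial>lborel) = (\<integral>x. f x \<partial>distr lborel borel ((+) h))"
    by (simp add: lborel_distr_plus)
  also have "\<dots> = (\<integral>x. f (h + x) \<partial>lborel)"
    using assms by (subst integral_distr) auto
  finally show ?thesis by (simp add: add.commute)
qed

text \<open>Difference quotients in direction i have integral 0 by translation invariance, and they
  converge to the partial derivative. The Lipschitz bound, together with step sizes at most 1, keeps
  them below a multiple of the indicator of one ball of radius R + 1.\<close>

lemma integral_partial_derivative_zero:
  fixes f :: "'a::euclidean_space \<Rightarrow> real"
  assumes f: "test_function \<Omega> f" and i: "i \<in> Basis"
  shows "(\<integral>x. grad f x \<bullet> i \<partial>lborel) = 0"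
proof -
  obtain B where B: "B > 0" "\<And>x. norm (grad f x) \<le> B"
    using test_function_bounded[OF f] by metis
  obtain K where K: "compact K" "\<And>x. x \<notin> K \<Longrightarrow> f x = 0"
    using test_function_support[OF f] by metis
  obtain R where "\<forall>x\<in>K. norm x \<le> R"
    using compact_imp_bounded[OF K(1)] unfolding bounded_iff by blast
  then have R: "K \<subseteq> cball 0 R" by auto
  define h where "h n = 1 / real (Suc n)" for n
  have h: "h n > 0" "h n \<le> 1" for n by (auto simp: h_def)
  have h0: "h \<longlonglongrightarrow> 0" unfolding h_def by (rule LIMSEQ_Suc) real_asymp
  define q where "q n x = (f (x + h n *\<^sub>R i) - f x) / h n" for n x
  note [measurable] = borel_measurable_test_function[OF f]
  have int: "integrable lborel (\<lambda>x. B * indicator (cball 0 (R + 1)) x :: real)"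
    by (intro integrable_mult_right integrable_real_indicator)
      (auto intro!: emeasure_bounded_finite[unfolded infinity_ennreal_def])
  have bd: "\<bar>q n x\<bar> \<le> B * indicator (cball 0 (R + 1)) x" for n x
  proof (cases "x \<in> cball 0 (R + 1)")
    case True
    have "\<bar>f (x + h n *\<^sub>R i) - f x\<bar> \<le> B * h n"
      using test_function_lipschitz[OF f B(2), of "x + h n *\<^sub>R i" x] h[of n] i by simp
    with h[of n] True show ?thesis by (simp add: q_def field_simps)
  next
    case False
    then have "norm x > R + 1" by simp
    moreover from this have "norm (x + h n *\<^sub>R i) > R"
      using norm_triangle_ineq4[of "x + h n *\<^sub>R i" "h n *\<^sub>R i"] h[of n] i by simp
    ultimately have "x \<notin> K" "x + h n *\<^sub>R i \<notin> K" using R by auto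
    then show ?thesis using B(1) by (simp add: q_def K)
  qed
  have lim: "(\<lambda>n. q n x) \<longlonglongrightarrow> grad f x \<bullet> i" for x
  proof -
    have "((\<lambda>s. f (x + s *\<^sub>R i)) has_derivative (\<lambda>s. grad f x \<bullet> (s *\<^sub>R i))) (at 0)"
    proof (rule has_derivative_compose[of "\<lambda>s. x + s *\<^sub>R i" "\<lambda>s. s *\<^sub>R i" 0 UNIV f])
      show "((\<lambda>s. x + s *\<^sub>R i) has_derivative (\<lambda>s. s *\<^sub>R i)) (at 0)"
        by (auto intro!: derivative_eq_intros)
      show "(f has_derivative (\<bullet>) (grad f x)) (at (x + 0 *\<^sub>R i))"
        using test_function_has_derivative[OF f] by simp
    qed
    then have "((\<lambda>s. f (x + s *\<^sub>R i)) has_real_derivative (grad f x \<bullet> i)) (at 0)"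
      unfolding has_field_derivative_def by (rule has_derivative_eq_rhs) (simp add: fun_eq_iff mult.commute)
    then have "((\<lambda>s. (f (x + s *\<^sub>R i) - f x) / s) \<longlongrightarrow> grad f x \<bullet> i) (at 0)"
      by (simp add: DERIV_def)
    then have "((\<lambda>n. (f (x + h n *\<^sub>R i) - f x) / h n) \<longlonglongrightarrow> grad f x \<bullet> i)"
      by (rule filterlim_compose) (use h0 h in \<open>auto simp: filterlim_at intro!: always_eventually less_imp_neq[symmetric]\<close>)
    then show ?thesis by (simp add: q_def)
  qed
  have "(\<lambda>n. \<integral>x. q n x \<partial>lborel) \<longlonglongrightarrow> (\<integral>x. grad f x \<bullet> i \<partial>lborel)"
  proof (rule integral_dominated_convergence[OF _ _ int])
    show "q n \<in> borel_measurable lborel" for n unfolding q_def by measurable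
    show "AE x in lborel. norm (q n x) \<le> B * indicator (cball 0 (R + 1)) x" for n
      using bd[of n] by (intro AE_I2) simp
  qed (simp_all add: lim)
  moreover have "(\<integral>x. q n x \<partial>lborel) = 0" for n
  proof -
    have fi: "integrable lborel f"
    proof -
      obtain B' where "\<And>x. \<bar>f x\<bar> \<le> B'" using test_function_bounded[OF f] by metis
      then show ?thesis
        by (intro integrableI_bounded_set[where A = K and B = B'])
          (use K(1,2) \<open>\<And>x. \<bar>f x\<bar> \<le> B'\<close> emeasure_bounded_finite[OF compact_imp_bounded[OF K(1)]] in
            \<open>simp_all add: borel_compact\<close>)
    qed
    have fi': "integrable lborel (\<lambda>x. f (x + h n *\<^sub>R i))"
    proof -
      have "integrable (distr lborel borel ((+) (h n *\<^sub>R i))) f" using fi by (simp add: lborel_distr_plus)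
      then have "integrable lborel (\<lambda>x. f (h n *\<^sub>R i + x))" by (subst (asm) integrable_distr_eq) auto
      then show ?thesis by (simp add: add.commute)
    qed
    show ?thesis unfolding q_def
      using integral_translation[of f "h n *\<^sub>R i"] fi fi' by simp
  qed
  ultimately show ?thesis by (simp add: LIMSEQ_const_iff)
qed

lemma integral_lebesgue_on_eq_lborel:
  fixes f :: "'a::euclidean_space \<Rightarrow> real"
  assumes "f \<in> borel_measurable borel" "S \<in> sets lebesgue" "\<And>x. x \<notin> S \<Longrightarrow> f x = 0"
  shows "(\<integral>x. f x \<partial>lebesgue_on S) = (\<integral>x. f x \<partial>lborel)"
proof -
  have "(\<integral>x. f x \<partial>lebesgue_on S) = (\<integral>x. indicator S x *\<^sub>R f x \<partial>lebesgue)"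
    using assms by (subst integral_restrict_space) auto
  also have "(\<lambda>x. indicator S x *\<^sub>R f x) = f"
  proof
    show "indicator S x *\<^sub>R f x = f x" for x using assms(3)[of x] by (cases "x \<in> S") auto
  qed
  finally show ?thesis using assms by (simp add: integral_completion)
qed

lemma loc_integrable_scale_compact:
  assumes "loc_integrable \<Omega> g" "\<Omega> \<in> sets lebesgue" "compact K" "K \<subseteq> \<Omega>"
    and "\<rho> \<in> borel_measurable borel" "\<And>x. \<bar>\<rho> x\<bar> \<le> B" "\<And>x. x \<notin> K \<Longrightarrow> \<rho> x = 0"
  shows "integrable (lebesgue_on \<Omega>) (\<lambda>x. \<rho> x *\<^sub>R g x)"
proof -
  have gK: "integrable lebesgue (\<lambda>x. indicator K x *\<^sub>R g x)"
    using assms by (auto simp: loc_integrable_def set_integrable_def)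
  have \<rho>: "\<rho> \<in> borel_measurable lebesgue" using assms(5) by (simp add: measurable_completion)
  have eq: "(\<lambda>x. indicator \<Omega> x *\<^sub>R \<rho> x *\<^sub>R g x) = (\<lambda>x. \<rho> x *\<^sub>R (indicator K x *\<^sub>R g x))"
    using assms(4,7) by (auto simp: fun_eq_iff indicator_def)
  have "integrable lebesgue (\<lambda>x. \<rho> x *\<^sub>R (indicator K x *\<^sub>R g x))"
  proof (rule Bochner_Integration.integrable_bound)
    show "integrable lebesgue (\<lambda>x. B * norm (indicator K x *\<^sub>R g x))"
      using gK by (intro integrable_mult_right integrable_norm)
    show "(\<lambda>x. \<rho> x *\<^sub>R indicat_real K x *\<^sub>R g x) \<in> borel_measurable lebesgue"
      using \<rho> gK by measurable
    show "AE x in lebesgue. norm (\<rho> x *\<^sub>R indicat_real K x *\<^sub>R g x) \<le> norm (B * norm (indicat_real K x *\<^sub>R g x))"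
    proof (intro AE_I2)
      fix x
      have "\<bar>\<rho> x\<bar> * norm (indicat_real K x *\<^sub>R g x) \<le> \<bar>B\<bar> * norm (indicat_real K x *\<^sub>R g x)"
        using assms(6)[of x] by (intro mult_right_mono) auto
      then show "norm (\<rho> x *\<^sub>R indicat_real K x *\<^sub>R g x) \<le> norm (B * norm (indicat_real K x *\<^sub>R g x))"
        by (simp add: abs_mult)
    qed
  qed
  then show ?thesis
    unfolding eq[symmetric] using assms(2) by (subst integrable_restrict_space) auto
qed

lemma loc_integrable_test_function_mult:
  assumes "loc_integrable \<Omega> g" "\<Omega> \<in> sets lebesgue" "test_function \<Omega> \<psi>"
  shows "integrable (lebesgue_on \<Omega>) (\<lambda>x. \<psi> x *\<^sub>R g x)"
    and "i \<in> Basis \<Longrightarrow> integrable (lebesgue_on \<Omega>) (\<lambda>x. frechet_derivative \<psi> (at x) i *\<^sub>R g x)"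
proof -
  obtain K where K: "compact K" "K \<subseteq> \<Omega>" "\<And>x. x \<notin> K \<Longrightarrow> \<psi> x = 0" "\<And>x. x \<notin> K \<Longrightarrow> grad \<psi> x = 0"
    using test_function_support[OF assms(3)] by metis
  obtain B where B: "\<And>x. \<bar>\<psi> x\<bar> \<le> B" "\<And>x. norm (grad \<psi> x) \<le> B"
    using test_function_bounded[OF assms(3)] by metis
  note [measurable] = borel_measurable_test_function[OF assms(3)]
  show "integrable (lebesgue_on \<Omega>) (\<lambda>x. \<psi> x *\<^sub>R g x)"
    by (rule loc_integrable_scale_compact[OF assms(1,2) K(1,2)]) (use B K in auto)
  show "integrable (lebesgue_on \<Omega>) (\<lambda>x. frechet_derivative \<psi> (at x) i *\<^sub>R g x)" if i: "i \<in> Basis"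
  proof (rule loc_integrable_scale_compact[OF assms(1,2) K(1,2), where B = B])
    have eq: "frechet_derivative \<psi> (at x) i = grad \<psi> x \<bullet> i" for x using i by (simp add: grad_inner)
    show "(\<lambda>x. frechet_derivative \<psi> (at x) i) \<in> borel_measurable borel"
      unfolding eq by measurable
    show "\<bar>frechet_derivative \<psi> (at x) i\<bar> \<le> B" for x
      unfolding eq using B(2)[of x] Basis_le_norm[OF i, of "grad \<psi> x"] by linarith
    show "frechet_derivative \<psi> (at x) i = 0" if "x \<notin> K" for x
      unfolding eq using K(4)[OF that] by simp
  qed
qed

lemma continuous_imp_loc_integrable:
  fixes f :: "'a::euclidean_space \<Rightarrow> 'b::euclidean_space"
  assumes "continuous_on UNIV f" shows "loc_integrable \<Omega> f"
proof -
  have "set_integrable lebesgue K f" if "compact K" for K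
  proof -
    have "integrable lborel (\<lambda>x. indicator K x *\<^sub>R f x)"
      using that assms by (intro borel_integrable_compact) (auto intro: continuous_on_subset)
    then show ?thesis
      unfolding set_integrable_def by (subst integrable_completion) auto
  qed
  then show ?thesis by (simp add: loc_integrable_def)
qed

text \<open>The product of f and \<psi> is a test function, so the integral of its partial
  derivative vanishes; f itself may have any support.\<close>

lemma integral_by_parts_test_function:
  assumes f: "\<And>k. Ck k f" and \<psi>: "test_function \<Omega> \<psi>" and \<Omega>: "\<Omega> \<in> sets lebesgue" and i: "i \<in> Basis"
  shows "(\<integral>x. f x * frechet_derivative \<psi> (at x) i \<partial>lebesgue_on \<Omega>)
       = - (\<integral>x. (grad f x \<bullet> i) * \<psi> x \<partial>lebesgue_on \<Omega>)"
proof -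
  have t: "test_function \<Omega> (\<lambda>x. f x * \<psi> x)" using f \<psi> by (rule test_function_mult)
  have fd: "(f has_derivative (\<lambda>h. grad f x \<bullet> h)) (at x)" for x
    using f[of "Suc 0"] by (intro grad_has_derivative) auto
  have g: "grad (\<lambda>x. f x * \<psi> x) x = f x *\<^sub>R grad \<psi> x + \<psi> x *\<^sub>R grad f x" for x
  proof (rule grad_eqI)
    show "((\<lambda>x. f x * \<psi> x) has_derivative (\<lambda>h. (f x *\<^sub>R grad \<psi> x + \<psi> x *\<^sub>R grad f x) \<bullet> h)) (at x)"
      using has_derivative_mult[OF fd test_function_has_derivative[OF \<psi>], of x]
      by (rule has_derivative_eq_rhs) (auto simp: inner_add_left)
  qed
  obtain K where K: "compact K" "K \<subseteq> \<Omega>" "\<And>x. x \<notin> K \<Longrightarrow> \<psi> x = 0" "\<And>x. x \<notin> K \<Longrightarrow> grad \<psi> x = 0"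
    using test_function_support[OF \<psi>] by metis
  have lf: "loc_integrable \<Omega> f" "loc_integrable \<Omega> (grad f)"
    by (rule continuous_imp_loc_integrable, use f[of 0] in simp)
      (rule continuous_imp_loc_integrable[OF continuous_grad[OF f]])
  have i1: "integrable (lebesgue_on \<Omega>) (\<lambda>x. f x * frechet_derivative \<psi> (at x) i)"
    using loc_integrable_test_function_mult(2)[OF lf(1) \<Omega> \<psi> i] by (simp add: mult.commute)
  have i2: "integrable (lebesgue_on \<Omega>) (\<lambda>x. (grad f x \<bullet> i) * \<psi> x)"
    using integrable_inner_left[OF loc_integrable_test_function_mult(1)[OF lf(2) \<Omega> \<psi>], of i]
    by (simp add: mult.commute)
  note [measurable] = borel_measurable_test_function[OF t]
  have "0 = (\<integral>x. grad (\<lambda>x. f x * \<psi> x) x \<bullet> i \<partial>lborel)"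
    using integral_partial_derivative_zero[OF t i] by simp
  also have "\<dots> = (\<integral>x. grad (\<lambda>x. f x * \<psi> x) x \<bullet> i \<partial>lebesgue_on \<Omega>)"
  proof (rule integral_lebesgue_on_eq_lborel[symmetric])
    show "(\<lambda>x. grad (\<lambda>x. f x * \<psi> x) x \<bullet> i) \<in> borel_measurable borel" by measurable
    show "grad (\<lambda>x. f x * \<psi> x) x \<bullet> i = 0" if "x \<notin> \<Omega>" for x
    proof -
      have "x \<notin> K" using that K(2) by blast
      then show ?thesis unfolding g by (simp add: K(3,4))
    qed
  qed (rule \<Omega>)
  also have "\<dots> = (\<integral>x. f x * frechet_derivative \<psi> (at x) i + (grad f x \<bullet> i) * \<psi> x \<partial>lebesgue_on \<Omega>)"
    unfolding g inner_add_left by (simp add: grad_inner[OF i] mult.commute)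
  also have "\<dots> = (\<integral>x. f x * frechet_derivative \<psi> (at x) i \<partial>lebesgue_on \<Omega>)
      + (\<integral>x. (grad f x \<bullet> i) * \<psi> x \<partial>lebesgue_on \<Omega>)"
    using i1 i2 by (rule Bochner_Integration.integral_add)
  finally show ?thesis by simp
qed

text \<open>Fundamental lemma of the calculus of variations. Bumps converging to the indicator of a
  box make the integral of g over every closed box in \<Omega> vanish; differentiating integrals
  over shrinking cubes gives g = 0 almost everywhere in each box, and countably many boxes exhaust
  \<Omega>.\<close>

lemma AE_zero_if_test_integrals_zero:
  fixes g :: "'a::euclidean_space \<Rightarrow> real"
  assumes "open \<Omega>" "loc_integrable \<Omega> g"
    and z: "\<And>\<psi>. test_function \<Omega> \<psi> \<Longrightarrow> (\<integral>x. g x * \<psi> x \<partial>lebesgue_on \<Omega>) = 0"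
  shows "AE x in lebesgue_on \<Omega>. g x = 0"
proof -
  have \<Omega>: "\<Omega> \<in> sets lebesgue" using assms(1) by (simp add: borel_open)
  have box0: "integral (cbox a b) g = 0" if ab: "cbox a b \<subseteq> \<Omega>" for a b
  proof -
    have gi: "integrable lebesgue (\<lambda>x. indicator (cbox a b) x *\<^sub>R g x)"
      using assms(2) ab by (auto simp: loc_integrable_def set_integrable_def)
    have "(\<lambda>n. \<integral>x. bump n a b x * (indicator (cbox a b) x *\<^sub>R g x) \<partial>lebesgue)
       \<longlonglongrightarrow> (\<integral>x. indicator (box a b) x * (indicator (cbox a b) x *\<^sub>R g x) \<partial>lebesgue)"
    proof (rule integral_dominated_convergence)
      show "integrable lebesgue (\<lambda>x. norm (indicator (cbox a b) x *\<^sub>R g x))" using gi by (rule integrable_norm)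
      show "AE x in lebesgue. (\<lambda>n. bump n a b x * (indicator (cbox a b) x *\<^sub>R g x))
          \<longlonglongrightarrow> indicator (box a b) x * (indicator (cbox a b) x *\<^sub>R g x)"
        by (intro AE_I2 tendsto_intros bump_tendsto)
      show "AE x in lebesgue. norm (bump n a b x * (indicator (cbox a b) x *\<^sub>R g x))
          \<le> norm (indicator (cbox a b) x *\<^sub>R g x)" for n
        by (intro AE_I2) (simp add: abs_mult mult_left_le_one_le bump_le_1 bump_nonneg)
      show "(\<lambda>x. bump n a b x * (indicator (cbox a b) x *\<^sub>R g x)) \<in> borel_measurable lebesgue" for n
      proof (rule borel_measurable_times)
        show "bump n a b \<in> borel_measurable lebesgue"
          using borel_measurable_test_function(1)[OF test_function_bump[OF ab]]
          by (simp add: measurable_completion)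
        show "(\<lambda>x. indicator (cbox a b) x *\<^sub>R g x) \<in> borel_measurable lebesgue"
          using gi by (rule borel_measurable_integrable)
      qed
      show "(\<lambda>x. indicator (box a b) x * (indicator (cbox a b) x *\<^sub>R g x)) \<in> borel_measurable lebesgue"
        by (rule borel_measurable_times[OF borel_measurable_indicator borel_measurable_integrable[OF gi]])
          (rule fmeasurableD[OF lmeasurable_box])
    qed
    moreover have "(\<integral>x. bump n a b x * (indicator (cbox a b) x *\<^sub>R g x) \<partial>lebesgue) = 0" for n
    proof -
      have "0 = (\<integral>x. g x * bump n a b x \<partial>lebesgue_on \<Omega>)"
        using z[OF test_function_bump[OF ab]] by simp
      also have "\<dots> = (\<integral>x. indicator \<Omega> x *\<^sub>R (g x * bump n a b x) \<partial>lebesgue)"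
        using \<Omega> by (subst integral_restrict_space) auto
      also have "(\<lambda>x. indicator \<Omega> x *\<^sub>R (g x * bump n a b x)) =
          (\<lambda>x. bump n a b x * (indicator (cbox a b) x *\<^sub>R g x))"
        using ab box_subset_cbox[of a b] bump_pos_iff[of n a b]
        by (auto simp: fun_eq_iff indicator_def)
      finally show ?thesis by simp
    qed
    ultimately have "(\<integral>x. indicator (box a b) x * (indicator (cbox a b) x *\<^sub>R g x) \<partial>lebesgue) = 0"
      by (simp add: LIMSEQ_const_iff)
    also have "(\<lambda>x. indicator (box a b) x * (indicator (cbox a b) x *\<^sub>R g x))
        = (\<lambda>x. indicator (box a b) x *\<^sub>R g x)"
      using box_subset_cbox[of a b] by (auto simp: fun_eq_iff indicator_def)
    finally have "(LINT x:box a b | lebesgue. g x) = 0" by (simp add: set_lebesgue_integral_def)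
    moreover have "set_integrable lebesgue (box a b) g"
    proof (rule set_integrable_subset)
      show "set_integrable lebesgue (cbox a b) g" using gi by (simp add: set_integrable_def)
    qed (auto simp: box_subset_cbox)
    ultimately have "integral (box a b) g = 0" by (simp add: set_lebesgue_integral_eq_integral)
    then show ?thesis by (simp add: integral_open_interval)
  qed
  have loc: "AE x in lebesgue. x \<in> box a b \<longrightarrow> g x = 0" if ab: "cbox a b \<subseteq> \<Omega>" for a b
  proof -
    \<comment> \<open>Extension by zero, since the differentiation theorem asks for integrability
      over all boxes of the space; on small cubes at an interior point F and g agree.\<close>
    define F where "F x = (if x \<in> cbox a b then g x else 0)" for x
    have "g absolutely_integrable_on cbox a b"
      using assms(2) ab by (auto simp: loc_integrable_def)
    then have "F integrable_on UNIV"
      unfolding F_def using integrable_restrict_UNIV set_lebesgue_integral_eq_integral(1) by blast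
    then have "F integrable_on cbox c d" for c d
      using integrable_on_subcbox by blast
    then obtain N where N: "negligible N" "\<And>x e. \<lbrakk>x \<notin> N; 0 < e\<rbrakk> \<Longrightarrow> \<exists>d>0. \<forall>h. 0 < h \<and> h < d \<longrightarrow>
        norm(integral (cbox x (x + h *\<^sub>R One)) F /\<^sub>R h ^ DIM('a) - F x) < e"
      using integrable_ccontinuous_explicit[of F] by metis
    have "g x = 0" if x: "x \<in> box a b" "x \<notin> N" for x
    proof (rule ccontr)
      assume "g x \<noteq> 0"
      then obtain d where d: "d > 0" "\<And>h. 0 < h \<Longrightarrow> h < d \<Longrightarrow>
          norm(integral (cbox x (x + h *\<^sub>R One)) F /\<^sub>R h ^ DIM('a) - F x) < \<bar>g x\<bar>"
        using N(2)[OF x(2), of "\<bar>g x\<bar>"] by auto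
      obtain r where r: "r > 0" "ball x r \<subseteq> box a b" using x(1) open_box open_contains_ball by blast
      \<comment> \<open>Small enough that the cube with lower corner x and side h, whose diameter is
        h times the norm of \<open>One\<close>, stays in the ball of radius r.\<close>
      define h where "h = min (d / 2) (r / (2 * norm (One::'a)))"
      have "norm (One::'a) > 0" by simp
      then have h: "h > 0" "h < d" using d r by (auto simp: h_def)
      have "cbox x (x + h *\<^sub>R One) \<subseteq> box a b"
      proof
        fix y assume "y \<in> cbox x (x + h *\<^sub>R One)"
        then have "norm (y - x) \<le> norm (h *\<^sub>R One :: 'a)"
          by (intro norm_le_componentwise)
            (use h in \<open>auto simp: mem_box inner_diff_left inner_add_left abs_le_iff\<close>)
        also have "\<dots> \<le> r / 2"
          using \<open>norm (One::'a) > 0\<close> h by (simp add: h_def field_simps min_def)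
        also have "\<dots> < r" using r by simp
        finally have "y \<in> ball x r" by (simp add: dist_norm norm_minus_commute)
        then show "y \<in> box a b" using r by auto
      qed
      with box_subset_cbox[of a b] have sub: "cbox x (x + h *\<^sub>R One) \<subseteq> cbox a b" by blast
      have "integral (cbox x (x + h *\<^sub>R One)) F = integral (cbox x (x + h *\<^sub>R One)) g"
        using sub by (intro integral_cong) (auto simp: F_def)
      also have "\<dots> = 0" using sub ab by (intro box0) auto
      finally have "\<bar>F x\<bar> < \<bar>g x\<bar>" using d(2)[OF h] by simp
      moreover have "F x = g x" using x(1) box_subset_cbox[of a b] by (auto simp: F_def)
      ultimately show False by simp
    qed
    moreover have "AE x in lebesgue. x \<notin> N"
      using N(1) by (simp add: AE_not_in negligible_iff_null_sets)
    ultimately show ?thesis by auto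
  qed
  obtain \<D> where D: "countable \<D>" "\<D> \<subseteq> Pow \<Omega>" "\<And>X. X \<in> \<D> \<Longrightarrow> \<exists>a b. X = cbox a b" "\<Union>\<D> = \<Omega>"
    using open_countable_Union_open_cbox[OF assms(1)] by metis
  have "AE x in lebesgue. \<forall>X\<in>\<D>. x \<in> X \<longrightarrow> g x = 0"
  proof (subst AE_ball_countable[OF D(1)], intro ballI)
    fix X assume X: "X \<in> \<D>"
    then obtain a b where ab: "X = cbox a b" using D by blast
    \<comment> \<open>The local statement concerns open boxes while the cover consists of closed
      ones; the faces are negligible.\<close>
    have "AE x in lebesgue. x \<notin> cbox a b - box a b"
      by (rule AE_not_in) (metis negligible_frontier_interval negligible_iff_null_sets)
    moreover have "AE x in lebesgue. x \<in> box a b \<longrightarrow> g x = 0"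
      using X D ab by (intro loc) auto
    ultimately show "AE x in lebesgue. x \<in> X \<longrightarrow> g x = 0" using ab by auto
  qed
  then have "AE x in lebesgue. x \<in> \<Omega> \<longrightarrow> g x = 0" using D(4) by auto
  then show ?thesis using \<Omega> by (subst AE_restrict_space_iff) auto
qed

lemma loc_integrable_diff:
  "loc_integrable \<Omega> f \<Longrightarrow> loc_integrable \<Omega> g \<Longrightarrow> loc_integrable \<Omega> (\<lambda>x. f x - g x)"
  unfolding loc_integrable_def by (auto intro: set_integral_diff)

lemma loc_integrable_inner:
  assumes "loc_integrable \<Omega> g" shows "loc_integrable \<Omega> (\<lambda>x. g x \<bullet> i)"
proof -
  have "integrable lebesgue (\<lambda>x. indicator K x *\<^sub>R (g x \<bullet> i))" if "compact K" "K \<subseteq> \<Omega>" for K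
  proof -
    have "integrable lebesgue (\<lambda>x. indicator K x *\<^sub>R g x)"
      using assms that by (auto simp: loc_integrable_def set_integrable_def)
    from integrable_inner_left[OF this, of i] show ?thesis by simp
  qed
  then show ?thesis by (auto simp: loc_integrable_def set_integrable_def)
qed

text \<open>Each component of the difference integrates to 0 against every test function. This makes
  the choice in \<open>weak_grad\<close> immaterial under integrals.\<close>

lemma weak_grad_unique:
  assumes "open \<Omega>" "has_weak_grad \<Omega> u g" "has_weak_grad \<Omega> u h"
  shows "AE x in lebesgue_on \<Omega>. g x = h x"
proof -
  have \<Omega>: "\<Omega> \<in> sets lebesgue" using assms(1) by (simp add: borel_open)
  have l: "loc_integrable \<Omega> g" "loc_integrable \<Omega> h" using assms by (auto simp: has_weak_grad_def)
  have "AE x in lebesgue_on \<Omega>. \<forall>i\<in>Basis. (g x - h x) \<bullet> i = 0"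
  proof (subst AE_ball_countable)
    show "countable (Basis :: 'a set)" by (simp add: countable_finite)
    show "\<forall>i\<in>Basis. AE x in lebesgue_on \<Omega>. (g x - h x) \<bullet> i = 0"
    proof (intro ballI AE_zero_if_test_integrals_zero assms(1))
      fix i :: 'a assume i: "i \<in> Basis"
      have "loc_integrable \<Omega> (\<lambda>x. g x - h x)" using l by (rule loc_integrable_diff)
      then show "loc_integrable \<Omega> (\<lambda>x. (g x - h x) \<bullet> i)" by (rule loc_integrable_inner)
      fix \<psi> assume \<psi>: "test_function \<Omega> \<psi>"
      have i1: "integrable (lebesgue_on \<Omega>) (\<lambda>x. (k x \<bullet> i) * \<psi> x)" if "loc_integrable \<Omega> k" for k
        using integrable_inner_left[OF loc_integrable_test_function_mult(1)[OF that \<Omega> \<psi>], of i]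
        by (simp add: mult.commute)
      have "(\<integral>x. (g x \<bullet> i) * \<psi> x \<partial>lebesgue_on \<Omega>) = (\<integral>x. (h x \<bullet> i) * \<psi> x \<partial>lebesgue_on \<Omega>)"
        using assms(2,3) i \<psi> unfolding has_weak_grad_def by fastforce
      then show "(\<integral>x. ((g x - h x) \<bullet> i) * \<psi> x \<partial>lebesgue_on \<Omega>) = 0"
        using i1[OF l(1)] i1[OF l(2)] by (simp add: inner_diff_left left_diff_distrib)
    qed
  qed
  then show ?thesis
    by (rule AE_mp) (auto intro!: AE_I2 euclidean_eqI[of "g _"] simp: inner_diff_left)
qed

lemma has_weak_grad_weak_grad: "has_weak_grad \<Omega> u g \<Longrightarrow> has_weak_grad \<Omega> u (weak_grad \<Omega> u)"
  unfolding weak_grad_def by (rule someI[of "has_weak_grad \<Omega> u"])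

lemma weak_grad_AE_eq:
  assumes "open \<Omega>" "has_weak_grad \<Omega> u g"
  shows "AE x in lebesgue_on \<Omega>. weak_grad \<Omega> u x = g x"
  using weak_grad_unique[OF assms(1) has_weak_grad_weak_grad[OF assms(2)] assms(2)] .

section \<open>Limits of test functions and the chain rule\<close>

text \<open>The p-th power of the L^p norm, with values in \<open>ennreal\<close> so that sums,
  bounds and limits can be handled before integrability is known.\<close>

definition pint :: "'a measure \<Rightarrow> real \<Rightarrow> ('a \<Rightarrow> 'b::real_normed_vector) \<Rightarrow> ennreal" where
  "pint M p f = (\<integral>\<^sup>+x. ennreal (norm (f x) powr p) \<partial>M)"

text \<open>A substitute for Minkowski's inequality: the norm of the sum is at most twice the larger
  norm. The constant is harmless, because only finiteness and convergence to 0 are derived from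
  it.\<close>

lemma powr_norm_add_le:
  fixes a b :: "'b::real_normed_vector"
  assumes "p \<ge> 0"
  shows "norm (a + b) powr p \<le> 2 powr p * (norm a powr p + norm b powr p)"
proof -
  have "norm (a + b) \<le> 2 * max (norm a) (norm b)"
    using norm_triangle_ineq[of a b] by (auto simp: max_def)
  then have "norm (a + b) powr p \<le> (2 * max (norm a) (norm b)) powr p"
    using assms by (intro powr_mono2) auto
  also have "\<dots> = 2 powr p * max (norm a) (norm b) powr p"
    by (simp add: powr_mult)
  also have "\<dots> \<le> 2 powr p * (norm a powr p + norm b powr p)"
    by (intro mult_left_mono) (auto simp: max_def)
  finally show ?thesis .
qed

lemma pint_add:
  fixes f g :: "'a \<Rightarrow> 'b::{real_normed_vector, second_countable_topology}"
  assumes "f \<in> borel_measurable M" "g \<in> borel_measurable M" "p \<ge> 0"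
  shows "pint M p (\<lambda>x. f x + g x) \<le> ennreal (2 powr p) * (pint M p f + pint M p g)"
proof -
  note [measurable] = assms(1,2)
  have "pint M p (\<lambda>x. f x + g x) \<le>
      (\<integral>\<^sup>+x. ennreal (2 powr p) * (ennreal (norm (f x) powr p) + ennreal (norm (g x) powr p)) \<partial>M)"
    unfolding pint_def
  proof (rule nn_integral_mono)
    show "ennreal (norm (f x + g x) powr p)
      \<le> ennreal (2 powr p) * (ennreal (norm (f x) powr p) + ennreal (norm (g x) powr p))" for x
      using powr_norm_add_le[OF assms(3), of "f x" "g x"]
      by (simp flip: ennreal_mult ennreal_plus)
  qed
  also have "\<dots> = ennreal (2 powr p) * (pint M p f + pint M p g)"
    unfolding pint_def by (simp add: nn_integral_cmult nn_integral_add)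
  finally show ?thesis .
qed

lemma pint_mono_AE:
  assumes "AE x in M. norm (f x) \<le> norm (g x)" "p \<ge> 0"
  shows "pint M p f \<le> pint M p g"
  unfolding pint_def using assms(1)
  by (intro nn_integral_mono_AE) (auto intro!: ennreal_leI powr_mono2 assms(2))

lemma pint_cong_AE: "(AE x in M. norm (f x) = norm (g x)) \<Longrightarrow> pint M p f = pint M p g"
  unfolding pint_def by (intro nn_integral_cong_AE) auto

lemma pint_scale:
  fixes f :: "'a \<Rightarrow> 'b::{real_normed_vector, second_countable_topology}"
  assumes "f \<in> borel_measurable M"
  shows "pint M p (\<lambda>x. c *\<^sub>R f x) = ennreal (\<bar>c\<bar> powr p) * pint M p f"
proof -
  note [measurable] = assms
  show ?thesis
    unfolding pint_def by (simp add: powr_mult ennreal_mult nn_integral_cmult)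
qed

lemma pint_bounded_mult:
  fixes f :: "'a \<Rightarrow> 'b::{real_normed_vector, second_countable_topology}"
  assumes "f \<in> borel_measurable M" "\<And>x. \<bar>\<rho> x\<bar> \<le> B" "p \<ge> 0"
  shows "pint M p (\<lambda>x. \<rho> x *\<^sub>R f x) \<le> ennreal (B powr p) * pint M p f"
proof -
  have B: "B \<ge> 0" using assms(2) abs_ge_zero order_trans by blast
  have "pint M p (\<lambda>x. \<rho> x *\<^sub>R f x) \<le> pint M p (\<lambda>x. B *\<^sub>R f x)"
    using B by (intro pint_mono_AE assms(3) AE_I2) (auto intro!: mult_right_mono assms(2))
  then show ?thesis using pint_scale[OF assms(1), of p B] B by simp
qed

lemma tendsto_ennreal_zero_cmult:
  fixes f :: "'i \<Rightarrow> ennreal"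
  assumes "(f \<longlongrightarrow> 0) F" shows "((\<lambda>n. ennreal c * f n) \<longlongrightarrow> 0) F"
  using ennreal_tendsto_cmult[of "ennreal c", OF _ assms] by simp

lemma tendsto_ennreal_zero_squeeze:
  fixes f :: "'i \<Rightarrow> ennreal"
  assumes "(g \<longlongrightarrow> 0) F" "\<And>n. f n \<le> g n" shows "(f \<longlongrightarrow> 0) F"
  by (rule tendsto_sandwich[OF _ _ tendsto_const assms(1)]) (auto simp: assms(2))

lemma pint_add_tendsto_0:
  fixes f g :: "nat \<Rightarrow> 'a \<Rightarrow> 'b::{real_normed_vector, second_countable_topology}"
  assumes "\<And>n. f n \<in> borel_measurable M" "\<And>n. g n \<in> borel_measurable M" "p \<ge> 0"
    and "(\<lambda>n. pint M p (f n)) \<longlonglongrightarrow> 0" "(\<lambda>n. pint M p (g n)) \<longlonglongrightarrow> 0"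
  shows "(\<lambda>n. pint M p (\<lambda>x. f n x + g n x)) \<longlonglongrightarrow> 0"
proof (rule tendsto_ennreal_zero_squeeze)
  show "(\<lambda>n. ennreal (2 powr p) * (pint M p (f n) + pint M p (g n))) \<longlonglongrightarrow> 0"
    using tendsto_add[OF assms(4,5)] by (intro tendsto_ennreal_zero_cmult) simp
qed (intro pint_add assms)

lemma pint_bounded_mult_tendsto_0:
  fixes f :: "nat \<Rightarrow> 'a \<Rightarrow> 'b::{real_normed_vector, second_countable_topology}"
  assumes "\<And>n. f n \<in> borel_measurable M" "\<And>n x. \<bar>\<rho> n x\<bar> \<le> B" "p \<ge> 0"
    and "(\<lambda>n. pint M p (f n)) \<longlonglongrightarrow> 0"
  shows "(\<lambda>n. pint M p (\<lambda>x. \<rho> n x *\<^sub>R f n x)) \<longlonglongrightarrow> 0"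
  by (rule tendsto_ennreal_zero_squeeze[OF tendsto_ennreal_zero_cmult[OF assms(4)]])
    (rule pint_bounded_mult[OF assms(1-3)])

lemma pint_dominated_tendsto_0:
  fixes f :: "nat \<Rightarrow> 'a \<Rightarrow> 'b::{real_normed_vector, second_countable_topology}"
    and w :: "'a \<Rightarrow> 'c::{real_normed_vector, second_countable_topology}"
  assumes [measurable]: "\<And>n. f n \<in> borel_measurable M" "w \<in> borel_measurable M" and "p > 0"
    and "AE x in M. (\<lambda>n. f n x) \<longlonglongrightarrow> 0" "\<And>n. AE x in M. norm (f n x) \<le> norm (w x)"
    and "pint M p w < \<infinity>"
  shows "(\<lambda>n. pint M p (f n)) \<longlonglongrightarrow> 0"
proof -
  have "(\<lambda>n. pint M p (f n)) \<longlonglongrightarrow> (\<integral>\<^sup>+x. 0 \<partial>M)"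
    unfolding pint_def
  proof (rule nn_integral_dominated_convergence)
    show "(\<integral>\<^sup>+ x. ennreal (norm (w x) powr p) \<partial>M) < \<infinity>" using assms(6) by (simp add: pint_def)
    show "AE x in M. ennreal (norm (f n x) powr p) \<le> ennreal (norm (w x) powr p)" for n
      using assms(5)[of n] by eventually_elim (use assms(3) in \<open>auto intro!: ennreal_leI powr_mono2\<close>)
    show "AE x in M. (\<lambda>n. ennreal (norm (f n x) powr p)) \<longlonglongrightarrow> 0"
      using assms(4)
    proof eventually_elim
      case (elim x)
      have "(\<lambda>n. norm (f n x) powr p) \<longlonglongrightarrow> 0 powr p"
        using tendsto_norm_zero[OF elim] assms(3)
        by (intro tendsto_powr' tendsto_const) auto
      from tendsto_ennrealI[OF this] show ?case using assms(3) by simp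
    qed
  qed measurable
  then show ?thesis by simp
qed

lemma pint_tendsto_0_AE_subseq:
  fixes f :: "nat \<Rightarrow> 'a \<Rightarrow> 'b::{real_normed_vector, second_countable_topology}"
  assumes [measurable]: "\<And>n. f n \<in> borel_measurable M" and "p > 0" "(\<lambda>n. pint M p (f n)) \<longlonglongrightarrow> 0"
    and fin: "\<And>n. pint M p (f n) < \<infinity>"
  shows "\<exists>r. strict_mono r \<and> (AE x in M. (\<lambda>n. f (r n) x) \<longlonglongrightarrow> 0)"
proof -
  have int: "integrable M (\<lambda>x. norm (f n x) powr p)" for n
    using fin[of n] by (intro integrableI_bounded) (auto simp: pint_def)
  have "(\<lambda>n. \<integral>x. norm (norm (f n x) powr p) \<partial>M) \<longlonglongrightarrow> 0"
  proof -
    have "(\<integral>x. norm (norm (f n x) powr p) \<partial>M) = enn2real (pint M p (f n))" for n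
      using int[of n] by (simp add: pint_def integral_eq_nn_integral)
    then show ?thesis using tendsto_enn2real[of "\<lambda>n. pint M p (f n)" 0] assms(3) by simp
  qed
  from tendsto_L1_AE_subseq[OF int this] obtain r where r: "strict_mono r"
    "AE x in M. (\<lambda>n. norm (f (r n) x) powr p) \<longlonglongrightarrow> 0" by blast
  have "AE x in M. (\<lambda>n. f (r n) x) \<longlonglongrightarrow> 0"
    using r(2)
  proof eventually_elim
    case (elim x)
    have "(\<lambda>n. (norm (f (r n) x) powr p) powr (1/p)) \<longlonglongrightarrow> 0 powr (1/p)"
      using assms(2) by (intro tendsto_powr' elim tendsto_const) auto
    then show ?case using assms(2) by (simp add: powr_powr tendsto_norm_zero_iff)
  qed
  with r(1) show ?thesis by blast
qed

text \<open>The bound passes to the pointwise limit f, so twice the bound dominates the differences.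
  Growth of this form is that of a Lipschitz function of two variables vanishing at the
  origin.\<close>

lemma pint_dominated_pair_tendsto_0:
  fixes F :: "nat \<Rightarrow> 'a \<Rightarrow> 'b::{real_normed_vector, second_countable_topology}"
    and a b :: "'a \<Rightarrow> 'c::{real_normed_vector, second_countable_topology}"
  assumes [measurable]: "\<And>n. F n \<in> borel_measurable M" "f \<in> borel_measurable M"
      "a \<in> borel_measurable M" "b \<in> borel_measurable M" and p: "p > 0"
    and fi: "pint M p a < \<infinity>" "pint M p b < \<infinity>"
    and l: "AE x in M. (\<lambda>n. F n x) \<longlonglongrightarrow> f x"
    and bd: "\<And>n x. norm (F n x) \<le> c * (norm (a x) + norm (b x))"
  shows "(\<lambda>n. pint M p (\<lambda>x. F n x - f x)) \<longlonglongrightarrow> 0"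
proof (rule pint_dominated_tendsto_0)
  define w where "w = (\<lambda>x. (2 * c) *\<^sub>R (norm (a x) + norm (b x)))"
  show w [measurable]: "w \<in> borel_measurable M" unfolding w_def by measurable
  have e: "pint M p (\<lambda>x. norm (a x)) = pint M p a" "pint M p (\<lambda>x. norm (b x)) = pint M p b"
    by (auto intro!: pint_cong_AE)
  have "pint M p (\<lambda>x. norm (a x) + norm (b x)) \<le> ennreal (2 powr p) * (pint M p a + pint M p b)"
    using pint_add[of "\<lambda>x. norm (a x)" M "\<lambda>x. norm (b x)" p] p e by simp
  also have "\<dots> < \<infinity>" using fi by (simp add: ennreal_mult_less_top)
  finally show "pint M p w < \<infinity>"
    unfolding w_def by (subst pint_scale) (auto simp: ennreal_mult_less_top)
  show "AE x in M. (\<lambda>n. F n x - f x) \<longlonglongrightarrow> 0" using l by (simp add: LIM_zero_iff)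
  show "AE x in M. norm (F n x - f x) \<le> norm (w x)" for n
    using l
  proof eventually_elim
    case (elim x)
    have "norm (f x) \<le> c * (norm (a x) + norm (b x))"
      by (rule tendsto_upperbound[OF tendsto_norm[OF elim]]) (auto simp: bd)
    then have "norm (F n x - f x) \<le> (2 * c) * (norm (a x) + norm (b x))"
      using bd[of n x] norm_triangle_ineq4[of "F n x" "f x"] by simp
    also have "\<dots> \<le> norm (w x)" unfolding w_def by (simp only: real_scaleR_def real_norm_def abs_ge_self)
    finally show ?case .
  qed
qed (use p in auto)

section \<open>The closure of the test functions and its chain rule\<close>

locale finite_domain =
  fixes \<Omega> :: "'a::euclidean_space set" and p :: real
  assumes open_domain: "open \<Omega>" and finite_measure_domain: "emeasure lebesgue \<Omega> < \<infinity>"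
    and p_gt_1: "1 < p"
begin

abbreviation M where "M \<equiv> lebesgue_on \<Omega>"

lemma domain_sets [simp]: "\<Omega> \<in> sets lebesgue"
  using open_domain by (simp add: borel_open)

sublocale finite_measure M
  using finite_measure_domain by (intro finite_measureI) (simp add: emeasure_restrict_space)

lemma pint_const_finite: "pint M p (\<lambda>x. c) < \<infinity>"
proof -
  have "emeasure M \<Omega> < top" using emeasure_finite[of \<Omega>] by (simp add: less_top[symmetric])
  then show ?thesis by (simp add: pint_def ennreal_mult_less_top)
qed

lemma borel_measurable_test [measurable (raw)]:
  "test_function \<Omega> f \<Longrightarrow> f \<in> borel_measurable M"
  "test_function \<Omega> f \<Longrightarrow> grad f \<in> borel_measurable M"
  by (auto intro!: borel_measurable_lebesgue_onI borel_measurable_test_function)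

lemma pint_test_function_finite:
  assumes "test_function \<Omega> f" shows "pint M p f < \<infinity>" "pint M p (grad f) < \<infinity>"
proof -
  obtain B where B: "B > 0" "\<And>x. \<bar>f x\<bar> \<le> B" "\<And>x. norm (grad f x) \<le> B"
    using test_function_bounded[OF assms] by metis
  have "pint M p f \<le> pint M p (\<lambda>x. B)" "pint M p (grad f) \<le> pint M p (\<lambda>x. B)"
    using B p_gt_1 by (auto intro!: pint_mono_AE AE_I2)
  then show "pint M p f < \<infinity>" "pint M p (grad f) < \<infinity>"
    using pint_const_finite[of B] by (auto intro: le_less_trans)
qed

text \<open>Membership in W_0^{1,p} with the gradient kept as an explicit argument: (u, g) lies in
  the closure in L^p of the pairs (\<psi>, grad \<psi>). Gradients can then be computed by formulas
  and compared with the representative \<open>weak_grad\<close> afterwards.\<close>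

definition sobolev0 :: "('a \<Rightarrow> real) \<Rightarrow> ('a \<Rightarrow> 'a) \<Rightarrow> bool" where
  "sobolev0 u g \<longleftrightarrow> u \<in> borel_measurable M \<and> g \<in> borel_measurable M \<and>
     (\<forall>e>0. \<exists>\<psi>. test_function \<Omega> \<psi> \<and> pint M p (\<lambda>x. \<psi> x - u x) < ennreal e
        \<and> pint M p (\<lambda>x. grad \<psi> x - g x) < ennreal e)"

lemma sobolev0_measurable:
  assumes "sobolev0 u g" shows "u \<in> borel_measurable M" "g \<in> borel_measurable M"
  using assms by (auto simp: sobolev0_def)

lemma ennreal_less_half:
  fixes a b :: ennreal
  assumes "a < ennreal e" "b < ennreal e" "e > 0" "c > 0"
  shows "ennreal c * (a + b) < ennreal (c * (2 * e))"
proof -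
  have "a + b < ennreal e + ennreal e"
    using assms by (intro add_strict_mono)
  then have "ennreal c * (a + b) < ennreal c * (ennreal e + ennreal e)"
    using assms by (intro ennreal_mult_strict_left_mono) auto
  then show ?thesis using assms by (simp flip: ennreal_plus ennreal_mult) 
qed

lemma sobolev0_limit:
  assumes "u \<in> borel_measurable M" "g \<in> borel_measurable M"
    and "\<And>e. e > 0 \<Longrightarrow> \<exists>u' g'. sobolev0 u' g' \<and> pint M p (\<lambda>x. u' x - u x) < ennreal e
        \<and> pint M p (\<lambda>x. g' x - g x) < ennreal e"
  shows "sobolev0 u g"
  unfolding sobolev0_def
proof (intro conjI assms(1,2) allI impI)
  fix e :: real assume "e > 0"
  \<comment> \<open>Two errors of size d, multiplied by the constant 2^p of \<open>pint_add\<close>,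
    add up to e.\<close>
  define d where "d = e / (2 powr p * 2)"
  have d: "d > 0" "2 powr p * (2 * d) = e" using \<open>e > 0\<close> by (auto simp: d_def)
  obtain u' g' where u': "sobolev0 u' g'" "pint M p (\<lambda>x. u' x - u x) < ennreal d"
    "pint M p (\<lambda>x. g' x - g x) < ennreal d" using assms(3)[OF d(1)] by blast
  obtain \<psi> where \<psi>: "test_function \<Omega> \<psi>" "pint M p (\<lambda>x. \<psi> x - u' x) < ennreal d"
    "pint M p (\<lambda>x. grad \<psi> x - g' x) < ennreal d" using u'(1) d(1) unfolding sobolev0_def by blast
  note m [measurable] = borel_measurable_test[OF \<psi>(1)] sobolev0_measurable[OF u'(1)] assms(1,2)
  have "pint M p (\<lambda>x. \<psi> x - u x) \<le> ennreal (2 powr p) * (pint M p (\<lambda>x. \<psi> x - u' x) + pint M p (\<lambda>x. u' x - u x))"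
    using pint_add[of "\<lambda>x. \<psi> x - u' x" M "\<lambda>x. u' x - u x" p] p_gt_1 by simp
  also have "\<dots> < ennreal e"
    using ennreal_less_half[OF \<psi>(2) u'(2) d(1), of "2 powr p"] by (simp add: d(2))
  finally have 1: "pint M p (\<lambda>x. \<psi> x - u x) < ennreal e" .
  have "pint M p (\<lambda>x. grad \<psi> x - g x) \<le> ennreal (2 powr p) * (pint M p (\<lambda>x. grad \<psi> x - g' x) + pint M p (\<lambda>x. g' x - g x))"
    using pint_add[of "\<lambda>x. grad \<psi> x - g' x" M "\<lambda>x. g' x - g x" p] p_gt_1 by simp
  also have "\<dots> < ennreal e"
    using ennreal_less_half[OF \<psi>(3) u'(3) d(1), of "2 powr p"] by (simp add: d(2))
  finally show "\<exists>\<psi>. test_function \<Omega> \<psi> \<and> pint M p (\<lambda>x. \<psi> x - u x) < ennreal e \<and>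
      pint M p (\<lambda>x. grad \<psi> x - g x) < ennreal e"
    using 1 \<psi>(1) by blast
qed

lemma sobolev0_limit_seq:
  assumes "u \<in> borel_measurable M" "g \<in> borel_measurable M" "\<And>n::nat. sobolev0 (v n) (k n)"
    and "(\<lambda>n. pint M p (\<lambda>x. v n x - u x)) \<longlonglongrightarrow> 0" "(\<lambda>n. pint M p (\<lambda>x. k n x - g x)) \<longlonglongrightarrow> 0"
  shows "sobolev0 u g"
proof (rule sobolev0_limit[OF assms(1,2)])
  fix e :: real assume "e > 0"
  then have "\<forall>\<^sub>F n in sequentially. pint M p (\<lambda>x. v n x - u x) < ennreal e \<and> pint M p (\<lambda>x. k n x - g x) < ennreal e"
    using order_tendstoD(2)[OF assms(4), of "ennreal e"] order_tendstoD(2)[OF assms(5), of "ennreal e"]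
    by (intro eventually_conj) auto
  then obtain n where "pint M p (\<lambda>x. v n x - u x) < ennreal e \<and> pint M p (\<lambda>x. k n x - g x) < ennreal e"
    by (auto dest: eventually_happens)
  with assms(3) show "\<exists>u' g'. sobolev0 u' g' \<and> pint M p (\<lambda>x. u' x - u x) < ennreal e
        \<and> pint M p (\<lambda>x. g' x - g x) < ennreal e" by blast
qed

lemma sobolev0_test_function: "test_function \<Omega> \<psi> \<Longrightarrow> sobolev0 \<psi> (grad \<psi>)"
  unfolding sobolev0_def using p_gt_1
  by (auto intro!: exI[of _ \<psi>] borel_measurable_test simp: pint_def)

lemma sobolev0_finite:
  assumes "sobolev0 u g" shows "pint M p u < \<infinity>" "pint M p g < \<infinity>"
proof -
  obtain \<psi> where \<psi>: "test_function \<Omega> \<psi>" "pint M p (\<lambda>x. \<psi> x - u x) < ennreal 1"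
    "pint M p (\<lambda>x. grad \<psi> x - g x) < ennreal 1" using assms unfolding sobolev0_def by (meson zero_less_one)
  note m [measurable] = borel_measurable_test[OF \<psi>(1)] sobolev0_measurable[OF assms]
  have "pint M p (\<lambda>x. u x - \<psi> x) = pint M p (\<lambda>x. \<psi> x - u x)"
     "pint M p (\<lambda>x. g x - grad \<psi> x) = pint M p (\<lambda>x. grad \<psi> x - g x)"
    by (auto intro!: pint_cong_AE simp: norm_minus_commute)
  then have f: "pint M p (\<lambda>x. u x - \<psi> x) < \<infinity>" "pint M p (\<lambda>x. g x - grad \<psi> x) < \<infinity>"
    using \<psi>(2,3) by (auto simp: less_top[symmetric] top_unique)
  have "pint M p u \<le> ennreal (2 powr p) * (pint M p (\<lambda>x. u x - \<psi> x) + pint M p \<psi>)"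
    using pint_add[of "\<lambda>x. u x - \<psi> x" M \<psi> p] p_gt_1 by simp
  also have "\<dots> < \<infinity>" using f pint_test_function_finite[OF \<psi>(1)] by (simp add: ennreal_mult_less_top)
  finally show "pint M p u < \<infinity>" .
  have "pint M p g \<le> ennreal (2 powr p) * (pint M p (\<lambda>x. g x - grad \<psi> x) + pint M p (grad \<psi>))"
    using pint_add[of "\<lambda>x. g x - grad \<psi> x" M "grad \<psi>" p] p_gt_1 by simp
  also have "\<dots> < \<infinity>" using f pint_test_function_finite[OF \<psi>(1)] by (simp add: ennreal_mult_less_top)
  finally show "pint M p g < \<infinity>" .
qed

lemma sobolev0_sequence:
  assumes "sobolev0 u g"
  shows "\<exists>\<psi>. (\<forall>n. test_function \<Omega> (\<psi> n)) \<and> (\<lambda>n. pint M p (\<lambda>x. \<psi> n x - u x)) \<longlonglongrightarrow> 0 \<and>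
    (\<lambda>n. pint M p (\<lambda>x. grad (\<psi> n) x - g x)) \<longlonglongrightarrow> 0 \<and> (AE x in M. (\<lambda>n. \<psi> n x) \<longlonglongrightarrow> u x)"
proof -
  have "\<exists>\<psi>. test_function \<Omega> \<psi> \<and> pint M p (\<lambda>x. \<psi> x - u x) < ennreal (1 / real (Suc n))
        \<and> pint M p (\<lambda>x. grad \<psi> x - g x) < ennreal (1 / real (Suc n))" for n
    using assms unfolding sobolev0_def by (metis of_nat_0_less_iff zero_less_Suc zero_less_divide_1_iff)
  then obtain \<psi> where \<psi>: "\<And>n. test_function \<Omega> (\<psi> n)"
    "\<And>n. pint M p (\<lambda>x. \<psi> n x - u x) < ennreal (1 / real (Suc n))"
    "\<And>n. pint M p (\<lambda>x. grad (\<psi> n) x - g x) < ennreal (1 / real (Suc n))" by metis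
  note m [measurable] = borel_measurable_test[OF \<psi>(1)] sobolev0_measurable[OF assms]
  have "(\<lambda>n. 1 / real (Suc n)) \<longlonglongrightarrow> 0" using LIMSEQ_inverse_real_of_nat by (simp add: inverse_eq_divide)
  from tendsto_ennrealI[OF this] have e0: "(\<lambda>n. ennreal (1 / real (Suc n))) \<longlonglongrightarrow> 0" by simp
  have l1: "(\<lambda>n. pint M p (\<lambda>x. \<psi> n x - u x)) \<longlonglongrightarrow> 0"
    by (rule tendsto_ennreal_zero_squeeze[OF e0]) (rule less_imp_le[OF \<psi>(2)])
  have l2: "(\<lambda>n. pint M p (\<lambda>x. grad (\<psi> n) x - g x)) \<longlonglongrightarrow> 0"
    by (rule tendsto_ennreal_zero_squeeze[OF e0]) (rule less_imp_le[OF \<psi>(3)])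
  have "\<exists>r. strict_mono r \<and> (AE x in M. (\<lambda>n. \<psi> (r n) x - u x) \<longlonglongrightarrow> 0)"
  proof (rule pint_tendsto_0_AE_subseq[OF _ _ l1])
    show "pint M p (\<lambda>x. \<psi> n x - u x) < \<infinity>" for n
      using \<psi>(2)[of n] by (rule less_le_trans) simp
  qed (use p_gt_1 in auto)
  then obtain r where r: "strict_mono r" "AE x in M. (\<lambda>n. \<psi> (r n) x - u x) \<longlonglongrightarrow> 0" by blast
  show ?thesis
  proof (intro exI[of _ "\<lambda>n. \<psi> (r n)"] conjI allI)
    show "AE x in M. (\<lambda>n. \<psi> (r n) x) \<longlonglongrightarrow> u x" using r(2) by (simp add: LIM_zero_iff)
    show "(\<lambda>n. pint M p (\<lambda>x. \<psi> (r n) x - u x)) \<longlonglongrightarrow> 0"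
      using LIMSEQ_subseq_LIMSEQ[OF l1 r(1)] by (simp add: o_def)
    show "(\<lambda>n. pint M p (\<lambda>x. grad (\<psi> (r n)) x - g x)) \<longlonglongrightarrow> 0"
      using LIMSEQ_subseq_LIMSEQ[OF l2 r(1)] by (simp add: o_def)
  qed (rule \<psi>(1))
qed

text \<open>H is a smooth function of two real variables whose partial derivatives P and Q are
  bounded by B. Smoothness is expressed through composition with smooth functions on the ambient
  space, which is how it is used, and \<open>H 0 0 = 0\<close> keeps supports compact.\<close>

definition smooth_lipschitz2 ::
    "(real \<Rightarrow> real \<Rightarrow> real) \<Rightarrow> (real \<Rightarrow> real \<Rightarrow> real) \<Rightarrow> (real \<Rightarrow> real \<Rightarrow> real) \<Rightarrow> real \<Rightarrow> bool" where
  "smooth_lipschitz2 H P Q B \<longleftrightarrow> H 0 0 = 0 \<and>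
     (\<forall>f g :: 'a \<Rightarrow> real. (\<forall>k. Ck k f) \<longrightarrow> (\<forall>k. Ck k g) \<longrightarrow> (\<forall>k. Ck k (\<lambda>x. H (f x) (g x)))) \<and>
     (\<forall>z. ((\<lambda>z. H (fst z) (snd z)) has_derivative
        (\<lambda>h. P (fst z) (snd z) * fst h + Q (fst z) (snd z) * snd h)) (at z)) \<and>
     continuous_on UNIV (\<lambda>z. P (fst z) (snd z)) \<and> continuous_on UNIV (\<lambda>z. Q (fst z) (snd z)) \<and>
     (\<forall>a b. \<bar>P a b\<bar> \<le> B \<and> \<bar>Q a b\<bar> \<le> B)"

context
  fixes H P Q B assumes H: "smooth_lipschitz2 H P Q B"
begin

lemma smooth_lipschitz2_nonneg: "0 \<le> B"
  using H abs_ge_zero[of "P 0 0"] unfolding smooth_lipschitz2_def by (meson order_trans)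

lemma smooth_lipschitz2_bound: "\<bar>P a b\<bar> \<le> B" "\<bar>Q a b\<bar> \<le> B"
  using H by (auto simp: smooth_lipschitz2_def)

lemma smooth_lipschitz2_derivative:
  "((\<lambda>z. H (fst z) (snd z)) has_derivative
        (\<lambda>h. P (fst z) (snd z) * fst h + Q (fst z) (snd z) * snd h)) (at z)"
  using H unfolding smooth_lipschitz2_def by blast

lemma smooth_lipschitz2_lipschitz:
  "\<bar>H a b - H a' b'\<bar> \<le> 2 * B * (\<bar>a - a'\<bar> + \<bar>b - b'\<bar>)"
proof -
  note B = smooth_lipschitz2_nonneg
  have "norm ((\<lambda>z. H (fst z) (snd z)) (a, b) - (\<lambda>z. H (fst z) (snd z)) (a', b')) \<le> (2 * B) * norm ((a, b) - (a', b'))"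
  proof (rule differentiable_bound[of UNIV])
    show "((\<lambda>z. H (fst z) (snd z)) has_derivative
        (\<lambda>h. P (fst z) (snd z) * fst h + Q (fst z) (snd z) * snd h)) (at z within UNIV)" for z
      using smooth_lipschitz2_derivative by simp
    show "onorm (\<lambda>h. P (fst z) (snd z) * fst h + Q (fst z) (snd z) * snd h) \<le> 2 * B" for z
    proof (rule onorm_bound)
      show "norm (P (fst z) (snd z) * fst h + Q (fst z) (snd z) * snd h) \<le> 2 * B * norm h" for h :: "real \<times> real"
      proof -
        have "\<bar>fst h\<bar> \<le> norm h" "\<bar>snd h\<bar> \<le> norm h"
          using norm_fst_le[of "fst h" "snd h"] norm_snd_le[of "snd h" "fst h"] by simp_all
        then have "\<bar>P (fst z) (snd z) * fst h\<bar> \<le> B * norm h" "\<bar>Q (fst z) (snd z) * snd h\<bar> \<le> B * norm h"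
          unfolding abs_mult by (auto intro!: mult_mono smooth_lipschitz2_bound B)
        then have "\<bar>P (fst z) (snd z) * fst h + Q (fst z) (snd z) * snd h\<bar> \<le> B * norm h + B * norm h"
          by linarith
        then show ?thesis by simp
      qed
    qed (use B in simp)
  qed auto
  also have "\<dots> \<le> (2 * B) * (\<bar>a - a'\<bar> + \<bar>b - b'\<bar>)"
    using norm_Pair_le[of "a - a'" "b - b'"] B by (intro mult_left_mono) auto
  finally show ?thesis by simp
qed

lemma smooth_lipschitz2_bound0: "\<bar>H a b\<bar> \<le> 2 * B * (\<bar>a\<bar> + \<bar>b\<bar>)"
  using smooth_lipschitz2_lipschitz[of a b 0 0] H by (simp add: smooth_lipschitz2_def)

lemma smooth_lipschitz2_isCont:
  "isCont (\<lambda>z. H (fst z) (snd z)) z" "isCont (\<lambda>z. P (fst z) (snd z)) z" "isCont (\<lambda>z. Q (fst z) (snd z)) z"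
proof -
  show "isCont (\<lambda>z. H (fst z) (snd z)) z"
    by (rule has_derivative_continuous[OF smooth_lipschitz2_derivative])
  have "continuous_on UNIV (\<lambda>z. P (fst z) (snd z))" "continuous_on UNIV (\<lambda>z. Q (fst z) (snd z))"
    using H unfolding smooth_lipschitz2_def by blast+
  then show "isCont (\<lambda>z. P (fst z) (snd z)) z" "isCont (\<lambda>z. Q (fst z) (snd z)) z"
    using continuous_on_interior[of UNIV _ z] by auto
qed

lemma smooth_lipschitz2_tendsto:
  assumes "(f \<longlongrightarrow> a) F" "(g \<longlongrightarrow> b) F"
  shows "((\<lambda>n. H (f n) (g n)) \<longlongrightarrow> H a b) F" "((\<lambda>n. P (f n) (g n)) \<longlongrightarrow> P a b) F"
    "((\<lambda>n. Q (f n) (g n)) \<longlongrightarrow> Q a b) F"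
  using isCont_tendsto_compose[OF smooth_lipschitz2_isCont(1) tendsto_Pair[OF assms]]
    isCont_tendsto_compose[OF smooth_lipschitz2_isCont(2) tendsto_Pair[OF assms]]
    isCont_tendsto_compose[OF smooth_lipschitz2_isCont(3) tendsto_Pair[OF assms]] by simp_all

lemma smooth_lipschitz2_measurable:
  assumes [measurable]: "f \<in> borel_measurable N" "g \<in> borel_measurable N"
  shows "(\<lambda>x. H (f x) (g x)) \<in> borel_measurable N" "(\<lambda>x. P (f x) (g x)) \<in> borel_measurable N"
    "(\<lambda>x. Q (f x) (g x)) \<in> borel_measurable N"
proof -
  have c: "continuous_on UNIV (\<lambda>z. H (fst z) (snd z))" "continuous_on UNIV (\<lambda>z. P (fst z) (snd z))"
    "continuous_on UNIV (\<lambda>z. Q (fst z) (snd z))"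
    using smooth_lipschitz2_isCont by (auto simp: continuous_on_eq_continuous_at)
  show "(\<lambda>x. H (f x) (g x)) \<in> borel_measurable N" "(\<lambda>x. P (f x) (g x)) \<in> borel_measurable N"
    "(\<lambda>x. Q (f x) (g x)) \<in> borel_measurable N"
    using borel_measurable_continuous_Pair[OF assms c(1)] borel_measurable_continuous_Pair[OF assms c(2)]
      borel_measurable_continuous_Pair[OF assms c(3)] by auto
qed

lemma smooth_lipschitz2_test_function:
  assumes f: "test_function \<Omega> f" and g: "test_function \<Omega> g"
  shows "test_function \<Omega> (\<lambda>x. H (f x) (g x))"
    and "grad (\<lambda>x. H (f x) (g x)) x = P (f x) (g x) *\<^sub>R grad f x + Q (f x) (g x) *\<^sub>R grad g x"
proof -
  have "{x. H (f x) (g x) \<noteq> 0} \<subseteq> {x. f x \<noteq> 0} \<union> {x. g x \<noteq> 0}"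
    using H by (auto simp: smooth_lipschitz2_def)
  then have s: "closure {x. H (f x) (g x) \<noteq> 0} \<subseteq> closure {x. f x \<noteq> 0} \<union> closure {x. g x \<noteq> 0}"
    using closure_mono by (metis closure_Un)
  have "bounded (closure {x. f x \<noteq> 0} \<union> closure {x. g x \<noteq> 0})"
    using f g by (auto simp: test_function_def compact_imp_bounded)
  with s have "bounded (closure {x. H (f x) (g x) \<noteq> 0})" by (rule bounded_subset[rotated])
  then have "compact (closure {x. H (f x) (g x) \<noteq> 0})" by (simp add: compact_eq_bounded_closed)
  moreover have "closure {x. H (f x) (g x) \<noteq> 0} \<subseteq> \<Omega>"
    using s f g unfolding test_function_def by blast
  moreover have "\<forall>k. Ck k (\<lambda>x. H (f x) (g x))"
    using H f g unfolding smooth_lipschitz2_def test_function_def by blast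
  ultimately show "test_function \<Omega> (\<lambda>x. H (f x) (g x))" by (simp add: test_function_def)
  show "grad (\<lambda>x. H (f x) (g x)) x = P (f x) (g x) *\<^sub>R grad f x + Q (f x) (g x) *\<^sub>R grad g x"
  proof (rule grad_eqI)
    have "((\<lambda>x. (f x, g x)) has_derivative (\<lambda>h. (grad f x \<bullet> h, grad g x \<bullet> h))) (at x)"
      by (intro has_derivative_Pair test_function_has_derivative[OF f] test_function_has_derivative[OF g])
    from has_derivative_compose[OF this smooth_lipschitz2_derivative]
    have "((\<lambda>x. H (f x) (g x)) has_derivative
        (\<lambda>h. P (f x) (g x) * (grad f x \<bullet> h) + Q (f x) (g x) * (grad g x \<bullet> h))) (at x)"
      by simp
    then show "((\<lambda>x. H (f x) (g x)) has_derivative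
        (\<lambda>h. (P (f x) (g x) *\<^sub>R grad f x + Q (f x) (g x) *\<^sub>R grad g x) \<bullet> h)) (at x)"
      by (rule has_derivative_eq_rhs) (auto simp: inner_add_left)
  qed
qed

text \<open>Along approximating test functions the values converge by the Lipschitz bound. The
  gradient error splits in two: bounded coefficients times converging gradients, and coefficients
  converging almost everywhere times the fixed gradients g and h, where dominated convergence
  applies.\<close>

lemma sobolev0_chain:
  assumes u: "sobolev0 u g" and w: "sobolev0 w h"
  shows "sobolev0 (\<lambda>x. H (u x) (w x)) (\<lambda>x. P (u x) (w x) *\<^sub>R g x + Q (u x) (w x) *\<^sub>R h x)"
proof -
  obtain \<psi> where \<psi>: "\<And>n. test_function \<Omega> (\<psi> n)" "(\<lambda>n. pint M p (\<lambda>x. \<psi> n x - u x)) \<longlonglongrightarrow> 0"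
    "(\<lambda>n. pint M p (\<lambda>x. grad (\<psi> n) x - g x)) \<longlonglongrightarrow> 0" "AE x in M. (\<lambda>n. \<psi> n x) \<longlonglongrightarrow> u x"
    using sobolev0_sequence[OF u] by blast
  obtain \<eta> where \<eta>: "\<And>n. test_function \<Omega> (\<eta> n)" "(\<lambda>n. pint M p (\<lambda>x. \<eta> n x - w x)) \<longlonglongrightarrow> 0"
    "(\<lambda>n. pint M p (\<lambda>x. grad (\<eta> n) x - h x)) \<longlonglongrightarrow> 0" "AE x in M. (\<lambda>n. \<eta> n x) \<longlonglongrightarrow> w x"
    using sobolev0_sequence[OF w] by blast
  note [measurable] = borel_measurable_test[OF \<psi>(1)] borel_measurable_test[OF \<eta>(1)]
    sobolev0_measurable[OF u] sobolev0_measurable[OF w]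
  note mm = smooth_lipschitz2_measurable
  have [measurable]: "(\<lambda>x. H (u x) (w x)) \<in> borel_measurable M" "(\<lambda>x. P (u x) (w x)) \<in> borel_measurable M"
    "(\<lambda>x. Q (u x) (w x)) \<in> borel_measurable M" by (auto intro!: mm)
  have [measurable]: "(\<lambda>x. H (\<psi> n x) (\<eta> n x)) \<in> borel_measurable M"
    "(\<lambda>x. P (\<psi> n x) (\<eta> n x)) \<in> borel_measurable M"
    "(\<lambda>x. Q (\<psi> n x) (\<eta> n x)) \<in> borel_measurable M" for n by (auto intro!: mm)
  have p0: "p \<ge> 0" "p > 0" using p_gt_1 by auto
  note B = smooth_lipschitz2_nonneg smooth_lipschitz2_bound
  define F where "F = (\<lambda>n x. H (\<psi> n x) (\<eta> n x))"
  show ?thesis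
  proof (rule sobolev0_limit_seq)
    show "sobolev0 (F n) (grad (F n))" for n
      unfolding F_def by (intro sobolev0_test_function smooth_lipschitz2_test_function \<psi>(1) \<eta>(1))
    show "(\<lambda>n. pint M p (\<lambda>x. F n x - H (u x) (w x))) \<longlonglongrightarrow> 0"
    proof (rule tendsto_ennreal_zero_squeeze)
      show "(\<lambda>n. pint M p (\<lambda>x. (2 * B) *\<^sub>R \<bar>\<psi> n x - u x\<bar> + (2 * B) *\<^sub>R \<bar>\<eta> n x - w x\<bar>)) \<longlonglongrightarrow> 0"
      proof (intro pint_add_tendsto_0 p0)
        have e: "pint M p (\<lambda>x. \<bar>\<psi> n x - u x\<bar>) = pint M p (\<lambda>x. \<psi> n x - u x)"
          "pint M p (\<lambda>x. \<bar>\<eta> n x - w x\<bar>) = pint M p (\<lambda>x. \<eta> n x - w x)" for n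
          by (auto intro!: pint_cong_AE)
        show "(\<lambda>n. pint M p (\<lambda>x. (2 * B) *\<^sub>R \<bar>\<psi> n x - u x\<bar>)) \<longlonglongrightarrow> 0"
          by (rule pint_bounded_mult_tendsto_0[where B = "2 * B"]) (use B p0 \<psi>(2) e in auto)
        show "(\<lambda>n. pint M p (\<lambda>x. (2 * B) *\<^sub>R \<bar>\<eta> n x - w x\<bar>)) \<longlonglongrightarrow> 0"
          by (rule pint_bounded_mult_tendsto_0[where B = "2 * B"]) (use B p0 \<eta>(2) e in auto)
      qed measurable
      show "pint M p (\<lambda>x. F n x - H (u x) (w x)) \<le>
          pint M p (\<lambda>x. (2 * B) *\<^sub>R \<bar>\<psi> n x - u x\<bar> + (2 * B) *\<^sub>R \<bar>\<eta> n x - w x\<bar>)" for n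
      proof (intro pint_mono_AE AE_I2 p0)
        fix x
        have "\<bar>F n x - H (u x) (w x)\<bar> \<le> 2 * B * \<bar>\<psi> n x - u x\<bar> + 2 * B * \<bar>\<eta> n x - w x\<bar>"
          using smooth_lipschitz2_lipschitz[of "\<psi> n x" "\<eta> n x" "u x" "w x"]
          by (simp add: F_def distrib_left)
        then show "norm (F n x - H (u x) (w x))
            \<le> norm ((2 * B) *\<^sub>R \<bar>\<psi> n x - u x\<bar> + (2 * B) *\<^sub>R \<bar>\<eta> n x - w x\<bar>)"
          using B(1) by simp
      qed
    qed
    define d1 where "d1 = (\<lambda>n x. P (\<psi> n x) (\<eta> n x) *\<^sub>R (grad (\<psi> n) x - g x)
      + Q (\<psi> n x) (\<eta> n x) *\<^sub>R (grad (\<eta> n) x - h x))"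
    define d2 where "d2 = (\<lambda>n x. (P (\<psi> n x) (\<eta> n x) - P (u x) (w x)) *\<^sub>R g x
      + (Q (\<psi> n x) (\<eta> n x) - Q (u x) (w x)) *\<^sub>R h x)"
    have "(\<lambda>n. pint M p (\<lambda>x. d1 n x + d2 n x)) \<longlonglongrightarrow> 0"
    proof (rule pint_add_tendsto_0[OF _ _ p0(1)])
      show "(\<lambda>n. pint M p (d1 n)) \<longlonglongrightarrow> 0"
        unfolding d1_def
      proof (rule pint_add_tendsto_0[OF _ _ p0(1)])
        show "(\<lambda>n. pint M p (\<lambda>x. P (\<psi> n x) (\<eta> n x) *\<^sub>R (grad (\<psi> n) x - g x))) \<longlonglongrightarrow> 0"
          by (rule pint_bounded_mult_tendsto_0[OF _ B(2) p0(1) \<psi>(3)]) measurable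
        show "(\<lambda>n. pint M p (\<lambda>x. Q (\<psi> n x) (\<eta> n x) *\<^sub>R (grad (\<eta> n) x - h x))) \<longlonglongrightarrow> 0"
          by (rule pint_bounded_mult_tendsto_0[OF _ B(3) p0(1) \<eta>(3)]) measurable
      qed measurable
      have dom: "pint M p (\<lambda>x. (2 * B) *\<^sub>R norm (k x)) < \<infinity>" if "sobolev0 v k" for v k
      proof -
        note [measurable] = sobolev0_measurable[OF that]
        have "pint M p (\<lambda>x. norm (k x)) = pint M p k" by (intro pint_cong_AE) auto
        then show ?thesis
          using sobolev0_finite[OF that] by (subst pint_scale) (auto simp: ennreal_mult_less_top)
      qed
      have le: "\<bar>P a b - P a' b'\<bar> \<le> 2 * B" "\<bar>Q a b - Q a' b'\<bar> \<le> 2 * B" for a b a' b'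
        using B(2)[of a b] B(2)[of a' b'] B(3)[of a b] B(3)[of a' b'] by linarith+
      show "(\<lambda>n. pint M p (d2 n)) \<longlonglongrightarrow> 0"
        unfolding d2_def
      proof (rule pint_add_tendsto_0[OF _ _ p0(1)])
        show "(\<lambda>n. pint M p (\<lambda>x. (P (\<psi> n x) (\<eta> n x) - P (u x) (w x)) *\<^sub>R g x)) \<longlonglongrightarrow> 0"
        proof (rule pint_dominated_tendsto_0[OF _ _ p0(2) _ _ dom[OF u]])
          show "AE x in M. (\<lambda>n. (P (\<psi> n x) (\<eta> n x) - P (u x) (w x)) *\<^sub>R g x) \<longlonglongrightarrow> 0"
            using \<psi>(4) \<eta>(4)
          proof eventually_elim
            case (elim x)
            have "(\<lambda>n. P (\<psi> n x) (\<eta> n x) - P (u x) (w x)) \<longlonglongrightarrow> 0"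
              using smooth_lipschitz2_tendsto(2)[OF elim] by (simp add: LIM_zero_iff)
            then show ?case using tendsto_scaleR[OF _ tendsto_const, of _ 0 sequentially "g x"] by simp
          qed
          show "AE x in M. norm ((P (\<psi> n x) (\<eta> n x) - P (u x) (w x)) *\<^sub>R g x) \<le> norm ((2 * B) *\<^sub>R norm (g x))" for n
            using le(1) B(1) by (intro AE_I2) (auto intro!: mult_right_mono)
        qed measurable
        show "(\<lambda>n. pint M p (\<lambda>x. (Q (\<psi> n x) (\<eta> n x) - Q (u x) (w x)) *\<^sub>R h x)) \<longlonglongrightarrow> 0"
        proof (rule pint_dominated_tendsto_0[OF _ _ p0(2) _ _ dom[OF w]])
          show "AE x in M. (\<lambda>n. (Q (\<psi> n x) (\<eta> n x) - Q (u x) (w x)) *\<^sub>R h x) \<longlonglongrightarrow> 0"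
            using \<psi>(4) \<eta>(4)
          proof eventually_elim
            case (elim x)
            have "(\<lambda>n. Q (\<psi> n x) (\<eta> n x) - Q (u x) (w x)) \<longlonglongrightarrow> 0"
              using smooth_lipschitz2_tendsto(3)[OF elim] by (simp add: LIM_zero_iff)
            then show ?case using tendsto_scaleR[OF _ tendsto_const, of _ 0 sequentially "h x"] by simp
          qed
          show "AE x in M. norm ((Q (\<psi> n x) (\<eta> n x) - Q (u x) (w x)) *\<^sub>R h x) \<le> norm ((2 * B) *\<^sub>R norm (h x))" for n
            using le(2) B(1) by (intro AE_I2) (auto intro!: mult_right_mono)
        qed measurable
      qed measurable
    qed (auto simp: d1_def d2_def)
    moreover have "d1 n x + d2 n x = grad (F n) x - (P (u x) (w x) *\<^sub>R g x + Q (u x) (w x) *\<^sub>R h x)" for n x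
      unfolding F_def d1_def d2_def smooth_lipschitz2_test_function(2)[OF \<psi>(1) \<eta>(1)]
      by (simp add: algebra_simps)
    ultimately show "(\<lambda>n. pint M p (\<lambda>x. grad (F n) x - (P (u x) (w x) *\<^sub>R g x + Q (u x) (w x) *\<^sub>R h x))) \<longlonglongrightarrow> 0"
      by simp
  qed measurable
qed

end

text \<open>Extends the chain rule to functions of (u, w) that are only limits of smooth ones. The
  bound B does not depend on n, so multiples of |u| + |w| and of |g| + |h| are majorants and
  pointwise convergence suffices.\<close>

lemma sobolev0_chain_limit:
  assumes H: "\<And>n::nat. smooth_lipschitz2 (H n) (P n) (Q n) B"
    and u: "sobolev0 u g" and w: "sobolev0 w h"
    and [measurable]: "v \<in> borel_measurable M" "k \<in> borel_measurable M"
    and v: "AE x in M. (\<lambda>n. H n (u x) (w x)) \<longlonglongrightarrow> v x"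
    and k: "AE x in M. (\<lambda>n. P n (u x) (w x) *\<^sub>R g x + Q n (u x) (w x) *\<^sub>R h x) \<longlonglongrightarrow> k x"
  shows "sobolev0 v k"
proof -
  note s = sobolev0_chain[OF H u w]
  note [measurable] = sobolev0_measurable[OF u] sobolev0_measurable[OF w] sobolev0_measurable[OF s]
  have p0: "p \<ge> 0" "p > 0" using p_gt_1 by auto
  have B: "B \<ge> 0" using smooth_lipschitz2_nonneg[OF H] .
  show ?thesis
  proof (rule sobolev0_limit_seq[OF _ _ s])
    show "(\<lambda>n. pint M p (\<lambda>x. H n (u x) (w x) - v x)) \<longlonglongrightarrow> 0"
      by (rule pint_dominated_pair_tendsto_0[where a = u and b = w and c = "2 * B"])
        (use p0 sobolev0_finite[OF u] sobolev0_finite[OF w] v smooth_lipschitz2_bound0[OF H] in auto)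
    show "(\<lambda>n. pint M p (\<lambda>x. P n (u x) (w x) *\<^sub>R g x + Q n (u x) (w x) *\<^sub>R h x - k x)) \<longlonglongrightarrow> 0"
    proof (rule pint_dominated_pair_tendsto_0[where a = g and b = h and c = "2 * B"])
      fix n x
      have "norm (P n (u x) (w x) *\<^sub>R g x + Q n (u x) (w x) *\<^sub>R h x) \<le> B * norm (g x) + B * norm (h x)"
        using smooth_lipschitz2_bound[OF H, of n "u x" "w x"]
        by (intro norm_triangle_le add_mono) (auto intro!: mult_right_mono)
      also have "\<dots> \<le> 2 * B * (norm (g x) + norm (h x))"
        using B by (simp add: distrib_left)
      finally show "norm (P n (u x) (w x) *\<^sub>R g x + Q n (u x) (w x) *\<^sub>R h x) \<le> 2 * B * (norm (g x) + norm (h x))" .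
    qed (use p0 sobolev0_finite[OF u] sobolev0_finite[OF w] k in auto)
  qed auto
qed

end

text \<open>Rests on the completeness of Lebesgue measure; it yields the measurability of
  \<open>weak_grad\<close>, which is known only up to a null set.\<close>

lemma borel_measurable_lebesgue_on_AE:
  fixes f g :: "'a::euclidean_space \<Rightarrow> 'b::euclidean_space"
  assumes "f \<in> borel_measurable (lebesgue_on S)" "S \<in> sets lebesgue"
    and "AE x in lebesgue_on S. f x = g x"
  shows "g \<in> borel_measurable (lebesgue_on S)"
proof -
  have "(\<lambda>x. indicator S x *\<^sub>R f x) \<in> borel_measurable lebesgue"
    using assms(1,2) by (subst (asm) borel_measurable_restrict_space_iff) auto
  moreover have "AE x in lebesgue. indicator S x *\<^sub>R f x = indicator S x *\<^sub>R g x"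
    using assms(2,3) by (subst (asm) AE_restrict_space_iff) (auto elim!: eventually_mono simp: indicator_def)
  ultimately have "(\<lambda>x. indicator S x *\<^sub>R g x) \<in> borel_measurable lebesgue"
    by (rule borel_measurable_AE)
  then show ?thesis
    using assms(2) by (subst borel_measurable_restrict_space_iff) auto
qed

section \<open>Weak gradients under local L^1 convergence\<close>

lemma integrable_lebesgue_on_imp_loc_integrable:
  assumes "integrable (lebesgue_on \<Omega>) u" "\<Omega> \<in> sets lebesgue"
  shows "loc_integrable \<Omega> u"
  unfolding loc_integrable_def
proof (intro allI impI)
  fix K assume "compact K \<and> K \<subseteq> \<Omega>"
  moreover have "set_integrable lebesgue \<Omega> u"
    using assms by (subst (asm) integrable_restrict_space) (auto simp: set_integrable_def)
  ultimately show "set_integrable lebesgue K u"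
    by (elim set_integrable_subset) (auto intro: fmeasurableD lmeasurable_compact)
qed

lemma loc_integrable_restrict_compact:
  assumes "loc_integrable \<Omega> f" "\<Omega> \<in> sets lebesgue" "compact K" "K \<subseteq> \<Omega>"
  shows "integrable (lebesgue_on \<Omega>) (\<lambda>x. indicator K x *\<^sub>R f x)"
  by (rule loc_integrable_scale_compact[OF assms, where B = 1]) (auto intro!: borel_measurable_indicator borel_compact assms(3))

lemma integrable_inner_bounded:
  fixes f \<rho> :: "'a::euclidean_space \<Rightarrow> 'b::euclidean_space"
  assumes f: "loc_integrable \<Omega> f" and \<Omega>: "\<Omega> \<in> sets lebesgue" and K: "compact K" "K \<subseteq> \<Omega>"
    and \<rho>: "\<rho> \<in> borel_measurable borel" "\<And>x. norm (\<rho> x) \<le> B" "\<And>x. x \<notin> K \<Longrightarrow> \<rho> x = 0"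
  shows "integrable (lebesgue_on \<Omega>) (\<lambda>x. f x \<bullet> \<rho> x)"
proof (rule Bochner_Integration.integrable_bound)
  note int = loc_integrable_restrict_compact[OF f \<Omega> K]
  have eq: "f x \<bullet> \<rho> x = (indicator K x *\<^sub>R f x) \<bullet> \<rho> x" for x
    using \<rho>(3)[of x] by (cases "x \<in> K") auto
  show "integrable (lebesgue_on \<Omega>) (\<lambda>x. B * norm (indicator K x *\<^sub>R f x))"
    using int by (intro integrable_mult_right integrable_norm)
  have [measurable]: "\<rho> \<in> borel_measurable (lebesgue_on \<Omega>)"
    using \<rho>(1) by (rule borel_measurable_lebesgue_onI)
  have [measurable]: "(\<lambda>x. indicator K x *\<^sub>R f x) \<in> borel_measurable (lebesgue_on \<Omega>)"
    using int by (rule borel_measurable_integrable)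
  show "(\<lambda>x. f x \<bullet> \<rho> x) \<in> borel_measurable (lebesgue_on \<Omega>)"
    unfolding eq by measurable
  show "AE x in lebesgue_on \<Omega>. norm (f x \<bullet> \<rho> x) \<le> norm (B * norm (indicator K x *\<^sub>R f x))"
  proof (intro AE_I2)
    fix x
    have "norm (f x \<bullet> \<rho> x) \<le> norm (indicator K x *\<^sub>R f x) * norm (\<rho> x)"
      unfolding eq real_norm_def by (rule Cauchy_Schwarz_ineq2)
    also have "\<dots> \<le> norm (indicator K x *\<^sub>R f x) * B"
      by (intro mult_left_mono \<rho>(2)) auto
    finally show "norm (f x \<bullet> \<rho> x) \<le> norm (B * norm (indicator K x *\<^sub>R f x))"
      by (simp add: mult.commute)
  qed
qed

lemma tendsto_integral_inner_bounded:
  fixes v :: "nat \<Rightarrow> 'a::euclidean_space \<Rightarrow> 'b::euclidean_space"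
  assumes v: "\<And>n. loc_integrable \<Omega> (v n)" and u: "loc_integrable \<Omega> u"
    and \<Omega>: "\<Omega> \<in> sets lebesgue" and K: "compact K" "K \<subseteq> \<Omega>"
    and \<rho>: "\<rho> \<in> borel_measurable borel" "\<And>x. norm (\<rho> x) \<le> B" "\<And>x. x \<notin> K \<Longrightarrow> \<rho> x = 0"
    and l: "(\<lambda>n. \<integral>\<^sup>+x. ennreal (norm (indicator K x *\<^sub>R (v n x - u x))) \<partial>lebesgue_on \<Omega>) \<longlonglongrightarrow> 0"
  shows "(\<lambda>n. \<integral>x. v n x \<bullet> \<rho> x \<partial>lebesgue_on \<Omega>) \<longlonglongrightarrow> (\<integral>x. u x \<bullet> \<rho> x \<partial>lebesgue_on \<Omega>)"
proof (rule tendsto_L1_int)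
  show "integrable (lebesgue_on \<Omega>) (\<lambda>x. v n x \<bullet> \<rho> x)" for n
    by (rule integrable_inner_bounded[OF v \<Omega> K \<rho>])
  show "integrable (lebesgue_on \<Omega>) (\<lambda>x. u x \<bullet> \<rho> x)"
    by (rule integrable_inner_bounded[OF u \<Omega> K \<rho>])
  show "(\<lambda>n. \<integral>\<^sup>+x. ennreal (norm (v n x \<bullet> \<rho> x - u x \<bullet> \<rho> x)) \<partial>lebesgue_on \<Omega>) \<longlonglongrightarrow> 0"
  proof (rule tendsto_ennreal_zero_squeeze[OF tendsto_ennreal_zero_cmult[OF l, of B]])
    fix n
    have B: "B \<ge> 0" using \<rho>(2) norm_ge_zero order_trans by blast
    have [measurable]: "(\<lambda>x. indicator K x *\<^sub>R (v n x - u x)) \<in> borel_measurable (lebesgue_on \<Omega>)"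
      by (intro borel_measurable_integrable loc_integrable_restrict_compact loc_integrable_diff v u \<Omega> K)
    have "(\<integral>\<^sup>+x. ennreal (norm (v n x \<bullet> \<rho> x - u x \<bullet> \<rho> x)) \<partial>lebesgue_on \<Omega>)
        \<le> (\<integral>\<^sup>+x. ennreal B * ennreal (norm (indicator K x *\<^sub>R (v n x - u x))) \<partial>lebesgue_on \<Omega>)"
    proof (rule nn_integral_mono)
      fix x
      have "norm (v n x \<bullet> \<rho> x - u x \<bullet> \<rho> x) = norm ((indicator K x *\<^sub>R (v n x - u x)) \<bullet> \<rho> x)"
        using \<rho>(3)[of x] by (cases "x \<in> K") (auto simp: inner_diff_left)
      also have "\<dots> \<le> norm (indicator K x *\<^sub>R (v n x - u x)) * norm (\<rho> x)"
        unfolding real_norm_def by (rule Cauchy_Schwarz_ineq2)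
      also have "\<dots> \<le> B * norm (indicator K x *\<^sub>R (v n x - u x))"
        using mult_left_mono[OF \<rho>(2), of "norm (indicator K x *\<^sub>R (v n x - u x))" x] by (simp add: mult.commute)
      finally show "ennreal (norm (v n x \<bullet> \<rho> x - u x \<bullet> \<rho> x))
          \<le> ennreal B * ennreal (norm (indicator K x *\<^sub>R (v n x - u x)))"
        using B by (simp flip: ennreal_mult add: ennreal_leI)
    qed
    also have "\<dots> = ennreal B * (\<integral>\<^sup>+x. ennreal (norm (indicator K x *\<^sub>R (v n x - u x))) \<partial>lebesgue_on \<Omega>)"
      by (rule nn_integral_cmult) measurable
    finally show "(\<integral>\<^sup>+x. ennreal (norm (v n x \<bullet> \<rho> x - u x \<bullet> \<rho> x)) \<partial>lebesgue_on \<Omega>)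
        \<le> ennreal B * (\<integral>\<^sup>+x. ennreal (norm (indicator K x *\<^sub>R (v n x - u x))) \<partial>lebesgue_on \<Omega>)" .
  qed
qed

text \<open>Test functions and their gradients are bounded with compact support, so L^1 convergence
  on compact subsets passes to the limit on both sides of the defining identity. The local form
  matters for quotients, whose convergence is controlled only away from the boundary.\<close>

lemma has_weak_grad_limit:
  fixes u :: "'a::euclidean_space \<Rightarrow> real"
  assumes \<Omega>: "\<Omega> \<in> sets lebesgue"
    and v: "\<And>n::nat. has_weak_grad \<Omega> (v n) (k n)"
    and u: "loc_integrable \<Omega> u" and g: "loc_integrable \<Omega> g"
    and lu: "\<And>K. compact K \<Longrightarrow> K \<subseteq> \<Omega> \<Longrightarrow>
      (\<lambda>n. \<integral>\<^sup>+x. ennreal (norm (indicator K x *\<^sub>R (v n x - u x))) \<partial>lebesgue_on \<Omega>) \<longlonglongrightarrow> 0"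
    and lg: "\<And>K. compact K \<Longrightarrow> K \<subseteq> \<Omega> \<Longrightarrow>
      (\<lambda>n. \<integral>\<^sup>+x. ennreal (norm (indicator K x *\<^sub>R (k n x - g x))) \<partial>lebesgue_on \<Omega>) \<longlonglongrightarrow> 0"
  shows "has_weak_grad \<Omega> u g"
  unfolding has_weak_grad_def
proof (intro conjI u g allI impI ballI)
  fix \<psi> and i :: 'a assume \<psi>: "test_function \<Omega> \<psi>" and i: "i \<in> Basis"
  obtain K where K: "compact K" "K \<subseteq> \<Omega>" "\<And>x. x \<notin> K \<Longrightarrow> \<psi> x = 0" "\<And>x. x \<notin> K \<Longrightarrow> grad \<psi> x = 0"
    using test_function_support[OF \<psi>] by metis
  obtain B where B: "B > 0" "\<And>x. \<bar>\<psi> x\<bar> \<le> B" "\<And>x. norm (grad \<psi> x) \<le> B"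
    using test_function_bounded[OF \<psi>] by metis
  have vk: "loc_integrable \<Omega> (v n)" "loc_integrable \<Omega> (k n)"
    "(\<integral>x. v n x * frechet_derivative \<psi> (at x) i \<partial>lebesgue_on \<Omega>) =
      - (\<integral>x. (k n x \<bullet> i) * \<psi> x \<partial>lebesgue_on \<Omega>)" for n
    using v[of n] \<psi> i by (auto simp: has_weak_grad_def)
  note [measurable] = borel_measurable_test_function[OF \<psi>]
  have "\<bar>grad \<psi> x \<bullet> i\<bar> \<le> B" for x
    using B(3)[of x] Basis_le_norm[OF i, of "grad \<psi> x"] by linarith
  then have "(\<lambda>n. \<integral>x. v n x \<bullet> (grad \<psi> x \<bullet> i) \<partial>lebesgue_on \<Omega>) \<longlonglongrightarrow> (\<integral>x. u x \<bullet> (grad \<psi> x \<bullet> i) \<partial>lebesgue_on \<Omega>)"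
    by (intro tendsto_integral_inner_bounded[OF vk(1) u \<Omega> K(1,2), where B = B] lu K) (auto simp: K(4))
  then have 1: "(\<lambda>n. \<integral>x. v n x * frechet_derivative \<psi> (at x) i \<partial>lebesgue_on \<Omega>)
      \<longlonglongrightarrow> (\<integral>x. u x * frechet_derivative \<psi> (at x) i \<partial>lebesgue_on \<Omega>)"
    by (simp add: grad_inner[OF i])
  have "(\<lambda>n. \<integral>x. k n x \<bullet> (\<psi> x *\<^sub>R i) \<partial>lebesgue_on \<Omega>) \<longlonglongrightarrow> (\<integral>x. g x \<bullet> (\<psi> x *\<^sub>R i) \<partial>lebesgue_on \<Omega>)"
    using B i by (intro tendsto_integral_inner_bounded[OF vk(2) g \<Omega> K(1,2), where B = B] lg K) (auto simp: K(3))
  then have 2: "(\<lambda>n. - (\<integral>x. (k n x \<bullet> i) * \<psi> x \<partial>lebesgue_on \<Omega>)) \<longlonglongrightarrow> - (\<integral>x. (g x \<bullet> i) * \<psi> x \<partial>lebesgue_on \<Omega>)"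
    by (intro tendsto_minus) (simp add: mult.commute)
  show "(\<integral>x. u x * frechet_derivative \<psi> (at x) i \<partial>lebesgue_on \<Omega>) =
        - (\<integral>x. (g x \<bullet> i) * \<psi> x \<partial>lebesgue_on \<Omega>)"
    using LIMSEQ_unique[OF 1] 2 by (simp add: vk(3))
qed

lemma has_weak_grad_diff:
  assumes \<Omega>: "\<Omega> \<in> sets lebesgue" and 1: "has_weak_grad \<Omega> u g" and 2: "has_weak_grad \<Omega> v h"
  shows "has_weak_grad \<Omega> (\<lambda>x. u x - v x) (\<lambda>x. g x - h x)"
  unfolding has_weak_grad_def
proof (intro conjI allI impI ballI)
  have l: "loc_integrable \<Omega> u" "loc_integrable \<Omega> v" "loc_integrable \<Omega> g" "loc_integrable \<Omega> h"
    using 1 2 by (auto simp: has_weak_grad_def)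
  then show "loc_integrable \<Omega> (\<lambda>x. u x - v x)" "loc_integrable \<Omega> (\<lambda>x. g x - h x)"
    by (auto intro: loc_integrable_diff)
  fix \<psi> and i :: 'a assume \<psi>: "test_function \<Omega> \<psi>" and i: "i \<in> Basis"
  note int = loc_integrable_test_function_mult[OF _ \<Omega> \<psi>]
  have a: "integrable (lebesgue_on \<Omega>) (\<lambda>x. k x * frechet_derivative \<psi> (at x) i)"
    if "loc_integrable \<Omega> k" for k using int(2)[OF that i] by (simp add: mult.commute)
  have b: "integrable (lebesgue_on \<Omega>) (\<lambda>x. (k x \<bullet> i) * \<psi> x)"
    if "loc_integrable \<Omega> k" for k using int(1)[OF loc_integrable_inner[OF that], of i] by (simp add: mult.commute)
  have "(\<integral>x. u x * frechet_derivative \<psi> (at x) i \<partial>lebesgue_on \<Omega>) = - (\<integral>x. (g x \<bullet> i) * \<psi> x \<partial>lebesgue_on \<Omega>)"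
     "(\<integral>x. v x * frechet_derivative \<psi> (at x) i \<partial>lebesgue_on \<Omega>) = - (\<integral>x. (h x \<bullet> i) * \<psi> x \<partial>lebesgue_on \<Omega>)"
    using 1 2 \<psi> i by (auto simp: has_weak_grad_def)
  then show "(\<integral>x. (u x - v x) * frechet_derivative \<psi> (at x) i \<partial>lebesgue_on \<Omega>) =
        - (\<integral>x. ((g x - h x) \<bullet> i) * \<psi> x \<partial>lebesgue_on \<Omega>)"
    using a[OF l(1)] a[OF l(2)] b[OF l(3)] b[OF l(4)] by (simp add: left_diff_distrib inner_diff_left)
qed

lemma pint_diff_finite:
  fixes a b :: "'a \<Rightarrow> 'b::{real_normed_vector, second_countable_topology}"
  assumes "a \<in> borel_measurable M" "b \<in> borel_measurable M" "p \<ge> 0"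
    and "pint M p a < \<infinity>" "pint M p b < \<infinity>"
  shows "pint M p (\<lambda>x. a x - b x) < \<infinity>"
proof -
  have "pint M p (\<lambda>x. - b x) = pint M p b" by (intro pint_cong_AE) auto
  then have "pint M p (\<lambda>x. a x - b x) \<le> ennreal (2 powr p) * (pint M p a + pint M p b)"
    using pint_add[of a M "\<lambda>x. - b x" p] assms by simp
  also have "\<dots> < \<infinity>" using assms by (simp add: ennreal_mult_less_top)
  finally show ?thesis .
qed

lemma (in finite_measure) integrable_if_pint_finite:
  fixes u :: "'a \<Rightarrow> 'b::{banach, second_countable_topology}"
  assumes [measurable]: "u \<in> borel_measurable M" and "pint M p u < \<infinity>" "p \<ge> 1"
  shows "integrable M u"
proof -
  have "integrable M (\<lambda>x. norm (u x) powr p)"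
    using assms(2) by (intro integrableI_bounded) (auto simp: pint_def)
  then have "integrable M (\<lambda>x. 1 + norm (u x) powr p)" by simp
  then show ?thesis
  proof (rule Bochner_Integration.integrable_bound)
    have "norm (u x) \<le> 1 + norm (u x) powr p" for x
    proof (cases "norm (u x) \<le> 1")
      case True then show ?thesis by (smt (verit) powr_ge_zero)
    next
      case False
      then have "norm (u x) powr 1 \<le> norm (u x) powr p" using assms(3) by (intro powr_mono) auto
      then show ?thesis using False by simp
    qed
    then show "AE x in M. norm (u x) \<le> norm (1 + norm (u x) powr p)" by simp
  qed measurable
qed

text \<open>For s > d one has s^(1 - p) \<le> d^(1 - p). The free parameter d replaces Hoelder's
  inequality when a p-th power has to control a first power on a set of finite measure.\<close>

lemma le_add_powr:
  fixes s d p :: real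
  assumes "s \<ge> 0" "d > 0" "p > 1" shows "s \<le> d + d powr (1 - p) * s powr p"
proof (cases "s \<le> d")
  case True
  moreover have "d powr (1 - p) * s powr p \<ge> 0" by simp
  ultimately show ?thesis by linarith
next
  case False
  have "s = s powr (1 - p) * s powr p" using False assms by (simp flip: powr_add)
  also have "\<dots> \<le> d powr (1 - p) * s powr p"
    using False assms by (intro mult_right_mono powr_mono2') auto
  finally show ?thesis using assms by simp
qed

lemma (in finite_measure) pint_tendsto_0_imp_L1:
  fixes f :: "nat \<Rightarrow> 'a \<Rightarrow> 'b::{real_normed_vector, second_countable_topology}"
  assumes [measurable]: "\<And>n. f n \<in> borel_measurable M" and "(\<lambda>n. pint M p (f n)) \<longlonglongrightarrow> 0" "p > 1"
  shows "(\<lambda>n. \<integral>\<^sup>+x. ennreal (norm (f n x)) \<partial>M) \<longlonglongrightarrow> 0"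
proof (rule order_tendstoI)
  fix e :: ennreal assume "0 < e"
  then obtain e' where e': "0 < e'" "ennreal e' < e"
    by (metis dense ennreal_cases ennreal_less_zero_iff less_le_trans not_less_iff_gr_or_eq top_greatest)
  define m where "m = measure M (space M)"
  have m: "m \<ge> 0" "emeasure M (space M) = ennreal m" by (auto simp: m_def emeasure_eq_measure)
  \<comment> \<open>The constant part contributes d times the total mass, which this keeps below
    e'/2; m + 1 instead of m avoids division by 0.\<close>
  define d where "d = e' / (2 * (m + 1))"
  have d: "d > 0" "d * m < e' / 2" using e' m by (auto simp: d_def field_simps)
  note ptw = le_add_powr[OF norm_ge_zero d(1) assms(3)]
  have le: "(\<integral>\<^sup>+x. ennreal (norm (f n x)) \<partial>M) \<le> ennreal (d * m) + ennreal (d powr (1 - p)) * pint M p (f n)" for n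
  proof -
    have "(\<integral>\<^sup>+x. ennreal (norm (f n x)) \<partial>M)
        \<le> (\<integral>\<^sup>+x. ennreal d + ennreal (d powr (1 - p)) * ennreal (norm (f n x) powr p) \<partial>M)"
      using ptw d by (intro nn_integral_mono) (simp flip: ennreal_mult ennreal_plus add: ennreal_leI)
    also have "\<dots> = ennreal (d * m) + ennreal (d powr (1 - p)) * pint M p (f n)"
      using d m by (simp add: nn_integral_add nn_integral_cmult pint_def ennreal_mult)
    finally show ?thesis .
  qed
  have "(\<lambda>n. ennreal (d powr (1 - p)) * pint M p (f n)) \<longlonglongrightarrow> 0"
    by (rule tendsto_ennreal_zero_cmult[OF assms(2)])
  from order_tendstoD(2)[OF this, of "ennreal (e' / 2)"]
  have "\<forall>\<^sub>F n in sequentially. ennreal (d powr (1 - p)) * pint M p (f n) < ennreal (e' / 2)" using e' by simp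
  then show "\<forall>\<^sub>F n in sequentially. (\<integral>\<^sup>+x. ennreal (norm (f n x)) \<partial>M) < e"
  proof eventually_elim
    case (elim n)
    have "(\<integral>\<^sup>+x. ennreal (norm (f n x)) \<partial>M) \<le> ennreal (d * m) + ennreal (d powr (1 - p)) * pint M p (f n)" by (rule le)
    also have "\<dots> \<le> ennreal (e' / 2) + ennreal (e' / 2)"
      using d elim by (intro add_mono) (auto intro: ennreal_leI)
    also have "\<dots> = ennreal e'" using e' by (simp flip: ennreal_plus)
    finally show ?case using e'(2) by simp
  qed
qed simp

section \<open>Equivalence of the explicit closure with \<open>W1_0\<close>\<close>

context finite_domain
begin

lemma sobolev0_integrable:
  assumes "sobolev0 u g" shows "integrable M u" "integrable M g"
  using integrable_if_pint_finite sobolev0_measurable[OF assms] sobolev0_finite[OF assms] p_gt_1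
  by (metis less_imp_le)+

lemma sobolev0_loc_integrable:
  assumes "sobolev0 u g" shows "loc_integrable \<Omega> u" "loc_integrable \<Omega> g"
  using sobolev0_integrable[OF assms] by (auto intro: integrable_lebesgue_on_imp_loc_integrable)

lemma has_weak_grad_test_function:
  assumes "test_function \<Omega> \<psi>" shows "has_weak_grad \<Omega> \<psi> (grad \<psi>)"
  unfolding has_weak_grad_def
  using sobolev0_loc_integrable[OF sobolev0_test_function[OF assms]]
    integral_by_parts_test_function[OF test_function_Ck[OF assms]] by auto

lemma nn_integral_indicator_tendsto_0:
  fixes f :: "nat \<Rightarrow> 'a \<Rightarrow> 'b::euclidean_space"
  assumes "\<And>n. f n \<in> borel_measurable M" "(\<lambda>n. pint M p (f n)) \<longlonglongrightarrow> 0"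
  shows "(\<lambda>n. \<integral>\<^sup>+x. ennreal (norm (indicator K x *\<^sub>R f n x)) \<partial>M) \<longlonglongrightarrow> 0"
  by (rule tendsto_ennreal_zero_squeeze[OF pint_tendsto_0_imp_L1[OF assms p_gt_1]])
    (auto intro!: nn_integral_mono ennreal_leI simp: indicator_def)

lemma sobolev0_has_weak_grad:
  assumes s: "sobolev0 u g" shows "has_weak_grad \<Omega> u g"
proof -
  obtain \<psi> where \<psi>: "\<forall>n. test_function \<Omega> (\<psi> n)" "(\<lambda>n. pint M p (\<lambda>x. \<psi> n x - u x)) \<longlonglongrightarrow> 0"
    "(\<lambda>n. pint M p (\<lambda>x. grad (\<psi> n) x - g x)) \<longlonglongrightarrow> 0"
    using sobolev0_sequence[OF s] by blast
  note [measurable] = sobolev0_measurable[OF s] borel_measurable_test[OF \<psi>(1)[rule_format]]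
  show ?thesis
    by (rule has_weak_grad_limit[OF domain_sets has_weak_grad_test_function[OF \<psi>(1)[rule_format]]
          sobolev0_loc_integrable[OF s]]; rule nn_integral_indicator_tendsto_0)
      (use \<psi>(2,3) in \<open>auto\<close>)
qed

lemma sobolev0_weak_grad: "sobolev0 u g \<Longrightarrow> AE x in M. weak_grad \<Omega> u x = g x"
  by (rule weak_grad_AE_eq[OF open_domain sobolev0_has_weak_grad])

lemma weak_grad_AE_measurable:
  "has_weak_grad \<Omega> u g \<Longrightarrow> g \<in> borel_measurable M \<Longrightarrow> weak_grad \<Omega> u \<in> borel_measurable M"
  using borel_measurable_lebesgue_on_AE[of g \<Omega> "weak_grad \<Omega> u"] weak_grad_AE_eq[OF open_domain]
  by (simp add: eq_commute)

lemma integral_powr_eq_pint: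
  fixes f :: "'a \<Rightarrow> 'b::euclidean_space"
  assumes "f \<in> borel_measurable M"
  shows "(\<integral>x. norm (f x) powr p \<partial>M) = enn2real (pint M p f)"
  unfolding pint_def using assms by (intro integral_eq_nn_integral) auto

lemma Lspace_iff_pint:
  fixes f :: "'a \<Rightarrow> 'b::euclidean_space"
  shows "f \<in> Lspace \<Omega> p \<longleftrightarrow> f \<in> borel_measurable M \<and> pint M p f < \<infinity>"
proof -
  have "integrable M (\<lambda>x. norm (f x) powr p) \<longleftrightarrow> pint M p f < \<infinity>" if "f \<in> borel_measurable M"
    using that by (auto simp: pint_def integrable_iff_bounded)
  then show ?thesis by (auto simp: Lspace_def)
qed

lemma W1norm_powr:
  assumes "f \<in> borel_measurable M" "has_weak_grad \<Omega> f k" "k \<in> borel_measurable M"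
  shows "W1norm \<Omega> p f powr p = enn2real (pint M p f) + enn2real (pint M p k)"
proof -
  have "pint M p (weak_grad \<Omega> f) = pint M p k"
    using weak_grad_AE_eq[OF open_domain assms(2)] by (intro pint_cong_AE) (auto elim!: eventually_mono)
  moreover have "Lnorm \<Omega> p h powr p = enn2real (pint M p h)" if "h \<in> borel_measurable M" for h :: "'a \<Rightarrow> real"
    using p_gt_1 integral_powr_eq_pint[OF that] by (simp add: Lnorm_def powr_powr)
  moreover have "Lnorm \<Omega> p h powr p = enn2real (pint M p h)" if "h \<in> borel_measurable M" for h :: "'a \<Rightarrow> 'a"
    using p_gt_1 integral_powr_eq_pint[OF that] by (simp add: Lnorm_def powr_powr)
  ultimately show ?thesis
    using p_gt_1 assms weak_grad_AE_measurable[OF assms(2,3)] by (simp add: W1norm_def powr_powr)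
qed

text \<open>The \<open>W1norm\<close> of \<psi> n - u involves the chosen gradient of this
  difference; linearity and uniqueness of weak gradients identify it almost everywhere with grad
  (\<psi> n) minus the chosen gradient of u.\<close>

lemma W1_0_imp_sobolev0:
  assumes u: "u \<in> W1_0 \<Omega> p" shows "sobolev0 u (weak_grad \<Omega> u)"
proof -
  obtain g0 where g0: "has_weak_grad \<Omega> u g0" using u by (auto simp: W1_0_def W1_def)
  note wg = has_weak_grad_weak_grad[OF g0]
  have L: "u \<in> Lspace \<Omega> p" "weak_grad \<Omega> u \<in> Lspace \<Omega> p" using u by (auto simp: W1_0_def W1_def)
  then have [measurable]: "u \<in> borel_measurable M" "weak_grad \<Omega> u \<in> borel_measurable M"
    and fin: "pint M p u < \<infinity>" "pint M p (weak_grad \<Omega> u) < \<infinity>" by (auto simp: Lspace_iff_pint)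
  obtain \<psi> where \<psi>: "\<And>n. test_function \<Omega> (\<psi> n)" and l: "(\<lambda>n. W1norm \<Omega> p (\<lambda>x. \<psi> n x - u x)) \<longlonglongrightarrow> 0"
    using u by (auto simp: W1_0_def)
  note [measurable] = borel_measurable_test[OF \<psi>]
  define A where "A n = pint M p (\<lambda>x. \<psi> n x - u x)" for n
  define A' where "A' n = pint M p (\<lambda>x. grad (\<psi> n) x - weak_grad \<Omega> u x)" for n
  have A: "A n < \<infinity>" "A' n < \<infinity>" for n
    unfolding A_def A'_def using p_gt_1
    by (intro pint_diff_finite fin pint_test_function_finite[OF \<psi>]; simp)+
  have eq: "enn2real (A n) + enn2real (A' n) = W1norm \<Omega> p (\<lambda>x. \<psi> n x - u x) powr p" for n
    unfolding A_def A'_def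
    by (rule W1norm_powr[symmetric])
      (auto intro!: has_weak_grad_diff[OF domain_sets has_weak_grad_test_function[OF \<psi>] wg])
  have "(\<lambda>n. W1norm \<Omega> p (\<lambda>x. \<psi> n x - u x) powr p) \<longlonglongrightarrow> 0 powr p"
    using p_gt_1 by (intro tendsto_powr' l tendsto_const) (auto simp: W1norm_def)
  then have "(\<lambda>n. ennreal (enn2real (A n) + enn2real (A' n))) \<longlonglongrightarrow> ennreal 0"
    using p_gt_1 unfolding eq by (intro tendsto_ennrealI) simp
  then have "(\<lambda>n. A n + A' n) \<longlonglongrightarrow> 0" using A by (simp add: ennreal_enn2real)
  then have l: "A \<longlonglongrightarrow> 0" "A' \<longlonglongrightarrow> 0"
    by (auto elim!: tendsto_ennreal_zero_squeeze)
  show ?thesis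
    by (rule sobolev0_limit_seq[OF _ _ sobolev0_test_function[OF \<psi>]])
      (use l in \<open>auto simp: A_def[abs_def] A'_def[abs_def]\<close>)
qed

lemma sobolev0_imp_W1_0:
  assumes s: "sobolev0 u g" shows "u \<in> W1_0 \<Omega> p"
proof -
  note wg = sobolev0_has_weak_grad[OF s]
  note [measurable] = sobolev0_measurable[OF s]
  have "pint M p (weak_grad \<Omega> u) = pint M p g"
    using sobolev0_weak_grad[OF s] by (intro pint_cong_AE) (auto elim!: eventually_mono)
  then have W: "u \<in> W1 \<Omega> p"
    using wg sobolev0_finite[OF s] weak_grad_AE_measurable[OF wg] by (auto simp: W1_def Lspace_iff_pint)
  obtain \<psi> where \<psi>: "\<forall>n. test_function \<Omega> (\<psi> n)" "(\<lambda>n. pint M p (\<lambda>x. \<psi> n x - u x)) \<longlonglongrightarrow> 0"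
    "(\<lambda>n. pint M p (\<lambda>x. grad (\<psi> n) x - g x)) \<longlonglongrightarrow> 0"
    using sobolev0_sequence[OF s] by blast
  note t = \<psi>(1)[rule_format]
  note [measurable] = borel_measurable_test[OF t]
  have eq: "W1norm \<Omega> p (\<lambda>x. \<psi> n x - u x) powr p
      = enn2real (pint M p (\<lambda>x. \<psi> n x - u x)) + enn2real (pint M p (\<lambda>x. grad (\<psi> n) x - g x))" for n
    by (rule W1norm_powr) (auto intro!: has_weak_grad_diff[OF domain_sets has_weak_grad_test_function[OF t] wg])
  have "(\<lambda>n. W1norm \<Omega> p (\<lambda>x. \<psi> n x - u x) powr p) \<longlonglongrightarrow> 0 + 0"
    unfolding eq using \<psi>(2,3) by (intro tendsto_add tendsto_enn2real) auto
  then have "(\<lambda>n. (W1norm \<Omega> p (\<lambda>x. \<psi> n x - u x) powr p) powr (1 / p)) \<longlonglongrightarrow> 0 powr (1 / p)"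
    using p_gt_1 by (intro tendsto_powr' tendsto_const) auto
  moreover have "(W1norm \<Omega> p f powr p) powr (1 / p) = W1norm \<Omega> p f" for f
    using p_gt_1 by (simp add: W1norm_def powr_powr)
  ultimately have "(\<lambda>n. W1norm \<Omega> p (\<lambda>x. \<psi> n x - u x)) \<longlonglongrightarrow> 0" by simp
  with W t show ?thesis by (auto simp: W1_0_def)
qed

end

section \<open>Truncations and power means of Sobolev functions\<close>

lemma has_derivative_fst_compose:
  "(f has_real_derivative f') (at (fst z)) \<Longrightarrow>
    ((\<lambda>z. f (fst z)) has_derivative (\<lambda>h. f' * fst h)) (at (z :: real \<times> real))"
  by (rule has_derivative_compose[of fst fst]) (auto simp: has_field_derivative_def intro!: derivative_intros)

lemma has_derivative_snd_compose:
  "(f has_real_derivative f') (at (snd z)) \<Longrightarrow>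
    ((\<lambda>z. f (snd z)) has_derivative (\<lambda>h. f' * snd h)) (at (z :: real \<times> real))"
  by (rule has_derivative_compose[of snd snd]) (auto simp: has_field_derivative_def intro!: derivative_intros)

lemma DERIV_powr_shifted_square:
  fixes s c d e :: real
  assumes "c > 0"
  shows "((\<lambda>s. ((s - d)\<^sup>2 + c) powr e) has_real_derivative (2 * e * (s - d)) * ((s - d)\<^sup>2 + c) powr (e - 1)) (at s)"
proof -
  have pos: "(s - d)\<^sup>2 + c > 0" using assms by (simp add: add_nonneg_pos)
  have "((\<lambda>s. (s - d)\<^sup>2 + c) has_real_derivative (2 * (s - d))) (at s)"
    by (auto intro!: derivative_eq_intros)
  from DERIV_fun_powr[OF this pos, of e] show ?thesis
    by (simp add: mult_ac)
qed

section \<open>Smooth approximations of positive parts and power means\<close>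

context finite_domain
begin

lemma smooth_lipschitz2_linear:
  "smooth_lipschitz2 (\<lambda>a b. \<alpha> * a + \<beta> * b) (\<lambda>a b. \<alpha>) (\<lambda>a b. \<beta>) (max \<bar>\<alpha>\<bar> \<bar>\<beta>\<bar>)"
  unfolding smooth_lipschitz2_def
proof (intro conjI allI impI)
  show "((\<lambda>z. \<alpha> * fst z + \<beta> * snd z) has_derivative (\<lambda>h. \<alpha> * fst h + \<beta> * snd h)) (at z)" for z :: "real \<times> real"
    by (intro derivative_intros)
qed (auto intro!: Ck_add Ck_cmult)

lemma sobolev0_linear:
  assumes "sobolev0 u g" "sobolev0 w h"
  shows "sobolev0 (\<lambda>x. \<alpha> * u x + \<beta> * w x) (\<lambda>x. \<alpha> *\<^sub>R g x + \<beta> *\<^sub>R h x)"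
  using sobolev0_chain[OF smooth_lipschitz2_linear assms] .

lemma sobolev0_cmult:
  assumes "sobolev0 u g" shows "sobolev0 (\<lambda>x. c * u x) (\<lambda>x. c *\<^sub>R g x)"
  using sobolev0_linear[OF assms assms, of c 0] by simp

text \<open>For d \<ge> 0, half of a + |a - d| - d is the positive part of a - d. Here the absolute
  value is smoothed by e, and the subtracted constant is adjusted so that the value at a = 0 is
  exactly 0.\<close>

lemma smooth_lipschitz2_pos_part:
  assumes e: "e > 0"
  shows "smooth_lipschitz2
     (\<lambda>a b. (a + ((a - d)\<^sup>2 + e) powr (1/2) - ((0 - d)\<^sup>2 + e) powr (1/2)) / 2)
     (\<lambda>a b. (1 + (a - d) * ((a - d)\<^sup>2 + e) powr (-1/2)) / 2) (\<lambda>a b. 0) 1"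
  unfolding smooth_lipschitz2_def
proof (intro conjI allI impI)
  have pos: "(a - d)\<^sup>2 + e > 0" for a using e by (simp add: add_nonneg_pos)
  show "Ck k (\<lambda>x. (f x + ((f x - d)\<^sup>2 + e) powr (1/2) - ((0 - d)\<^sup>2 + e) powr (1/2)) / 2)"
    if "\<forall>k. Ck k f" for f g :: "'a \<Rightarrow> real" and k
  proof -
    have "Ck k (\<lambda>x. (1/2) * (f x + ((f x - d)\<^sup>2 + e) powr (1/2) - ((0 - d)\<^sup>2 + e) powr (1/2)))"
      using that pos by (intro Ck_cmult Ck_diff Ck_add Ck_powr Ck_power Ck_const) auto
    then show ?thesis by simp
  qed
  show "((\<lambda>z. (fst z + ((fst z - d)\<^sup>2 + e) powr (1/2) - ((0 - d)\<^sup>2 + e) powr (1/2)) / 2) has_derivative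
      (\<lambda>h. (1 + (fst z - d) * ((fst z - d)\<^sup>2 + e) powr (-1/2)) / 2 * fst h + 0 * snd h)) (at z)" for z :: "real \<times> real"
  proof -
    let ?s = "fst z"
    have "((\<lambda>s. (s + ((s - d)\<^sup>2 + e) powr (1/2) - ((0 - d)\<^sup>2 + e) powr (1/2)) / 2) has_real_derivative
        (1 + (2 * (1/2) * (?s - d)) * ((?s - d)\<^sup>2 + e) powr (1/2 - 1) - 0) / 2) (at ?s)"
      by (intro DERIV_cdivide DERIV_diff DERIV_add DERIV_ident DERIV_powr_shifted_square e DERIV_const)
    from has_derivative_fst_compose[OF this] show ?thesis by simp
  qed
  show "continuous_on UNIV (\<lambda>z::real \<times> real. (1 + (fst z - d) * ((fst z - d)\<^sup>2 + e) powr (-1/2)) / 2)"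
    using pos by (intro continuous_intros) (auto simp: less_imp_neq[symmetric])
  show "\<bar>(1 + (a - d) * ((a - d)\<^sup>2 + e) powr (-1/2)) / 2\<bar> \<le> 1" for a
  proof -
    have "\<bar>a - d\<bar> = ((a - d)\<^sup>2) powr (1/2)" by (simp add: powr_half_sqrt)
    also have "\<dots> \<le> ((a - d)\<^sup>2 + e) powr (1/2)" using e by (intro powr_mono2) auto
    finally have "\<bar>a - d\<bar> * ((a - d)\<^sup>2 + e) powr (-1/2) \<le> ((a - d)\<^sup>2 + e) powr (1/2) * ((a - d)\<^sup>2 + e) powr (-1/2)"
      by (rule mult_right_mono) simp
    also have "\<dots> = 1" using pos[of a] by (simp flip: powr_add)
    finally have "\<bar>(a - d) * ((a - d)\<^sup>2 + e) powr (-1/2)\<bar> \<le> 1" by (simp add: abs_mult)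
    moreover have "\<bar>(1 + s) / 2\<bar> \<le> 1" if "\<bar>s\<bar> \<le> 1" for s :: real
      using that by (simp add: abs_le_iff)
    ultimately show ?thesis by blast
  qed
qed auto

text \<open>The centre of the regularised kink is moved slightly to the right of \<open>c\<close>, so that its
  derivative tends to \<open>0\<close> also on the level set \<open>u = c\<close>.\<close>

lemma sobolev0_pos_part:
  assumes u: "sobolev0 u g" and c: "c \<ge> 0"
  shows "sobolev0 (\<lambda>x. max (u x - c) 0) (\<lambda>x. if u x > c then g x else 0)"
proof -
  note [measurable] = sobolev0_measurable[OF u]
  define d where "d = (\<lambda>n::nat. c + 1 / real (Suc n))"
  \<comment> \<open>The fourth power makes e negligible against the square of the shift in d: at u =
    c the slope term is -(1 + r^2)^(-1/2) with r = 1 / \<open>Suc n\<close>, which tends to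
    -1.\<close>
  define e where "e = (\<lambda>n::nat. 1 / real (Suc n) ^ 4)"
  have e: "e n > 0" for n by (simp add: e_def)
  have "(\<lambda>n. 1 / real (Suc n)) \<longlonglongrightarrow> 0" using LIMSEQ_inverse_real_of_nat by (simp add: inverse_eq_divide)
  then have dl: "d \<longlonglongrightarrow> c" unfolding d_def using tendsto_add[OF tendsto_const] by fastforce
  have "(\<lambda>n. (1 / real (Suc n)) ^ 4) \<longlonglongrightarrow> 0 ^ 4"
    using LIMSEQ_inverse_real_of_nat by (intro tendsto_power) (simp add: inverse_eq_divide)
  then have el: "e \<longlonglongrightarrow> 0" by (simp add: e_def power_divide)
  have pw: "(\<lambda>n. ((a - d n)\<^sup>2 + e n) powr (1/2)) \<longlonglongrightarrow> \<bar>a - c\<bar>" for a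
  proof -
    have "(\<lambda>n. ((a - d n)\<^sup>2 + e n) powr (1/2)) \<longlonglongrightarrow> ((a - c)\<^sup>2 + 0) powr (1/2)"
      using e by (intro tendsto_powr' tendsto_intros dl el) (auto simp: less_imp_le add_nonneg_nonneg)
    then show ?thesis by (simp add: powr_half_sqrt)
  qed
  show ?thesis
  proof (rule sobolev0_chain_limit[OF smooth_lipschitz2_pos_part[OF e] u u])
    show "AE x in M. (\<lambda>n. (u x + ((u x - d n)\<^sup>2 + e n) powr (1/2) - ((0 - d n)\<^sup>2 + e n) powr (1/2)) / 2)
        \<longlonglongrightarrow> max (u x - c) 0"
    proof (intro AE_I2)
      fix x
      have "(\<lambda>n. (u x + ((u x - d n)\<^sup>2 + e n) powr (1/2) - ((0 - d n)\<^sup>2 + e n) powr (1/2)) / 2)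
        \<longlonglongrightarrow> (u x + \<bar>u x - c\<bar> - \<bar>0 - c\<bar>) / 2"
        by (intro tendsto_intros pw) auto
      also have "(u x + \<bar>u x - c\<bar> - \<bar>0 - c\<bar>) / 2 = max (u x - c) 0" using c by (auto simp: max_def)
      finally show "(\<lambda>n. (u x + ((u x - d n)\<^sup>2 + e n) powr (1/2) - ((0 - d n)\<^sup>2 + e n) powr (1/2)) / 2)
        \<longlonglongrightarrow> max (u x - c) 0" .
    qed
    have P: "(\<lambda>n. (1 + (a - d n) * ((a - d n)\<^sup>2 + e n) powr (-1/2)) / 2) \<longlonglongrightarrow> (if a > c then 1 else 0)" for a
    proof (cases "a = c")
      case False
      have "(\<lambda>n. ((a - d n)\<^sup>2 + e n) powr (-1/2)) \<longlonglongrightarrow> ((a - c)\<^sup>2 + 0) powr (-1/2)"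
        using False by (intro tendsto_powr tendsto_intros dl el) auto
      also have "((a - c)\<^sup>2 + 0) powr (-1/2) = 1 / \<bar>a - c\<bar>"
        by (simp add: powr_half_sqrt powr_minus_divide)
      finally have "(\<lambda>n. (1 + (a - d n) * ((a - d n)\<^sup>2 + e n) powr (-1/2)) / 2) \<longlonglongrightarrow> (1 + (a - c) * (1 / \<bar>a - c\<bar>)) / 2"
        by (intro tendsto_intros dl) auto
      also have "(1 + (a - c) * (1 / \<bar>a - c\<bar>)) / 2 = (if a > c then 1 else 0)"
        using False by (auto simp: abs_if field_simps)
      finally show ?thesis .
    next
      case True
      have "(a - d n) * ((a - d n)\<^sup>2 + e n) powr (-1/2) = - ((1 + (1 / real (Suc n))\<^sup>2) powr (-1/2))" for n
      proof -
        define r where "r = 1 / real (Suc n)"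
        have r: "r > 0" "a - d n = - r" "e n = r ^ 4" using True by (auto simp: r_def d_def e_def power_divide)
        have "(a - d n)\<^sup>2 + e n = r\<^sup>2 * (1 + r\<^sup>2)" unfolding r by (simp add: algebra_simps power2_eq_square power4_eq_xxxx)
        then have "((a - d n)\<^sup>2 + e n) powr (-1/2) = (r\<^sup>2) powr (-1/2) * (1 + r\<^sup>2) powr (-1/2)"
          by (simp add: powr_mult)
        also have "(r\<^sup>2) powr (-1/2) = 1 / r" using r by (simp add: powr_half_sqrt powr_minus_divide)
        finally show ?thesis using r by (simp add: r_def)
      qed
      moreover have "(\<lambda>n. (1 + - ((1 + (1 / real (Suc n))\<^sup>2) powr (-1/2))) / 2) \<longlonglongrightarrow> (1 + - ((1 + 0\<^sup>2) powr (-1/2))) / 2"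
        using LIMSEQ_inverse_real_of_nat by (intro tendsto_intros) (auto simp: inverse_eq_divide)
      ultimately show ?thesis using True by simp
    qed
    show "AE x in M. (\<lambda>n. ((1 + (u x - d n) * ((u x - d n)\<^sup>2 + e n) powr (-1/2)) / 2) *\<^sub>R g x + 0 *\<^sub>R g x)
        \<longlonglongrightarrow> (if u x > c then g x else 0)"
    proof (intro AE_I2)
      fix x
      have "(\<lambda>n. ((1 + (u x - d n) * ((u x - d n)\<^sup>2 + e n) powr (-1/2)) / 2) *\<^sub>R g x + 0 *\<^sub>R g x)
        \<longlonglongrightarrow> (if u x > c then 1 else 0) *\<^sub>R g x + 0 *\<^sub>R g x"
        by (intro tendsto_intros P)
      then show "(\<lambda>n. ((1 + (u x - d n) * ((u x - d n)\<^sup>2 + e n) powr (-1/2)) / 2) *\<^sub>R g x + 0 *\<^sub>R g x)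
        \<longlonglongrightarrow> (if u x > c then g x else 0)" by (simp split: if_splits)
    qed
  qed measurable
qed

lemma sobolev0_abs_gradient:
  assumes u: "sobolev0 u g"
  shows "sobolev0 (\<lambda>x. \<bar>u x\<bar>) (\<lambda>x. sgn (u x) *\<^sub>R g x)"
proof -
  have m: "sobolev0 (\<lambda>x. (-1) * u x) (\<lambda>x. (-1) *\<^sub>R g x)" by (rule sobolev0_cmult[OF u])
  have "sobolev0 (\<lambda>x. 1 * max (u x - 0) 0 + 1 * max ((-1) * u x - 0) 0)
      (\<lambda>x. 1 *\<^sub>R (if u x > 0 then g x else 0) + 1 *\<^sub>R (if (-1) * u x > 0 then (-1) *\<^sub>R g x else 0))"
    by (intro sobolev0_linear sobolev0_pos_part u m order_refl)
  also have "(\<lambda>x. 1 * max (u x - 0) 0 + 1 * max ((-1) * u x - 0) 0) = (\<lambda>x. \<bar>u x\<bar>)"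
    by (auto simp: max_def abs_if)
  also have "(\<lambda>x. 1 *\<^sub>R (if u x > 0 then g x else 0) + 1 *\<^sub>R (if (-1) * u x > 0 then (-1) *\<^sub>R g x else 0))
      = (\<lambda>x. sgn (u x) *\<^sub>R g x)"
    by (auto simp: sgn_if fun_eq_iff)
  finally show ?thesis .
qed

text \<open>Stampacchia's observation: u is the difference of the positive parts of u and -u, and
  the gradient obtained from these carries strict inequalities, hence vanishes where u = 0.
  Uniqueness of weak gradients transfers this to g.\<close>

lemma sobolev0_gradient_zero:
  assumes u: "sobolev0 u g" shows "AE x in M. u x = 0 \<longrightarrow> g x = 0"
proof -
  have m: "sobolev0 (\<lambda>x. (-1) * u x) (\<lambda>x. (-1) *\<^sub>R g x)" by (rule sobolev0_cmult[OF u])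
  have "sobolev0 (\<lambda>x. 1 * max (u x - 0) 0 + (-1) * max ((-1) * u x - 0) 0)
      (\<lambda>x. 1 *\<^sub>R (if u x > 0 then g x else 0) + (-1) *\<^sub>R (if (-1) * u x > 0 then (-1) *\<^sub>R g x else 0))"
    by (intro sobolev0_linear sobolev0_pos_part u m order_refl)
  also have "(\<lambda>x. 1 * max (u x - 0) 0 + (-1) * max ((-1) * u x - 0) 0) = u"
    by (auto simp: max_def abs_if)
  finally have "AE x in M. weak_grad \<Omega> u x =
      1 *\<^sub>R (if u x > 0 then g x else 0) + (-1) *\<^sub>R (if (-1) * u x > 0 then (-1) *\<^sub>R g x else 0)"
    by (rule sobolev0_weak_grad)
  with sobolev0_weak_grad[OF u] show ?thesis
    by eventually_elim (auto split: if_splits)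
qed

text \<open>The bound 1 is uniform in e: S is at least one of its summands \<tau> A^(p/2), where A
  is the shifted square, and 1/p - 1 is negative. With |a| \<le> A^(1/2) all powers of A cancel, and
  what is left is \<tau>^(1/p) \<le> 1.\<close>

lemma smooth_lipschitz2_power_mean:
  assumes t: "0 < t" "t < 1" and e: "e > 0"
  defines "S \<equiv> \<lambda>a b. (1 - t) * ((a - 0)\<^sup>2 + e) powr (p/2) + t * ((b - 0)\<^sup>2 + e) powr (p/2)"
  shows "smooth_lipschitz2 (\<lambda>a b. S a b powr (1/p) - S 0 0 powr (1/p))
     (\<lambda>a b. (1 - t) * (a * (a\<^sup>2 + e) powr (p/2 - 1)) * S a b powr (1/p - 1))
     (\<lambda>a b. t * (b * (b\<^sup>2 + e) powr (p/2 - 1)) * S a b powr (1/p - 1)) 1"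
  unfolding smooth_lipschitz2_def
proof (intro conjI allI impI)
  have pos: "a\<^sup>2 + e > 0" for a :: real using e by (simp add: add_nonneg_pos)
  have pw: "((a - 0)\<^sup>2 + e) powr (p/2) > 0" for a :: real using pos[of a] by simp
  have S: "S a b > 0" for a b unfolding S_def using t pw[of a] pw[of b] by (intro add_pos_pos mult_pos_pos) auto
  show "Ck k (\<lambda>x. S (f x) (g x) powr (1/p) - S 0 0 powr (1/p))"
    if "\<forall>k. Ck k f" "\<forall>k. Ck k g" for f g :: "'a \<Rightarrow> real" and k
  proof -
    have "Ck k (\<lambda>x. S (f x) (g x))"
      unfolding S_def using that pos by (intro Ck_add Ck_cmult Ck_powr Ck_power Ck_const Ck_diff) auto
    then show ?thesis using S by (intro Ck_diff Ck_powr Ck_const) auto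
  qed
  show "((\<lambda>z. S (fst z) (snd z) powr (1/p) - S 0 0 powr (1/p)) has_derivative
      (\<lambda>h. (1 - t) * (fst z * ((fst z)\<^sup>2 + e) powr (p/2 - 1)) * S (fst z) (snd z) powr (1/p - 1) * fst h
         + t * (snd z * ((snd z)\<^sup>2 + e) powr (p/2 - 1)) * S (fst z) (snd z) powr (1/p - 1) * snd h)) (at z)"
    for z :: "real \<times> real"
  proof -
    have 1: "((\<lambda>z. S (fst z) (snd z)) has_derivative
      (\<lambda>h. (1 - t) * ((2 * (p/2) * (fst z - 0)) * ((fst z - 0)\<^sup>2 + e) powr (p/2 - 1) * fst h)
         + t * ((2 * (p/2) * (snd z - 0)) * ((snd z - 0)\<^sup>2 + e) powr (p/2 - 1) * snd h))) (at z)"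
      unfolding S_def
      by (intro has_derivative_add has_derivative_mult_right has_derivative_fst_compose
          has_derivative_snd_compose DERIV_powr_shifted_square e)
    have 2: "((\<lambda>s. s powr (1/p)) has_derivative (*) ((1/p) * S (fst z) (snd z) powr (1/p - 1))) (at (S (fst z) (snd z)))"
      using has_real_derivative_powr[OF S, of "1/p"] by (simp add: has_field_derivative_def)
    have "((\<lambda>z. S (fst z) (snd z) powr (1/p)) has_derivative (\<lambda>h. (1/p) * S (fst z) (snd z) powr (1/p - 1) *
       ((1 - t) * ((2 * (p/2) * (fst z - 0)) * ((fst z - 0)\<^sup>2 + e) powr (p/2 - 1) * fst h)
         + t * ((2 * (p/2) * (snd z - 0)) * ((snd z - 0)\<^sup>2 + e) powr (p/2 - 1) * snd h)))) (at z)"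
      using has_derivative_compose[OF 1 2] .
    from has_derivative_diff[OF this has_derivative_const] show ?thesis
      by (rule has_derivative_eq_rhs) (use p_gt_1 in \<open>auto simp: fun_eq_iff field_simps\<close>)
  qed
  have c: "continuous_on UNIV (\<lambda>z::real \<times> real. S (fst z) (snd z))"
    unfolding S_def using pos by (intro continuous_intros) (auto simp: less_imp_neq[symmetric])
  show "continuous_on UNIV (\<lambda>z::real \<times> real. (1 - t) * (fst z * ((fst z)\<^sup>2 + e) powr (p/2 - 1)) * S (fst z) (snd z) powr (1/p - 1))"
    "continuous_on UNIV (\<lambda>z::real \<times> real. t * (snd z * ((snd z)\<^sup>2 + e) powr (p/2 - 1)) * S (fst z) (snd z) powr (1/p - 1))"
    using pos S by (intro continuous_intros c; auto simp: less_imp_neq[symmetric])+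
  have bd: "\<bar>\<tau> * (a * (a\<^sup>2 + e) powr (p/2 - 1)) * T powr (1/p - 1)\<bar> \<le> 1"
    if \<tau>: "0 < \<tau>" "\<tau> \<le> 1" and T: "T \<ge> \<tau> * (a\<^sup>2 + e) powr (p/2)" for \<tau> a T :: real
  proof -
    define A where "A = a\<^sup>2 + e"
    have A: "A > 0" using pos by (simp add: A_def)
    have a: "\<bar>a\<bar> \<le> A powr (1/2)"
    proof -
      have "\<bar>a\<bar> = (a\<^sup>2) powr (1/2)" by (simp add: powr_half_sqrt)
      also have "\<dots> \<le> A powr (1/2)" unfolding A_def using e by (intro powr_mono2) auto
      finally show ?thesis .
    qed
    have "T powr (1/p - 1) \<le> (\<tau> * A powr (p/2)) powr (1/p - 1)"
      using T \<tau> A p_gt_1 by (intro powr_mono2') (auto simp: A_def field_simps)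
    also have "\<dots> = \<tau> powr (1/p - 1) * A powr (1/2 - p/2)"
      using \<tau> A p_gt_1 by (simp add: powr_mult powr_powr right_diff_distrib)
    finally have Tb: "T powr (1/p - 1) \<le> \<tau> powr (1/p - 1) * A powr (1/2 - p/2)" .
    have "\<bar>\<tau> * (a * A powr (p/2 - 1)) * T powr (1/p - 1)\<bar> = \<tau> * (\<bar>a\<bar> * A powr (p/2 - 1)) * T powr (1/p - 1)"
      using \<tau> by (simp add: abs_mult)
    also have "\<dots> \<le> \<tau> * (A powr (1/2) * A powr (p/2 - 1)) * (\<tau> powr (1/p - 1) * A powr (1/2 - p/2))"
      using \<tau> a Tb by (intro mult_mono) auto
    also have "\<dots> = (\<tau> powr 1 * \<tau> powr (1/p - 1)) * (A powr (1/2) * A powr (p/2 - 1) * A powr (1/2 - p/2))"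
      using \<tau> by (simp add: mult_ac)
    also have "\<dots> = \<tau> powr (1/p)" unfolding powr_add[symmetric] using A by simp
    also have "\<dots> \<le> 1" using \<tau> p_gt_1 by (intro powr_le1) auto
    finally show ?thesis by (simp add: A_def)
  qed
  show "\<bar>(1 - t) * (a * (a\<^sup>2 + e) powr (p/2 - 1)) * S a b powr (1/p - 1)\<bar> \<le> 1" for a b
    using t pw[of b] by (intro bd) (auto simp: S_def)
  show "\<bar>t * (b * (b\<^sup>2 + e) powr (p/2 - 1)) * S a b powr (1/p - 1)\<bar> \<le> 1" for a b
    using t pw[of a] by (intro bd) (auto simp: S_def)
qed auto

text \<open>Limit of the smooth power means as e tends to 0. Positivity of w gives S x > 0 for
  almost every x, so the negative power 1/p - 1 passes to the limit.\<close>

lemma sobolev0_power_mean: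
  assumes t: "0 < t" "t < 1" and v: "sobolev0 v a" and w: "sobolev0 w b"
    and v0: "\<And>x. v x \<ge> 0" and w0: "AE x in M. w x > 0"
  defines "S \<equiv> \<lambda>x. (1 - t) * v x powr p + t * w x powr p"
  shows "sobolev0 (\<lambda>x. S x powr (1/p))
    (\<lambda>x. S x powr (1/p - 1) *\<^sub>R (((1 - t) * v x powr (p - 1)) *\<^sub>R a x + (t * w x powr (p - 1)) *\<^sub>R b x))"
proof -
  note [measurable] = sobolev0_measurable[OF v] sobolev0_measurable[OF w]
  define e where "e = (\<lambda>n::nat. 1 / real (Suc n))"
  have e: "e n > 0" for n by (simp add: e_def)
  have el: "e \<longlonglongrightarrow> 0" unfolding e_def using LIMSEQ_inverse_real_of_nat by (simp add: inverse_eq_divide)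
  have sq: "(s\<^sup>2) powr (r/2) = s powr r" if "s \<ge> 0" for s r :: real
  proof (cases "s = 0")
    case False
    then have "s\<^sup>2 = s powr 2" using that by (simp add: powr_numeral)
    then show ?thesis by (simp add: powr_powr)
  qed simp
  have l1: "(\<lambda>n. ((s - 0)\<^sup>2 + e n) powr (p/2)) \<longlonglongrightarrow> s powr p" if "s \<ge> 0" for s
  proof -
    have "(\<lambda>n. ((s - 0)\<^sup>2 + e n) powr (p/2)) \<longlonglongrightarrow> ((s - 0)\<^sup>2 + 0) powr (p/2)"
      using e p_gt_1 by (intro tendsto_powr' tendsto_intros el) (auto simp: less_imp_le add_nonneg_nonneg)
    then show ?thesis using sq[OF that] by simp
  qed
  have l2: "(\<lambda>n. s * (s\<^sup>2 + e n) powr (p/2 - 1)) \<longlonglongrightarrow> s powr (p - 1)" if "s \<ge> 0" for s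
  proof (cases "s = 0")
    case False
    then have "(\<lambda>n. s * (s\<^sup>2 + e n) powr (p/2 - 1)) \<longlonglongrightarrow> s * (s\<^sup>2 + 0) powr (p/2 - 1)"
      by (intro tendsto_intros el) auto
    also have "(s\<^sup>2 + 0) powr (p/2 - 1) = s powr (p - 2)" using sq[OF that, of "p - 2"] by (simp add: diff_divide_distrib)
    also have "s * s powr (p - 2) = s powr (p - 1)"
      using that False powr_add[of s 1 "p - 2"] by simp
    finally show ?thesis .
  qed simp
  define T where "T = (\<lambda>n a b. (1 - t) * ((a - 0)\<^sup>2 + e n) powr (p/2) + t * ((b - 0)\<^sup>2 + e n) powr (p/2))"
  have Tl: "(\<lambda>n. T n a b) \<longlonglongrightarrow> (1 - t) * a powr p + t * b powr p" if "a \<ge> 0" "b \<ge> 0" for a b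
    unfolding T_def using that by (intro tendsto_intros l1)
  have Tn: "T n a b \<ge> 0" for n a b unfolding T_def using t by (intro add_nonneg_nonneg mult_nonneg_nonneg) auto
  have H: "smooth_lipschitz2 (\<lambda>a b. T n a b powr (1/p) - T n 0 0 powr (1/p))
     (\<lambda>a b. (1 - t) * (a * (a\<^sup>2 + e n) powr (p/2 - 1)) * T n a b powr (1/p - 1))
     (\<lambda>a b. t * (b * (b\<^sup>2 + e n) powr (p/2 - 1)) * T n a b powr (1/p - 1)) 1" for n
    unfolding T_def by (rule smooth_lipschitz2_power_mean[OF t e])
  show ?thesis
  proof (rule sobolev0_chain_limit[OF H v w])
    show "(\<lambda>x. S x powr (1 / p)) \<in> borel_measurable M" unfolding S_def by measurable
    show "(\<lambda>x. S x powr (1/p - 1) *\<^sub>R (((1 - t) * v x powr (p - 1)) *\<^sub>R a x + (t * w x powr (p - 1)) *\<^sub>R b x))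
      \<in> borel_measurable M" unfolding S_def by measurable
    show "AE x in M. (\<lambda>n. T n (v x) (w x) powr (1/p) - T n 0 0 powr (1/p)) \<longlonglongrightarrow> S x powr (1/p)"
      using w0
    proof eventually_elim
      case (elim x)
      have "(\<lambda>n. T n (v x) (w x) powr (1/p) - T n 0 0 powr (1/p)) \<longlonglongrightarrow>
        ((1 - t) * v x powr p + t * w x powr p) powr (1/p) - ((1 - t) * 0 powr p + t * 0 powr p) powr (1/p)"
        using p_gt_1 v0 elim Tn
        by (intro tendsto_diff tendsto_powr' Tl tendsto_const) (auto simp: less_imp_le)
      then show ?case by (simp add: S_def)
    qed
    show "AE x in M. (\<lambda>n. ((1 - t) * (v x * ((v x)\<^sup>2 + e n) powr (p/2 - 1)) * T n (v x) (w x) powr (1/p - 1)) *\<^sub>R a x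
         + (t * (w x * ((w x)\<^sup>2 + e n) powr (p/2 - 1)) * T n (v x) (w x) powr (1/p - 1)) *\<^sub>R b x)
       \<longlonglongrightarrow> S x powr (1/p - 1) *\<^sub>R (((1 - t) * v x powr (p - 1)) *\<^sub>R a x + (t * w x powr (p - 1)) *\<^sub>R b x)"
      using w0
    proof eventually_elim
      case (elim x)
      have "S x > 0" unfolding S_def using t elim by (intro add_nonneg_pos) auto
      then have "(\<lambda>n. ((1 - t) * (v x * ((v x)\<^sup>2 + e n) powr (p/2 - 1)) * T n (v x) (w x) powr (1/p - 1)) *\<^sub>R a x
         + (t * (w x * ((w x)\<^sup>2 + e n) powr (p/2 - 1)) * T n (v x) (w x) powr (1/p - 1)) *\<^sub>R b x)
       \<longlonglongrightarrow> ((1 - t) * v x powr (p - 1) * S x powr (1/p - 1)) *\<^sub>R a x + (t * w x powr (p - 1) * S x powr (1/p - 1)) *\<^sub>R b x"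
        unfolding S_def using v0 elim
        by (intro tendsto_add tendsto_scaleR tendsto_mult l2 tendsto_const tendsto_powr Tl) (auto simp: less_imp_le)
      then show ?case by (simp add: scaleR_add_right mult_ac)
    qed
  qed
qed

end

section \<open>Hidden convexity\<close>

lemma powr_superadditive:
  fixes s t r :: real
  assumes "s \<ge> 0" "t \<ge> 0" "r \<ge> 1" shows "s powr r + t powr r \<le> (s + t) powr r"
proof (cases "s + t = 0")
  case True
  then have "s = 0" "t = 0" using assms by auto
  then show ?thesis by simp
next
  case False
  have le: "x powr r \<le> x * (s + t) powr (r - 1)" if "0 \<le> x" "x \<le> s + t" for x
  proof (cases "x = 0")
    case False
    then have "x powr r = x * x powr (r - 1)" using that powr_add[of x 1 "r - 1"] by simp
    also have "\<dots> \<le> x * (s + t) powr (r - 1)" using that assms by (intro mult_left_mono powr_mono2) auto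
    finally show ?thesis .
  qed simp
  have "s powr r + t powr r \<le> s * (s + t) powr (r - 1) + t * (s + t) powr (r - 1)"
    using assms by (intro add_mono le) auto
  also have "\<dots> = (s + t) * (s + t) powr (r - 1)" by (simp add: distrib_right)
  also have "\<dots> = (s + t) powr r" using assms False powr_add[of "s + t" 1 "r - 1"] by simp
  finally show ?thesis .
qed

lemma powr_convex_combination:
  fixes x y r :: real
  assumes "x \<ge> 0" "y \<ge> 0" "r \<ge> 1" "\<alpha> \<ge> 0" "\<beta> \<ge> 0" "\<alpha> + \<beta> = 1"
  shows "(\<alpha> * x + \<beta> * y) powr r \<le> \<alpha> * x powr r + \<beta> * y powr r"
proof -
  have le: "(\<gamma> * z) powr r \<le> \<gamma> * z powr r" if "0 \<le> \<gamma>" "\<gamma> \<le> 1" "z \<ge> 0" for \<gamma> z :: real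
  proof (cases "\<gamma> = 0")
    case False
    then have "\<gamma> powr r \<le> \<gamma> powr 1" using that assms(3) by (intro powr_mono') auto
    then show ?thesis using that by (simp add: powr_mult mult_right_mono)
  qed simp
  consider "x = 0" | "y = 0" | "x > 0" "y > 0" using assms by linarith
  then show ?thesis
  proof cases
    case 3
    have \<alpha>: "\<alpha> = 1 - \<beta>" using assms by simp
    show ?thesis
      unfolding \<alpha> using convex_onD[OF powr_convex[OF assms(3)], of \<beta> x y] 3 assms by simp
  qed (use le[of \<beta> y] le[of \<alpha> x] assms in auto)
qed

lemma norm_powr_convex_combination:
  fixes X Y :: "'b::real_normed_vector"
  assumes "r \<ge> 1" "\<alpha> \<ge> 0" "\<beta> \<ge> 0" "\<alpha> + \<beta> = 1"
  shows "norm (\<alpha> *\<^sub>R X + \<beta> *\<^sub>R Y) powr r \<le> \<alpha> * norm X powr r + \<beta> * norm Y powr r"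
proof -
  have "norm (\<alpha> *\<^sub>R X + \<beta> *\<^sub>R Y) \<le> \<alpha> * norm X + \<beta> * norm Y"
    using norm_triangle_ineq[of "\<alpha> *\<^sub>R X" "\<beta> *\<^sub>R Y"] assms by simp
  then have "norm (\<alpha> *\<^sub>R X + \<beta> *\<^sub>R Y) powr r \<le> (\<alpha> * norm X + \<beta> * norm Y) powr r"
    using assms by (intro powr_mono2) auto
  also have "\<dots> \<le> \<alpha> * norm X powr r + \<beta> * norm Y powr r"
    using assms by (intro powr_convex_combination) auto
  finally show ?thesis .
qed

lemma norm_square_powr_half: "(norm (X::'b::real_normed_vector))\<^sup>2 powr (r/2) = norm X powr r"
proof (cases "X = 0")
  case False
  then have "(norm X)\<^sup>2 powr (r/2) = (norm X powr 2) powr (r/2)" by (simp add: powr_numeral)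
  also have "\<dots> = norm X powr r" by (simp only: powr_powr) simp
  finally show ?thesis .
qed simp

text \<open>Parallelogram law for the squares, then superadditivity of s^(p/2) on the left and its
  convexity on the right.\<close>

lemma clarkson_midpoint:
  fixes X Y :: "'b::real_inner"
  assumes "p \<ge> 2"
  shows "norm ((1/2) *\<^sub>R (X + Y)) powr p + norm ((1/2) *\<^sub>R (X - Y)) powr p \<le> (norm X powr p + norm Y powr p) / 2"
proof -
  have par: "(norm ((1/2) *\<^sub>R (X + Y)))\<^sup>2 + (norm ((1/2) *\<^sub>R (X - Y)))\<^sup>2 = (1/2) * (norm X)\<^sup>2 + (1/2) * (norm Y)\<^sup>2"
    by (simp add: power2_norm_eq_inner inner_add_left inner_add_right inner_diff_left inner_diff_right inner_commute field_simps)
  have "norm ((1/2) *\<^sub>R (X + Y)) powr p + norm ((1/2) *\<^sub>R (X - Y)) powr p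
      = ((norm ((1/2) *\<^sub>R (X + Y)))\<^sup>2) powr (p/2) + ((norm ((1/2) *\<^sub>R (X - Y)))\<^sup>2) powr (p/2)"
    by (simp only: norm_square_powr_half)
  also have "\<dots> \<le> ((1/2) * (norm X)\<^sup>2 + (1/2) * (norm Y)\<^sup>2) powr (p/2)"
    unfolding par[symmetric] using assms by (intro powr_superadditive) auto
  also have "\<dots> \<le> (1/2) * ((norm X)\<^sup>2) powr (p/2) + (1/2) * ((norm Y)\<^sup>2) powr (p/2)"
    using assms by (intro powr_convex_combination) auto
  finally show ?thesis by (simp add: norm_square_powr_half add_divide_distrib)
qed

text \<open>Convexity turns an estimate at the midpoint into one at every point of the segment, with a
  loss that is only linear in the smaller weight.\<close>

lemma uniform_convexity_ge_2:
  fixes X Y :: "'b::real_inner"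
  assumes p: "p \<ge> 2" and ab: "\<alpha> \<ge> 0" "\<beta> \<ge> 0" "\<alpha> + \<beta> = 1"
  shows "norm (\<alpha> *\<^sub>R X + \<beta> *\<^sub>R Y) powr p + 2 * (1/2) powr p * (\<alpha> * \<beta> * norm (X - Y) powr p)
    \<le> \<alpha> * norm X powr p + \<beta> * norm Y powr p"
proof -
  have main: "norm (\<alpha> *\<^sub>R X + \<beta> *\<^sub>R Y) powr p + 2 * (1/2) powr p * (\<alpha> * \<beta> * norm (X - Y) powr p)
    \<le> \<alpha> * norm X powr p + \<beta> * norm Y powr p"
    if ab: "\<alpha> \<ge> 0" "\<alpha> \<le> \<beta>" "\<alpha> + \<beta> = 1" for \<alpha> \<beta> and X Y :: 'b
  proof -
    define Z where "Z = (1/2) *\<^sub>R (X + Y)"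
    define d where "d = (1/2) powr p * norm (X - Y) powr p"
    have d: "norm ((1/2) *\<^sub>R (X - Y)) powr p = d" by (simp add: d_def powr_mult powr_divide)
    \<comment> \<open>As \<alpha> \<le> \<beta>, the point lies between the midpoint Z and Y, with
      weights 2 \<alpha> and \<beta> - \<alpha>.\<close>
    have "\<alpha> *\<^sub>R X + \<beta> *\<^sub>R Y = (2 * \<alpha>) *\<^sub>R Z + (\<beta> - \<alpha>) *\<^sub>R Y"
      by (simp add: Z_def scaleR_add_right algebra_simps)
    also have "norm \<dots> powr p \<le> 2 * \<alpha> * norm Z powr p + (\<beta> - \<alpha>) * norm Y powr p"
      using p ab by (intro norm_powr_convex_combination) auto
    also have "\<dots> \<le> 2 * \<alpha> * ((norm X powr p + norm Y powr p) / 2 - d) + (\<beta> - \<alpha>) * norm Y powr p"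
    proof -
      have "norm Z powr p \<le> (norm X powr p + norm Y powr p) / 2 - d"
        using clarkson_midpoint[OF p, of X Y] unfolding Z_def[symmetric] d by argo
      then show ?thesis using ab by (intro add_right_mono mult_left_mono) auto
    qed
    also have "\<dots> = \<alpha> * norm X powr p + \<beta> * norm Y powr p - 2 * \<alpha> * d"
      by (simp add: algebra_simps)
    also have "\<dots> \<le> \<alpha> * norm X powr p + \<beta> * norm Y powr p - 2 * (\<alpha> * \<beta>) * d"
    proof -
      have "\<alpha> * \<beta> \<le> \<alpha> * 1" using ab by (intro mult_left_mono) auto
      then have "2 * (\<alpha> * \<beta>) * d \<le> 2 * \<alpha> * d" by (intro mult_right_mono) (auto simp: d_def)
      then show ?thesis by simp
    qed
    finally show ?thesis by (simp add: d_def mult_ac)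
  qed
  show ?thesis
  proof (cases "\<alpha> \<le> \<beta>")
    case True then show ?thesis using main[of \<alpha> \<beta> X Y] ab by simp
  next
    case False
    then show ?thesis using main[of \<beta> \<alpha> Y X] ab by (simp add: add.commute norm_minus_commute mult_ac)
  qed
qed

text \<open>Second-order expansion along the segment; the shift by \<open>e\<close> avoids the singularity of
  \<open>\<bar>\<cdot>\<bar>\<^sup>p\<close> at the origin.\<close>

lemma uniform_convexity_shifted:
  fixes X Y :: "'b::real_inner"
  assumes p: "1 < p" "p < 2" and ab: "\<alpha> \<ge> 0" "\<beta> \<ge> 0" "\<alpha> + \<beta> = 1" and e: "e > 0"
  shows "((norm (\<alpha> *\<^sub>R X + \<beta> *\<^sub>R Y))\<^sup>2 + e) powr (p/2)
      + p * (p - 1) / 2 * (\<alpha> * \<beta> * (((norm X)\<^sup>2 + (norm Y)\<^sup>2 + e) powr ((p - 2)/2) * (norm (X - Y))\<^sup>2))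
    \<le> \<alpha> * ((norm X)\<^sup>2 + e) powr (p/2) + \<beta> * ((norm Y)\<^sup>2 + e) powr (p/2)"
proof -
  define D where "D = X - Y"
  \<comment> \<open>A lower bound for the second derivative of h^(p/2) on [0, 1]: there h is at most
    |X|^2 + |Y|^2 + e, and the exponent p/2 - 1 is negative.\<close>
  define m where "m = p * (p - 1) * ((norm X)\<^sup>2 + (norm Y)\<^sup>2 + e) powr ((p - 2)/2) * (norm D)\<^sup>2"
  define h where "h s = (norm Y)\<^sup>2 + 2 * s * (Y \<bullet> D) + s\<^sup>2 * (norm D)\<^sup>2 + e" for s
  define h' where "h' s = 2 * (Y \<bullet> D) + 2 * s * (norm D)\<^sup>2" for s
  have h: "h s = (norm (Y + s *\<^sub>R D))\<^sup>2 + e" for s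
    unfolding h_def power2_norm_eq_inner
    by (simp add: inner_add_left inner_add_right inner_commute[of D Y] algebra_simps power2_eq_square)
  have hpos: "h s > 0" for s unfolding h using e by (simp add: add_nonneg_pos)
  have dh: "(h has_real_derivative h' s) (at s)" for s
    unfolding h_def[abs_def] h'_def by (auto intro!: derivative_eq_intros)
  have dh': "(h' has_real_derivative 2 * (norm D)\<^sup>2) (at s)" for s
    unfolding h'_def[abs_def] by (auto intro!: derivative_eq_intros)
  have h'sq: "(h' s)\<^sup>2 \<le> 4 * h s * (norm D)\<^sup>2" for s
  proof -
    have "h' s = 2 * ((Y + s *\<^sub>R D) \<bullet> D)" by (simp add: h'_def inner_add_left power2_norm_eq_inner)
    then have "(h' s)\<^sup>2 = 4 * ((Y + s *\<^sub>R D) \<bullet> D)\<^sup>2" by (simp add: power_mult_distrib)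
    also have "\<dots> \<le> 4 * ((norm (Y + s *\<^sub>R D))\<^sup>2 * (norm D)\<^sup>2)"
      using Cauchy_Schwarz_ineq[of "Y + s *\<^sub>R D" D] by (simp add: power2_norm_eq_inner)
    also have "\<dots> \<le> 4 * (h s * (norm D)\<^sup>2)"
      unfolding h using e by (intro mult_left_mono mult_right_mono) auto
    finally show ?thesis by simp
  qed
  \<comment> \<open>Removing a quadratic with second derivative m leaves a convex function; the
    distance m/2 (\<alpha> - \<alpha>^2) of the quadratic from its chord is the gain m/2 \<alpha>
    \<beta>.\<close>
  define g where "g s = h s powr (p/2) - m / 2 * s\<^sup>2" for s
  define g' where "g' s = p/2 * h s powr (p/2 - 1) * h' s - m * s" for s
  define g'' where "g'' s = p/2 * ((p/2 - 1) * h s powr (p/2 - 2) * h' s * h' s + h s powr (p/2 - 1) * (2 * (norm D)\<^sup>2)) - m" for s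
  have pw: "((\<lambda>s. h s powr r) has_real_derivative r * h s powr (r - 1) * h' s) (at s)" for r s
    using DERIV_fun_powr[OF dh hpos] by simp
  have 1: "(g has_real_derivative g' s) (at s)" for s
  proof -
    have "((\<lambda>s. h s powr (p/2) - m / 2 * s\<^sup>2) has_real_derivative (p/2) * h s powr (p/2 - 1) * h' s - m / 2 * (2 * s)) (at s)"
      by (intro DERIV_diff pw) (auto intro!: derivative_eq_intros)
    then show ?thesis by (simp add: g_def[abs_def] g'_def)
  qed
  have 2: "(g' has_real_derivative g'' s) (at s)" for s
  proof -
    have "((\<lambda>s. p/2 * (h s powr (p/2 - 1) * h' s) - m * s) has_real_derivative
       p/2 * (((p/2 - 1) * h s powr (p/2 - 1 - 1) * h' s) * h' s + 2 * (norm D)\<^sup>2 * h s powr (p/2 - 1)) - m) (at s)"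
      by (intro DERIV_diff DERIV_cmult DERIV_mult pw dh') (auto intro!: derivative_eq_intros)
    moreover have "(\<lambda>s. p/2 * (h s powr (p/2 - 1) * h' s) - m * s) = g'" by (simp add: g'_def fun_eq_iff)
    moreover have "p/2 * (((p/2 - 1) * h s powr (p/2 - 1 - 1) * h' s) * h' s + 2 * (norm D)\<^sup>2 * h s powr (p/2 - 1)) - m = g'' s"
      by (simp add: g''_def algebra_simps)
    ultimately show ?thesis by simp
  qed
  \<comment> \<open>Since p/2 - 1 < 0, the Cauchy-Schwarz bound h'^2 \<le> 4 h |D|^2 estimates the
    first term from below; the coefficients (p/2) (2 p - 4) and (p/2) 2 add up to p (p - 1).\<close>
  have 3: "g'' s \<ge> 0" if s: "s \<in> {0..1}" for s
  proof -
    have eq: "h s powr (p/2 - 2) * h s = h s powr (p/2 - 1)"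
      using powr_add[of "h s" "p/2 - 2" 1] hpos[of s] by simp
    have "(p/2 - 1) * h s powr (p/2 - 2) * (h' s)\<^sup>2 \<ge> (p/2 - 1) * h s powr (p/2 - 2) * (4 * h s * (norm D)\<^sup>2)"
      using p by (intro mult_left_mono_neg h'sq) (auto intro: mult_nonpos_nonneg)
    also have "(p/2 - 1) * h s powr (p/2 - 2) * (4 * h s * (norm D)\<^sup>2) = (p/2 - 1) * 4 * (h s powr (p/2 - 2) * h s) * (norm D)\<^sup>2"
      by (simp add: mult_ac)
    also have "\<dots> = (2 * p - 4) * h s powr (p/2 - 1) * (norm D)\<^sup>2" unfolding eq by (simp add: algebra_simps)
    finally have "g'' s \<ge> p/2 * ((2 * p - 4) * h s powr (p/2 - 1) * (norm D)\<^sup>2 + h s powr (p/2 - 1) * (2 * (norm D)\<^sup>2)) - m"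
      unfolding g''_def using p by (intro diff_right_mono mult_left_mono add_right_mono) (auto simp: power2_eq_square mult_ac)
    also have "p/2 * ((2 * p - 4) * h s powr (p/2 - 1) * (norm D)\<^sup>2 + h s powr (p/2 - 1) * (2 * (norm D)\<^sup>2))
        = p * (p - 1) * h s powr (p/2 - 1) * (norm D)\<^sup>2" by (simp add: algebra_simps)
    finally have 4: "g'' s \<ge> p * (p - 1) * h s powr (p/2 - 1) * (norm D)\<^sup>2 - m" .
    have "norm (Y + s *\<^sub>R D) powr 2 \<le> s * norm X powr 2 + (1 - s) * norm Y powr 2"
      using norm_powr_convex_combination[of 2 s "1 - s" X Y] s by (simp add: D_def algebra_simps)
    also have "\<dots> \<le> 1 * norm X powr 2 + 1 * norm Y powr 2" using s by (intro add_mono mult_right_mono) auto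
    finally have "h s \<le> (norm X)\<^sup>2 + (norm Y)\<^sup>2 + e" unfolding h by (simp add: powr_numeral)
    then have "((norm X)\<^sup>2 + (norm Y)\<^sup>2 + e) powr (p/2 - 1) \<le> h s powr (p/2 - 1)"
      using p hpos by (intro powr_mono2') auto
    then have "m \<le> p * (p - 1) * h s powr (p/2 - 1) * (norm D)\<^sup>2"
      unfolding m_def using p by (intro mult_right_mono mult_left_mono) (auto simp: diff_divide_distrib)
    with 4 show ?thesis by linarith
  qed
  have "convex_on {0..1} g"
    by (rule f''_ge0_imp_convex[of _ g g' g'']) (use 1 2 3 in auto)
  from convex_onD[OF this, of \<alpha> 0 1] have "g \<alpha> \<le> \<beta> * g 0 + \<alpha> * g 1"
    using ab by (simp add: eq_diff_eq[symmetric])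
  moreover have "Y + \<alpha> *\<^sub>R D = \<alpha> *\<^sub>R X + \<beta> *\<^sub>R Y"
  proof -
    have \<beta>: "\<beta> = 1 - \<alpha>" using ab by simp
    show ?thesis unfolding \<beta> by (simp add: D_def algebra_simps)
  qed
  moreover have "Y + 1 *\<^sub>R D = X" "Y + 0 *\<^sub>R D = Y" by (simp_all add: D_def)
  ultimately have "((norm (\<alpha> *\<^sub>R X + \<beta> *\<^sub>R Y))\<^sup>2 + e) powr (p/2) - m / 2 * \<alpha>\<^sup>2
      \<le> \<beta> * ((norm Y)\<^sup>2 + e) powr (p/2) + \<alpha> * (((norm X)\<^sup>2 + e) powr (p/2) - m / 2)"
    unfolding g_def h by simp
  moreover have "m / 2 * \<alpha>\<^sup>2 - m / 2 * \<alpha> = - (m / 2 * (\<alpha> * \<beta>))"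
  proof -
    have \<beta>: "\<beta> = 1 - \<alpha>" using ab by simp
    show ?thesis unfolding \<beta> by (simp add: power2_eq_square field_simps)
  qed
  ultimately have "((norm (\<alpha> *\<^sub>R X + \<beta> *\<^sub>R Y))\<^sup>2 + e) powr (p/2) + m / 2 * (\<alpha> * \<beta>)
      \<le> \<alpha> * ((norm X)\<^sup>2 + e) powr (p/2) + \<beta> * ((norm Y)\<^sup>2 + e) powr (p/2)"
    unfolding right_diff_distrib by argo
  then show ?thesis by (simp add: m_def D_def mult_ac)
qed

text \<open>Limit of the shifted estimate as e tends to 0. Unless X = Y = 0, where all terms vanish,
  |X|^2 + |Y|^2 is positive and the negative power is continuous there.\<close>

lemma uniform_convexity_less_2:
  fixes X Y :: "'b::real_inner"
  assumes p: "1 < p" "p < 2" and ab: "\<alpha> \<ge> 0" "\<beta> \<ge> 0" "\<alpha> + \<beta> = 1"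
  shows "norm (\<alpha> *\<^sub>R X + \<beta> *\<^sub>R Y) powr p
      + p * (p - 1) / 2 * (\<alpha> * \<beta> * (((norm X)\<^sup>2 + (norm Y)\<^sup>2) powr ((p - 2)/2) * (norm (X - Y))\<^sup>2))
    \<le> \<alpha> * norm X powr p + \<beta> * norm Y powr p"
proof (cases "X = 0 \<and> Y = 0")
  case True then show ?thesis by simp
next
  case False
  define e where "e = (\<lambda>n::nat. 1 / real (Suc n))"
  have e: "e n > 0" for n by (simp add: e_def)
  have el: "e \<longlonglongrightarrow> 0" unfolding e_def using LIMSEQ_inverse_real_of_nat by (simp add: inverse_eq_divide)
  have pw: "(\<lambda>n. ((norm Z)\<^sup>2 + e n) powr (p/2)) \<longlonglongrightarrow> norm Z powr p" for Z :: 'b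
  proof -
    have "(\<lambda>n. ((norm Z)\<^sup>2 + e n) powr (p/2)) \<longlonglongrightarrow> ((norm Z)\<^sup>2 + 0) powr (p/2)"
      using e p by (intro tendsto_powr' tendsto_intros el) (auto simp: less_imp_le add_nonneg_nonneg)
    then show ?thesis by (simp add: norm_square_powr_half)
  qed
  have pos: "(norm X)\<^sup>2 + (norm Y)\<^sup>2 \<noteq> 0" using False by (simp add: sum_power2_eq_zero_iff)
  have "(\<lambda>n. ((norm X)\<^sup>2 + (norm Y)\<^sup>2 + e n) powr ((p - 2)/2)) \<longlonglongrightarrow> ((norm X)\<^sup>2 + (norm Y)\<^sup>2 + 0) powr ((p - 2)/2)"
    using pos by (intro tendsto_powr tendsto_intros el) auto
  then have q: "(\<lambda>n. ((norm X)\<^sup>2 + (norm Y)\<^sup>2 + e n) powr ((p - 2)/2)) \<longlonglongrightarrow> ((norm X)\<^sup>2 + (norm Y)\<^sup>2) powr ((p - 2)/2)"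
    by simp
  show ?thesis
  proof (rule LIMSEQ_le)
    show "(\<lambda>n. ((norm (\<alpha> *\<^sub>R X + \<beta> *\<^sub>R Y))\<^sup>2 + e n) powr (p/2)
      + p * (p - 1) / 2 * (\<alpha> * \<beta> * (((norm X)\<^sup>2 + (norm Y)\<^sup>2 + e n) powr ((p - 2)/2) * (norm (X - Y))\<^sup>2)))
      \<longlonglongrightarrow> norm (\<alpha> *\<^sub>R X + \<beta> *\<^sub>R Y) powr p
      + p * (p - 1) / 2 * (\<alpha> * \<beta> * (((norm X)\<^sup>2 + (norm Y)\<^sup>2) powr ((p - 2)/2) * (norm (X - Y))\<^sup>2))"
      by (intro tendsto_add pw tendsto_mult tendsto_const q)
    show "(\<lambda>n. \<alpha> * ((norm X)\<^sup>2 + e n) powr (p/2) + \<beta> * ((norm Y)\<^sup>2 + e n) powr (p/2))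
      \<longlonglongrightarrow> \<alpha> * norm X powr p + \<beta> * norm Y powr p"
      by (intro tendsto_add pw tendsto_mult tendsto_const)
  qed (use uniform_convexity_shifted[OF p ab e] in auto)
qed

text \<open>The numerator of \<open>Rp\<close> as a function of the two vectors w \<nabla>v and v
  \<nabla>w; it is positively homogeneous of degree p.\<close>

definition remainder_num :: "real \<Rightarrow> 'b::real_inner \<Rightarrow> 'b \<Rightarrow> real" where
  "remainder_num p a b = (if p \<ge> 2 then norm (a - b) powr p
     else ((norm a)\<^sup>2 + (norm b)\<^sup>2) powr ((p - 2) / 2) * (norm (a - b))\<^sup>2)"

text \<open>For p \<ge> 2 the factor 2^(-p) comes from the half difference in the midpoint
  inequality and the 2 from the weight 2 \<alpha> of the midpoint; for p < 2 it is half of the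
  constant in the second-derivative bound.\<close>

definition convexity_const :: "real \<Rightarrow> real" where
  "convexity_const p = (if p \<ge> 2 then 2 * (1/2) powr p else p * (p - 1) / 2)"

lemma convexity_const_pos: "1 < p \<Longrightarrow> convexity_const p > 0"
  by (simp add: convexity_const_def)

lemma remainder_num_nonneg: "remainder_num p a b \<ge> 0"
  by (simp add: remainder_num_def)

lemma remainder_num_0 [simp]: "remainder_num p 0 0 = 0"
  by (simp add: remainder_num_def)

lemma remainder_num_scale:
  assumes "c > 0" shows "remainder_num p (c *\<^sub>R a) (c *\<^sub>R b) = c powr p * remainder_num p a b"
proof -
  have "((norm (c *\<^sub>R a))\<^sup>2 + (norm (c *\<^sub>R b))\<^sup>2) powr ((p - 2) / 2) * (norm (c *\<^sub>R a - c *\<^sub>R b))\<^sup>2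
      = c powr p * (((norm a)\<^sup>2 + (norm b)\<^sup>2) powr ((p - 2) / 2) * (norm (a - b))\<^sup>2)"
  proof -
    have "(norm (c *\<^sub>R a))\<^sup>2 + (norm (c *\<^sub>R b))\<^sup>2 = c\<^sup>2 * ((norm a)\<^sup>2 + (norm b)\<^sup>2)"
      by (simp add: power_mult_distrib distrib_left)
    moreover have "(c\<^sup>2) powr ((p - 2)/2) = c powr (p - 2)"
      using norm_square_powr_half[of c "p - 2"] assms by simp
    moreover have "c powr (p - 2) * c\<^sup>2 = c powr p"
      using assms powr_add[of c "p - 2" 2] by (simp add: powr_numeral)
    ultimately show ?thesis
      by (simp add: powr_mult scaleR_diff_right[symmetric] power_mult_distrib mult_ac)
  qed
  then show ?thesis
    using assms by (simp add: remainder_num_def scaleR_diff_right[symmetric] powr_mult)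
qed

lemma uniform_convexity:
  fixes X Y :: "'b::real_inner"
  assumes p: "1 < p" and ab: "\<alpha> \<ge> 0" "\<beta> \<ge> 0" "\<alpha> + \<beta> = 1"
  shows "norm (\<alpha> *\<^sub>R X + \<beta> *\<^sub>R Y) powr p + convexity_const p * (\<alpha> * \<beta> * remainder_num p X Y)
    \<le> \<alpha> * norm X powr p + \<beta> * norm Y powr p"
  using uniform_convexity_ge_2[OF _ ab, of p X Y] uniform_convexity_less_2[OF p _ ab, of X Y]
  by (simp add: remainder_num_def convexity_const_def)

text \<open>With the logarithmic gradients X = a/v and Y = b/w, the gradient of S^(1/p) is S^(1/p)
  times the average of X and Y with weights (1 - t) v^p / S and t w^p / S. Uniform convexity for
  these weights, multiplied by S, is the claim; the remainder is rescaled by its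
  homogeneity.\<close>

lemma hidden_convexity:
  fixes a b :: "'b::real_inner"
  assumes p: "1 < p" and t: "0 < t" "t < 1" and w: "w > 0" and v: "v \<ge> 0" "v = 0 \<Longrightarrow> a = 0"
  defines "S \<equiv> (1 - t) * v powr p + t * w powr p"
  shows "norm (S powr (1/p - 1) *\<^sub>R (((1 - t) * v powr (p - 1)) *\<^sub>R a + (t * w powr (p - 1)) *\<^sub>R b)) powr p
      + convexity_const p * (t * (1 - t)) * (remainder_num p (w *\<^sub>R a) (v *\<^sub>R b) / S)
    \<le> (1 - t) * norm a powr p + t * norm b powr p"
proof (cases "v = 0")
  case True
  \<comment> \<open>Here v has no logarithmic gradient; but a = 0, the remainder vanishes, and both
    sides equal t |b|^p.\<close>
  have S: "S = t * w powr p" using True by (simp add: S_def)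
  have "S powr (1/p - 1) * (t * w powr (p - 1)) = (t powr (1/p - 1) * t) * ((w powr p) powr (1/p - 1) * w powr (p - 1))"
    unfolding S using t w by (simp add: powr_mult mult_ac)
  also have "t powr (1/p - 1) * t = t powr (1/p)" using t powr_add[of t "1/p - 1" 1] by simp
  also have "(w powr p) powr (1/p - 1) * w powr (p - 1) = 1"
    using p w by (simp add: powr_powr right_diff_distrib flip: powr_add)
  finally have "S powr (1/p - 1) * (t * w powr (p - 1)) = t powr (1/p)" by simp
  moreover have "(t powr (1/p)) powr p = t" using t p by (simp add: powr_powr)
  ultimately show ?thesis using True v(2) t by (simp add: powr_mult)
next
  case False
  with v have v: "v > 0" by simp
  have vp: "v powr p > 0" "w powr p > 0" using v w by auto
  have S: "S > 0" unfolding S_def using t vp by (intro add_pos_pos mult_pos_pos) auto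
  define X where "X = (1/v) *\<^sub>R a"
  define Y where "Y = (1/w) *\<^sub>R b"
  define \<alpha> where "\<alpha> = (1 - t) * v powr p / S"
  define \<beta> where "\<beta> = t * w powr p / S"
  have ab: "\<alpha> \<ge> 0" "\<beta> \<ge> 0" "\<alpha> + \<beta> = 1"
    using t S vp by (auto simp: \<alpha>_def \<beta>_def S_def simp flip: add_divide_distrib)
  have aX: "a = v *\<^sub>R X" "b = w *\<^sub>R Y" using v w by (auto simp: X_def Y_def)
  have Sab: "(1 - t) * v powr p = S * \<alpha>" "t * w powr p = S * \<beta>" using S by (auto simp: \<alpha>_def \<beta>_def)
  have pp: "v powr (p - 1) * v = v powr p" "w powr (p - 1) * w = w powr p"
    using v w powr_add[of v "p - 1" 1] powr_add[of w "p - 1" 1] by auto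
  have "S powr (1/p - 1) *\<^sub>R (((1 - t) * v powr (p - 1)) *\<^sub>R a + (t * w powr (p - 1)) *\<^sub>R b)
     = S powr (1/p - 1) *\<^sub>R (((1 - t) * (v powr (p - 1) * v)) *\<^sub>R X + (t * (w powr (p - 1) * w)) *\<^sub>R Y)"
    by (simp add: aX mult_ac)
  also have "\<dots> = (S powr (1/p - 1) * S) *\<^sub>R (\<alpha> *\<^sub>R X + \<beta> *\<^sub>R Y)"
    unfolding pp Sab by (simp add: scaleR_add_right mult.assoc)
  also have "S powr (1/p - 1) * S = S powr (1/p)" using S powr_add[of S "1/p - 1" 1] by simp
  finally have 1: "norm (S powr (1/p - 1) *\<^sub>R (((1 - t) * v powr (p - 1)) *\<^sub>R a + (t * w powr (p - 1)) *\<^sub>R b)) powr p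
      = S * norm (\<alpha> *\<^sub>R X + \<beta> *\<^sub>R Y) powr p"
    using S p by (simp add: powr_mult powr_powr)
  have "remainder_num p (w *\<^sub>R a) (v *\<^sub>R b) = remainder_num p ((v * w) *\<^sub>R X) ((v * w) *\<^sub>R Y)"
    by (simp add: aX mult.commute)
  also have "\<dots> = v powr p * w powr p * remainder_num p X Y"
    using v w by (subst remainder_num_scale) (auto simp: powr_mult)
  finally have "(t * (1 - t)) * (remainder_num p (w *\<^sub>R a) (v *\<^sub>R b) / S)
     = ((1 - t) * v powr p) * (t * w powr p) * remainder_num p X Y / S" by (simp add: mult_ac)
  also have "\<dots> = S * (\<alpha> * \<beta> * remainder_num p X Y)" unfolding Sab using S by simp
  finally have 2: "convexity_const p * (t * (1 - t)) * (remainder_num p (w *\<^sub>R a) (v *\<^sub>R b) / S)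
     = S * (convexity_const p * (\<alpha> * \<beta> * remainder_num p X Y))"
    unfolding mult.assoc[of "convexity_const p"] by (simp only: mult.left_commute)
  have "(1 - t) * norm a powr p + t * norm b powr p
      = ((1 - t) * v powr p) * norm X powr p + (t * w powr p) * norm Y powr p"
    using v w by (simp add: aX powr_mult)
  also have "\<dots> = S * (\<alpha> * norm X powr p + \<beta> * norm Y powr p)"
    unfolding Sab by (simp add: algebra_simps)
  finally show ?thesis
    unfolding 1 2 using mult_left_mono[OF uniform_convexity[OF p ab, of X Y], of S] S
    by (simp add: distrib_left)
qed

section \<open>The minimizer and the deficit\<close>

lemma Rp_eq_remainder_num:
  "Rp \<Omega> p v w t x = remainder_num p (w x *\<^sub>R weak_grad \<Omega> v x) (v x *\<^sub>R weak_grad \<Omega> w x)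
     / ((1 - t) * v x powr p + t * w x powr p)"
  by (simp add: Rp_def remainder_num_def Let_def)

lemma borel_measurable_remainder_num [measurable]:
  fixes f g :: "'a \<Rightarrow> 'b::euclidean_space"
  assumes [measurable]: "f \<in> borel_measurable M" "g \<in> borel_measurable M"
  shows "(\<lambda>x. remainder_num p (f x) (g x)) \<in> borel_measurable M"
  unfolding remainder_num_def by (cases "p \<ge> 2") auto

lemma powr_concave_combination:
  fixes x y r :: real
  assumes "x \<ge> 0" "y \<ge> 0" "0 < r" "r \<le> 1" "\<alpha> \<ge> 0" "\<beta> \<ge> 0" "\<alpha> + \<beta> = 1"
  shows "\<alpha> * x powr r + \<beta> * y powr r \<le> (\<alpha> * x + \<beta> * y) powr r"
proof -
  have "(\<alpha> * x powr r + \<beta> * y powr r) powr (1/r) \<le> \<alpha> * (x powr r) powr (1/r) + \<beta> * (y powr r) powr (1/r)"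
    using assms by (intro powr_convex_combination) auto
  also have "\<dots> = \<alpha> * x + \<beta> * y" using assms by (simp add: powr_powr)
  finally have "((\<alpha> * x powr r + \<beta> * y powr r) powr (1/r)) powr r \<le> (\<alpha> * x + \<beta> * y) powr r"
    using assms by (intro powr_mono2) auto
  then show ?thesis using assms by (simp add: powr_powr)
qed

section \<open>Energies and Rayleigh quotients through explicit gradients\<close>

context finite_domain
begin

lemma sobolev0_integrable_powr:
  assumes s: "sobolev0 u g" and q: "0 < q" "q \<le> p"
  shows "integrable M (\<lambda>x. \<bar>u x\<bar> powr q)" "integrable M (\<lambda>x. norm (g x) powr p)"
proof -
  note [measurable] = sobolev0_measurable[OF s]
  have i: "integrable M (\<lambda>x. \<bar>u x\<bar> powr p)" "integrable M (\<lambda>x. norm (g x) powr p)"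
    using sobolev0_finite[OF s] by (auto intro!: integrableI_bounded simp: pint_def)
  show "integrable M (\<lambda>x. norm (g x) powr p)" by fact
  have "integrable M (\<lambda>x. 1 + \<bar>u x\<bar> powr p)" using i by simp
  then show "integrable M (\<lambda>x. \<bar>u x\<bar> powr q)"
  proof (rule Bochner_Integration.integrable_bound)
    have "\<bar>u x\<bar> powr q \<le> 1 + \<bar>u x\<bar> powr p" for x
    proof (cases "\<bar>u x\<bar> \<le> 1")
      case True
      then have "\<bar>u x\<bar> powr q \<le> 1" using q by (intro powr_le1) auto
      moreover have "\<bar>u x\<bar> powr p \<ge> 0" by simp
      ultimately show ?thesis by linarith
    next
      case False
      then have "\<bar>u x\<bar> powr q \<le> \<bar>u x\<bar> powr p" using q by (intro powr_mono) auto
      then show ?thesis by simp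
    qed
    then show "AE x in M. norm (\<bar>u x\<bar> powr q) \<le> norm (1 + \<bar>u x\<bar> powr p)" by simp
  qed measurable
qed

lemma integral_norm_weak_grad:
  assumes "sobolev0 u g"
  shows "(\<integral>x. norm (weak_grad \<Omega> u x) powr p \<partial>M) = (\<integral>x. norm (g x) powr p \<partial>M)"
proof (rule integral_cong_AE)
  note wg = sobolev0_has_weak_grad[OF assms]
  have [measurable]: "weak_grad \<Omega> u \<in> borel_measurable M" "g \<in> borel_measurable M"
    using weak_grad_AE_measurable[OF wg] sobolev0_measurable[OF assms] by auto
  show "(\<lambda>x. norm (weak_grad \<Omega> u x) powr p) \<in> borel_measurable M" "(\<lambda>x. norm (g x) powr p) \<in> borel_measurable M"
    by measurable
  show "AE x in M. norm (weak_grad \<Omega> u x) powr p = norm (g x) powr p"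
    using sobolev0_weak_grad[OF assms] by eventually_elim simp
qed

lemma integral_powr_pos_iff:
  assumes s: "sobolev0 u g" and q: "0 < q" "q \<le> p"
  shows "0 < (\<integral>x. \<bar>u x\<bar> powr q \<partial>M) \<longleftrightarrow> \<not> (AE x in M. u x = 0)"
proof -
  have "(\<integral>x. \<bar>u x\<bar> powr q \<partial>M) = 0 \<longleftrightarrow> (AE x in M. \<bar>u x\<bar> powr q = 0)"
    by (rule integral_nonneg_eq_0_iff_AE[OF sobolev0_integrable_powr(1)[OF s q]]) simp
  moreover have "(\<integral>x. \<bar>u x\<bar> powr q \<partial>M) \<ge> 0" by simp
  ultimately show ?thesis by (simp add: less_le)
qed

text \<open>Clearing the denominator extends the bound by the infimum to functions vanishing almost
  everywhere, for which no Rayleigh quotient enters the infimum.\<close>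

lemma lambda1_le:
  assumes s: "sobolev0 u g" and q: "0 < q" "q \<le> p"
  shows "lambda1 \<Omega> p q * (\<integral>x. \<bar>u x\<bar> powr q \<partial>M) powr (p / q) \<le> (\<integral>x. norm (g x) powr p \<partial>M)"
proof (cases "AE x in M. u x = 0")
  case True
  then have "(\<integral>x. \<bar>u x\<bar> powr q \<partial>M) = 0"
    using integral_powr_pos_iff[OF s q] integral_nonneg_AE[of "\<lambda>x. \<bar>u x\<bar> powr q" M] by (simp add: less_le)
  then show ?thesis using q by simp
next
  case False
  then have pos: "0 < (\<integral>x. \<bar>u x\<bar> powr q \<partial>M)" using integral_powr_pos_iff[OF s q] by simp
  have u: "u \<in> W1_0_nonzero \<Omega> p" using sobolev0_imp_W1_0[OF s] False by (simp add: W1_0_nonzero_def)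
  have "bdd_below (rayleigh \<Omega> p q ` W1_0_nonzero \<Omega> p)"
    by (rule bdd_belowI[of _ 0]) (auto simp: rayleigh_def)
  then have "lambda1 \<Omega> p q \<le> rayleigh \<Omega> p q u" unfolding lambda1_def using u by (rule cINF_lower)
  also have "\<dots> = (\<integral>x. norm (g x) powr p \<partial>M) / (\<integral>x. \<bar>u x\<bar> powr q \<partial>M) powr (p / q)"
    unfolding rayleigh_def integral_norm_weak_grad[OF s] ..
  finally show ?thesis using pos by (simp add: pos_le_divide_eq)
qed

end

section \<open>Comparison of a nonnegative function with the minimizer\<close>

locale minimizer = finite_domain \<Omega> p for \<Omega> :: "'a::euclidean_space set" and p :: real +
  fixes q :: real and \<phi> :: "'a \<Rightarrow> real"
  assumes q: "1 < q" "q \<le> p" and minimizer: "positive_minimizer \<Omega> p q \<phi>"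
begin

abbreviation lam where "lam \<equiv> lambda1 \<Omega> p q"

abbreviation d\<phi> where "d\<phi> \<equiv> weak_grad \<Omega> \<phi>"

abbreviation C where "C \<equiv> convexity_const p"

lemma q_pos: "0 < q" using q by simp

lemma sobolev0_minimizer: "sobolev0 \<phi> d\<phi>"
  using minimizer by (intro W1_0_imp_sobolev0) (auto simp: positive_minimizer_def W1_0_nonzero_def)

lemma minimizer_pos: "AE x in M. 0 < \<phi> x"
  using minimizer by (simp add: positive_minimizer_def)

lemma minimizer_integral_pos: "0 < (\<integral>x. \<bar>\<phi> x\<bar> powr q \<partial>M)"
  using minimizer integral_powr_pos_iff[OF sobolev0_minimizer q_pos q(2)]
  by (simp add: positive_minimizer_def W1_0_nonzero_def)

lemma minimizer_energy: "(\<integral>x. norm (d\<phi> x) powr p \<partial>M) = lam * (\<integral>x. \<bar>\<phi> x\<bar> powr q \<partial>M) powr (p / q)"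
  using minimizer minimizer_integral_pos by (simp add: positive_minimizer_def rayleigh_def field_simps)

lemma lambda_nonneg: "lam \<ge> 0"
proof -
  have "lam = rayleigh \<Omega> p q \<phi>" using minimizer by (simp add: positive_minimizer_def)
  also have "\<dots> \<ge> 0" by (simp add: rayleigh_def)
  finally show ?thesis .
qed

definition deficit :: "('a \<Rightarrow> real) \<Rightarrow> real" where
  "deficit v = (\<integral>x. norm (weak_grad \<Omega> v x) powr p \<partial>M) - lam * (\<integral>x. \<bar>v x\<bar> powr q \<partial>M) powr (p / q)"

text \<open>The disjunction in \<open>norm_eq\<close> serves both uses: normalised functions for
  general q, and arbitrary nonnegative functions in the homogeneous case.\<close>

context
  fixes v :: "'a \<Rightarrow> real"
  assumes v: "sobolev0 v (weak_grad \<Omega> v)" and v_nonneg: "\<And>x. v x \<ge> 0"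
    and norm_eq: "p = q \<or> (\<integral>x. \<bar>v x\<bar> powr q \<partial>M) = (\<integral>x. \<bar>\<phi> x\<bar> powr q \<partial>M)"
begin

lemma deficit_nonneg: "deficit v \<ge> 0"
  using lambda1_le[OF v q_pos q(2)] by (simp add: deficit_def)

lemma measurable_v [measurable]:
  "v \<in> borel_measurable M" "\<phi> \<in> borel_measurable M"
  "weak_grad \<Omega> v \<in> borel_measurable M" "d\<phi> \<in> borel_measurable M"
  using sobolev0_measurable[OF v] sobolev0_measurable[OF sobolev0_minimizer] by auto

lemma measurable_Rp [measurable]: "Rp \<Omega> p v \<phi> t \<in> borel_measurable M"
  unfolding Rp_eq_remainder_num[abs_def] by measurable

lemma Rp_nonneg: "0 \<le> t \<Longrightarrow> t \<le> 1 \<Longrightarrow> Rp \<Omega> p v \<phi> t x \<ge> 0"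
  unfolding Rp_eq_remainder_num by (intro divide_nonneg_nonneg remainder_num_nonneg add_nonneg_nonneg mult_nonneg_nonneg) auto

text \<open>Pointwise this is concavity of s^(q/p). After integration, raising a convex combination
  to the power p/q \<ge> 1 would in general go the wrong way; it does no harm if p = q, and if the
  two integrals agree the combination is just their common value.\<close>

lemma power_mean_norm_ge:
  assumes t: "0 < t" "t < 1"
  defines "\<sigma> \<equiv> \<lambda>x. ((1 - t) * v x powr p + t * \<phi> x powr p) powr (1/p)"
  assumes \<sigma>: "integrable M (\<lambda>x. \<bar>\<sigma> x\<bar> powr q)"
  shows "(1 - t) * (\<integral>x. \<bar>v x\<bar> powr q \<partial>M) powr (p / q) + t * (\<integral>x. \<bar>\<phi> x\<bar> powr q \<partial>M) powr (p / q)
    \<le> (\<integral>x. \<bar>\<sigma> x\<bar> powr q \<partial>M) powr (p / q)"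
proof -
  note iv = sobolev0_integrable_powr(1)[OF v q_pos q(2)]
  note i\<phi> = sobolev0_integrable_powr(1)[OF sobolev0_minimizer q_pos q(2)]
  have "(1 - t) * (\<integral>x. \<bar>v x\<bar> powr q \<partial>M) + t * (\<integral>x. \<bar>\<phi> x\<bar> powr q \<partial>M)
      = (\<integral>x. (1 - t) * \<bar>v x\<bar> powr q + t * \<bar>\<phi> x\<bar> powr q \<partial>M)"
    using iv i\<phi> by simp
  also have "\<dots> \<le> (\<integral>x. \<bar>\<sigma> x\<bar> powr q \<partial>M)"
  proof (rule integral_mono_AE[OF _ \<sigma>])
    show "integrable M (\<lambda>x. (1 - t) * \<bar>v x\<bar> powr q + t * \<bar>\<phi> x\<bar> powr q)" using iv i\<phi> by simp
    show "AE x in M. (1 - t) * \<bar>v x\<bar> powr q + t * \<bar>\<phi> x\<bar> powr q \<le> \<bar>\<sigma> x\<bar> powr q"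
      using minimizer_pos
    proof eventually_elim
      case (elim x)
      have "(1 - t) * (v x powr p) powr (q/p) + t * (\<phi> x powr p) powr (q/p)
          \<le> ((1 - t) * v x powr p + t * \<phi> x powr p) powr (q/p)"
        using t q by (intro powr_concave_combination) auto
      then show ?case using elim v_nonneg[of x] q
        by (simp add: \<sigma>_def powr_powr)
    qed
  qed
  finally have le: "(1 - t) * (\<integral>x. \<bar>v x\<bar> powr q \<partial>M) + t * (\<integral>x. \<bar>\<phi> x\<bar> powr q \<partial>M) \<le> (\<integral>x. \<bar>\<sigma> x\<bar> powr q \<partial>M)" .
  show ?thesis
  proof (cases "p = q")
    case True
    have "(\<integral>x. \<bar>w x\<bar> powr q \<partial>M) powr (p / q) = (\<integral>x. \<bar>w x\<bar> powr q \<partial>M)" for w :: "'a \<Rightarrow> real"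
      using True q by simp
    then show ?thesis using le by simp
  next
    case False
    then have eq: "(\<integral>x. \<bar>v x\<bar> powr q \<partial>M) = (\<integral>x. \<bar>\<phi> x\<bar> powr q \<partial>M)" using norm_eq by simp
    then have "(\<integral>x. \<bar>\<phi> x\<bar> powr q \<partial>M) \<le> (\<integral>x. \<bar>\<sigma> x\<bar> powr q \<partial>M)" using le by (simp add: algebra_simps)
    then have "(\<integral>x. \<bar>\<phi> x\<bar> powr q \<partial>M) powr (p / q) \<le> (\<integral>x. \<bar>\<sigma> x\<bar> powr q \<partial>M) powr (p / q)"
      using q by (intro powr_mono2) auto
    then show ?thesis using eq by (simp add: algebra_simps)
  qed
qed

lemma remainder_le_deficit:
  assumes t: "0 < t" "t < 1"
  shows "integrable M (Rp \<Omega> p v \<phi> t)" "C * t * (\<integral>x. Rp \<Omega> p v \<phi> t x \<partial>M) \<le> deficit v"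
proof -
  define S where "S = (\<lambda>x. (1 - t) * v x powr p + t * \<phi> x powr p)"
  define G where "G = (\<lambda>x. S x powr (1/p - 1) *\<^sub>R
    (((1 - t) * v x powr (p - 1)) *\<^sub>R weak_grad \<Omega> v x + (t * \<phi> x powr (p - 1)) *\<^sub>R d\<phi> x))"
  have \<sigma>: "sobolev0 (\<lambda>x. S x powr (1/p)) G"
    unfolding S_def G_def by (rule sobolev0_power_mean[OF t v sobolev0_minimizer v_nonneg minimizer_pos])
  note [measurable] = sobolev0_measurable[OF \<sigma>]
  note iG = sobolev0_integrable_powr(2)[OF \<sigma> q_pos q(2)]
  note ia = sobolev0_integrable_powr(2)[OF v q_pos q(2)]
  note ib = sobolev0_integrable_powr(2)[OF sobolev0_minimizer q_pos q(2)]
  have C: "C > 0" using p_gt_1 by (rule convexity_const_pos)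
  have ct: "C * (t * (1 - t)) > 0" using C t by simp
  have ptw: "AE x in M. norm (G x) powr p + C * (t * (1 - t)) * Rp \<Omega> p v \<phi> t x
      \<le> (1 - t) * norm (weak_grad \<Omega> v x) powr p + t * norm (d\<phi> x) powr p"
    using minimizer_pos sobolev0_gradient_zero[OF v]
  proof eventually_elim
    case (elim x)
    show ?case
      unfolding G_def S_def Rp_eq_remainder_num
      by (rule hidden_convexity[OF p_gt_1 t elim(1) v_nonneg]) (use elim(2) in simp)
  qed
  have iab: "integrable M (\<lambda>x. (1 - t) * norm (weak_grad \<Omega> v x) powr p + t * norm (d\<phi> x) powr p)"
    using ia ib by simp
  have iR': "integrable M (\<lambda>x. C * (t * (1 - t)) * Rp \<Omega> p v \<phi> t x)"
  proof (rule Bochner_Integration.integrable_bound[OF iab])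
    show "AE x in M. norm (C * (t * (1 - t)) * Rp \<Omega> p v \<phi> t x)
        \<le> norm ((1 - t) * norm (weak_grad \<Omega> v x) powr p + t * norm (d\<phi> x) powr p)"
      using ptw
    proof eventually_elim
      case (elim x)
      have "0 \<le> C * (t * (1 - t)) * Rp \<Omega> p v \<phi> t x" using ct Rp_nonneg[of t x] t by simp
      moreover have "norm (G x) powr p \<ge> 0" by simp
      ultimately show ?case using elim unfolding real_norm_def by linarith
    qed
  qed measurable
  have "integrable M (\<lambda>x. 1 / (C * (t * (1 - t))) * (C * (t * (1 - t)) * Rp \<Omega> p v \<phi> t x))"
    by (intro integrable_mult_right iR')
  moreover have "1 / (C * (t * (1 - t))) * (C * (t * (1 - t)) * r) = r" for r
    using C t by simp
  ultimately show iR: "integrable M (Rp \<Omega> p v \<phi> t)" by simp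
  have "(\<integral>x. norm (G x) powr p \<partial>M) + C * (t * (1 - t)) * (\<integral>x. Rp \<Omega> p v \<phi> t x \<partial>M)
      = (\<integral>x. norm (G x) powr p + C * (t * (1 - t)) * Rp \<Omega> p v \<phi> t x \<partial>M)"
    using iG iR by simp
  also have "\<dots> \<le> (\<integral>x. (1 - t) * norm (weak_grad \<Omega> v x) powr p + t * norm (d\<phi> x) powr p \<partial>M)"
    using iG iR' iab ptw by (intro integral_mono_AE) auto
  also have "\<dots> = (1 - t) * (\<integral>x. norm (weak_grad \<Omega> v x) powr p \<partial>M) + t * (\<integral>x. norm (d\<phi> x) powr p \<partial>M)"
    using ia ib by simp
  finally have 1: "(\<integral>x. norm (G x) powr p \<partial>M) + C * (t * (1 - t)) * (\<integral>x. Rp \<Omega> p v \<phi> t x \<partial>M)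
    \<le> (1 - t) * (\<integral>x. norm (weak_grad \<Omega> v x) powr p \<partial>M) + t * (\<integral>x. norm (d\<phi> x) powr p \<partial>M)" .
  have "lam * ((1 - t) * (\<integral>x. \<bar>v x\<bar> powr q \<partial>M) powr (p / q) + t * (\<integral>x. \<bar>\<phi> x\<bar> powr q \<partial>M) powr (p / q))
     \<le> lam * (\<integral>x. \<bar>S x powr (1/p)\<bar> powr q \<partial>M) powr (p / q)"
    using power_mean_norm_ge[OF t] sobolev0_integrable_powr(1)[OF \<sigma> q_pos q(2)] lambda_nonneg
    unfolding S_def by (intro mult_left_mono) auto
  also have "\<dots> \<le> (\<integral>x. norm (G x) powr p \<partial>M)" by (rule lambda1_le[OF \<sigma> q_pos q(2)])
  finally have 2: "lam * ((1 - t) * (\<integral>x. \<bar>v x\<bar> powr q \<partial>M) powr (p / q) + t * (\<integral>x. \<bar>\<phi> x\<bar> powr q \<partial>M) powr (p / q))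
     \<le> (\<integral>x. norm (G x) powr p \<partial>M)" .
  \<comment> \<open>The minimizer has no deficit, so its terms cancel and the right-hand side is (1
    - t) times the deficit of v. The same factor in t (1 - t) cancels, leaving a bound with the
    factor t alone.\<close>
  have "(1 - t) * (C * t * (\<integral>x. Rp \<Omega> p v \<phi> t x \<partial>M)) \<le> (1 - t) * deficit v"
    using 1 2 unfolding minimizer_energy deficit_def by (simp add: algebra_simps)
  then show "C * t * (\<integral>x. Rp \<Omega> p v \<phi> t x \<partial>M) \<le> deficit v" using t by simp
qed

lemma remainder_endpoint_le_deficit:
  "(\<integral>\<^sup>+x. ennreal (Rp \<Omega> p v \<phi> 1 x) \<partial>M) \<le> ennreal (deficit v / C)"
proof -
  have C: "C > 0" using p_gt_1 by (rule convexity_const_pos)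
  \<comment> \<open>The double \<open>Suc\<close> makes the sequence start at 1/2, keeping t
    positive.\<close>
  define t where "t = (\<lambda>n::nat. 1 - 1 / real (Suc (Suc n)))"
  have t: "0 < t n" "t n < 1" for n by (auto simp: t_def)
  have tl: "t \<longlonglongrightarrow> 1"
  proof -
    have "(\<lambda>n. 1 / real (Suc (Suc n))) \<longlonglongrightarrow> 0"
      using LIMSEQ_Suc[OF LIMSEQ_inverse_real_of_nat] by (simp add: inverse_eq_divide)
    from tendsto_diff[OF tendsto_const this] show ?thesis unfolding t_def by simp
  qed
  have "(\<integral>\<^sup>+x. ennreal (Rp \<Omega> p v \<phi> 1 x) \<partial>M) = (\<integral>\<^sup>+x. liminf (\<lambda>n. ennreal (Rp \<Omega> p v \<phi> (t n) x)) \<partial>M)"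
  proof (rule nn_integral_cong_AE)
    show "AE x in M. ennreal (Rp \<Omega> p v \<phi> 1 x) = liminf (\<lambda>n. ennreal (Rp \<Omega> p v \<phi> (t n) x))"
      using minimizer_pos
    proof eventually_elim
      case (elim x)
      have "(\<lambda>n. Rp \<Omega> p v \<phi> (t n) x) \<longlonglongrightarrow> Rp \<Omega> p v \<phi> 1 x"
        unfolding Rp_eq_remainder_num using elim by (intro tendsto_intros tl) auto
      then have "(\<lambda>n. ennreal (Rp \<Omega> p v \<phi> (t n) x)) \<longlonglongrightarrow> ennreal (Rp \<Omega> p v \<phi> 1 x)" by (rule tendsto_ennrealI)
      then show ?case by (simp add: lim_imp_Liminf)
    qed
  qed
  also have "\<dots> \<le> liminf (\<lambda>n. \<integral>\<^sup>+x. ennreal (Rp \<Omega> p v \<phi> (t n) x) \<partial>M)"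
    by (rule nn_integral_liminf) measurable
  also have "\<dots> \<le> liminf (\<lambda>n. ennreal (deficit v / (C * t n)))"
  proof (intro Liminf_mono always_eventually allI)
    fix n
    have "(\<integral>\<^sup>+x. ennreal (Rp \<Omega> p v \<phi> (t n) x) \<partial>M) = ennreal (\<integral>x. Rp \<Omega> p v \<phi> (t n) x \<partial>M)"
      using Rp_nonneg[of "t n"] t[of n]
      by (intro nn_integral_eq_integral remainder_le_deficit(1) t AE_I2) auto
    also have "\<dots> \<le> ennreal (deficit v / (C * t n))"
      using remainder_le_deficit(2)[OF t[of n]] C t[of n]
      by (intro ennreal_leI) (simp add: pos_le_divide_eq mult.commute)
    finally show "(\<integral>\<^sup>+x. ennreal (Rp \<Omega> p v \<phi> (t n) x) \<partial>M) \<le> ennreal (deficit v / (C * t n))" .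
  qed
  also have "\<dots> = ennreal (deficit v / C)"
  proof (rule lim_imp_Liminf)
    have "(\<lambda>n. deficit v / (C * t n)) \<longlonglongrightarrow> deficit v / (C * 1)"
      using C by (intro tendsto_intros tl) auto
    then show "(\<lambda>n. ennreal (deficit v / (C * t n))) \<longlonglongrightarrow> ennreal (deficit v / C)"
      by (intro tendsto_ennrealI) simp
  qed simp
  finally show ?thesis .
qed

lemma integrable_remainder_endpoint: "integrable M (Rp \<Omega> p v \<phi> 1)"
proof (rule integrableI_bounded)
  have "(\<integral>\<^sup>+x. ennreal (norm (Rp \<Omega> p v \<phi> 1 x)) \<partial>M) = (\<integral>\<^sup>+x. ennreal (Rp \<Omega> p v \<phi> 1 x) \<partial>M)"
    using Rp_nonneg[of 1] by simp
  also have "\<dots> < \<infinity>" using remainder_endpoint_le_deficit by (rule le_less_trans) simp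
  finally show "(\<integral>\<^sup>+x. ennreal (norm (Rp \<Omega> p v \<phi> 1 x)) \<partial>M) < \<infinity>" .
qed measurable

text \<open>Since \<open>t R(t) \<le> R(1)\<close> pointwise, the functions \<open>t (1 - t) R(t)\<close> have a common integrable
  majorant, so that their integrals depend continuously on \<open>t\<close> up to the endpoints.\<close>

lemma remainder_attains_max:
  defines "F \<equiv> \<lambda>t. ereal (t * (1 - t)) * pos_integral \<Omega> (Rp \<Omega> p v \<phi> t)"
  shows "\<exists>s. is_arg_max F (\<lambda>t. t \<in> {0..1}) s \<and> ereal C * F s \<le> ereal (deficit v)"
proof -
  define h where "h t = (\<integral>x. t * (1 - t) * Rp \<Omega> p v \<phi> t x \<partial>M)" for t
  have C: "C > 0" using p_gt_1 by (rule convexity_const_pos)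
  have dom: "AE x in M. norm (t * (1 - t) * Rp \<Omega> p v \<phi> t x) \<le> Rp \<Omega> p v \<phi> 1 x" if t: "t \<in> {0..1}" for t
    using minimizer_pos
  proof eventually_elim
    case (elim x)
    show ?case
    proof (cases "t = 0")
      case True then show ?thesis using Rp_nonneg[of 1 x] by simp
    next
      case False
      define K where "K = remainder_num p (\<phi> x *\<^sub>R weak_grad \<Omega> v x) (v x *\<^sub>R d\<phi> x)"
      have K: "K \<ge> 0" by (simp add: K_def remainder_num_nonneg)
      have "t * (1 - t) * Rp \<Omega> p v \<phi> t x = (t * (1 - t) * K) / ((1 - t) * v x powr p + t * \<phi> x powr p)"
        by (simp add: Rp_eq_remainder_num K_def)
      also have "\<dots> \<le> (t * (1 - t) * K) / (t * \<phi> x powr p)"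
        using t False elim K by (intro divide_left_mono mult_pos_pos add_nonneg_pos) auto
      also have "\<dots> = (1 - t) * (K / \<phi> x powr p)" using False by simp
      also have "\<dots> \<le> K / \<phi> x powr p" using t K by (intro mult_left_le_one_le) auto
      also have "\<dots> = Rp \<Omega> p v \<phi> 1 x" by (simp add: Rp_eq_remainder_num K_def)
      finally show ?thesis using Rp_nonneg[of t x] t by (simp add: abs_mult)
    qed
  qed
  have lim: "AE x in M. (\<lambda>n. \<tau> n * (1 - \<tau> n) * Rp \<Omega> p v \<phi> (\<tau> n) x) \<longlonglongrightarrow> t * (1 - t) * Rp \<Omega> p v \<phi> t x"
    if \<tau>: "\<tau> \<longlonglongrightarrow> t" and t: "t \<in> {0..1}" for \<tau> t
    using minimizer_pos sobolev0_gradient_zero[OF v]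
  proof eventually_elim
    case (elim x)
    \<comment> \<open>At t = 0 the denominator is v^p and may vanish; there the gradient of v is 0
      as well, so \<open>Rp\<close> is 0 for every parameter and the limit is trivial.\<close>
    show ?case
    proof (cases "v x = 0")
      case True
      then show ?thesis using elim by (simp add: Rp_eq_remainder_num)
    next
      case False
      then have "v x > 0" using v_nonneg[of x] by simp
      then have "(1 - t) * v x powr p + t * \<phi> x powr p > 0"
        using t elim by (cases "t = 0") (auto intro!: add_nonneg_pos)
      then show ?thesis unfolding Rp_eq_remainder_num by (intro tendsto_intros \<tau>) auto
    qed
  qed
  have "continuous_on {0..1} h"
    unfolding continuous_on_sequentially
  proof (intro allI ballI impI)
    fix \<tau> t assume a: "t \<in> {0..1::real}" and b: "(\<forall>n::nat. \<tau> n \<in> {0..1}) \<and> \<tau> \<longlonglongrightarrow> t"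
    have "(\<lambda>n. \<integral>x. \<tau> n * (1 - \<tau> n) * Rp \<Omega> p v \<phi> (\<tau> n) x \<partial>M) \<longlonglongrightarrow> (\<integral>x. t * (1 - t) * Rp \<Omega> p v \<phi> t x \<partial>M)"
      using a b by (intro integral_dominated_convergence[OF _ _ integrable_remainder_endpoint] lim dom) auto
    then show "(h \<circ> \<tau>) \<longlonglongrightarrow> h t" by (simp add: h_def o_def)
  qed
  then obtain s where s: "s \<in> {0..1}" "\<And>t. t \<in> {0..1} \<Longrightarrow> h t \<le> h s"
    using continuous_attains_sup[of "{0..1::real}" h] by auto
  \<comment> \<open>At t = 0 the integral of the remainder may be infinite, but its factor 0 makes
    the product 0 in \<open>ereal\<close>.\<close>
  have Fh: "F t = ereal (h t)" if t: "t \<in> {0..1}" for t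
  proof (cases "t = 0 \<or> t = 1")
    case True then show ?thesis by (auto simp: F_def h_def zero_ereal_def[symmetric])
  next
    case False
    then have t: "0 < t" "t < 1" using t by auto
    have "(\<integral>\<^sup>+x. ennreal (Rp \<Omega> p v \<phi> t x) \<partial>M) = ennreal (\<integral>x. Rp \<Omega> p v \<phi> t x \<partial>M)"
      using Rp_nonneg[of t] t
      by (intro nn_integral_eq_integral remainder_le_deficit(1) t AE_I2) auto
    moreover have "(\<integral>x. Rp \<Omega> p v \<phi> t x \<partial>M) \<ge> 0"
      using Rp_nonneg t by (intro integral_nonneg_AE AE_I2) auto
    ultimately show ?thesis by (simp add: F_def h_def pos_integral_def enn2ereal_ennreal)
  qed
  have "C * h s \<le> deficit v"
  proof (cases "s = 0 \<or> s = 1")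
    case True then show ?thesis using deficit_nonneg by (auto simp: h_def)
  next
    case False
    then have t: "0 < s" "s < 1" using s by auto
    have "C * h s = (1 - s) * (C * s * (\<integral>x. Rp \<Omega> p v \<phi> s x \<partial>M))" by (simp add: h_def)
    also have "\<dots> \<le> (1 - s) * deficit v" using remainder_le_deficit(2)[OF t] t by (intro mult_left_mono) auto
    also have "\<dots> \<le> deficit v" using deficit_nonneg t by (intro mult_left_le_one_le) auto
    finally show ?thesis .
  qed
  moreover have "is_arg_max F (\<lambda>t. t \<in> {0..1}) s"
    unfolding is_arg_max_def using s Fh by (auto simp: not_less)
  ultimately show ?thesis using Fh[OF s(1)] by auto
qed

end

end

section \<open>Superlevel sets of Sobolev functions\<close>

lemma nn_integral_translation:
  fixes f :: "'a::euclidean_space \<Rightarrow> ennreal"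
  assumes [measurable]: "f \<in> borel_measurable borel"
  shows "(\<integral>\<^sup>+x. f (x + h) \<partial>lborel) = (\<integral>\<^sup>+x. f x \<partial>lborel)"
proof -
  have "(\<integral>\<^sup>+x. f x \<partial>lborel) = (\<integral>\<^sup>+x. f x \<partial>distr lborel borel ((+) h))"
    by (simp add: lborel_distr_plus)
  also have "\<dots> = (\<integral>\<^sup>+x. f (h + x) \<partial>lborel)"
    by (subst nn_integral_distr) auto
  finally show ?thesis by (simp add: add.commute)
qed

lemma test_function_increment_le:
  assumes \<psi>: "test_function \<Omega> \<psi>"
  shows "ennreal \<bar>\<psi> (x + h) - \<psi> x\<bar>
    \<le> ennreal (norm h) * (\<integral>\<^sup>+s. indicator {0..1} s * ennreal (norm (grad \<psi> (x + s *\<^sub>R h))) \<partial>lborel)"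
proof -
  note [measurable] = borel_measurable_test_function[OF \<psi>]
  define k where "k s = grad \<psi> (x + s *\<^sub>R h) \<bullet> h" for s
  define m where "m s = norm (grad \<psi> (x + s *\<^sub>R h))" for s
  have cg: "continuous_on UNIV (grad \<psi>)" by (rule continuous_grad[OF test_function_Ck[OF \<psi>]])
  have cm: "continuous_on {0..1} m"
    unfolding m_def by (intro continuous_intros continuous_on_compose2[OF cg]) auto
  have mi: "m integrable_on {0..1}" using cm by (rule integrable_continuous_real)
  have "((\<lambda>s. \<psi> (x + s *\<^sub>R h)) has_vector_derivative k s) (at s within {0..1})" for s
  proof -
    have "((\<lambda>s. \<psi> (x + s *\<^sub>R h)) has_derivative (\<lambda>r. grad \<psi> (x + s *\<^sub>R h) \<bullet> (r *\<^sub>R h))) (at s within {0..1})"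
      by (rule has_derivative_compose[of "\<lambda>s. x + s *\<^sub>R h" "\<lambda>s. s *\<^sub>R h" s "{0..1}" \<psi>])
        (auto intro!: derivative_eq_intros test_function_has_derivative[OF \<psi>])
    then show ?thesis by (simp add: has_vector_derivative_def k_def)
  qed
  then have "(k has_integral (\<psi> (x + 1 *\<^sub>R h) - \<psi> (x + 0 *\<^sub>R h))) {0..1}"
    by (intro fundamental_theorem_of_calculus) auto
  then have kI: "k integrable_on {0..1}" "integral {0..1} k = \<psi> (x + h) - \<psi> x"
    by (auto simp: has_integral_iff)
  have "norm (integral {0..1} k) \<le> integral {0..1} (\<lambda>s. norm h * m s)"
  proof (rule integral_norm_bound_integral[OF kI(1)])
    show "(\<lambda>s. norm h * m s) integrable_on {0..1}" using mi by (rule integrable_on_mult_right)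
    show "norm (k s) \<le> norm h * m s" for s
      using Cauchy_Schwarz_ineq2[of "grad \<psi> (x + s *\<^sub>R h)" h] by (simp add: k_def m_def mult.commute)
  qed
  then have le: "\<bar>\<psi> (x + h) - \<psi> x\<bar> \<le> norm h * integral {0..1} m"
    by (simp add: kI(2))
  have "(\<integral>\<^sup>+s. ennreal (indicator {0..1} s * m s) \<partial>lborel) = ennreal (integral {0..1} m)"
  proof (rule nn_integral_has_integral_lborel)
    show "(\<lambda>s. indicator {0..1} s * m s) \<in> borel_measurable borel" unfolding m_def by measurable
    have "((\<lambda>s. if s \<in> {0..1} then m s else 0) has_integral integral {0..1} m) UNIV"
      using integrable_integral[OF mi] by (simp only: has_integral_restrict_UNIV)
    also have "(\<lambda>s. if s \<in> {0..1} then m s else 0) = (\<lambda>s. indicator {0..1} s * m s)"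
      by (auto simp: fun_eq_iff indicator_def)
    finally show "((\<lambda>s. indicator {0..1} s * m s) has_integral integral {0..1} m) UNIV" .
  qed (simp add: m_def)
  also have "(\<lambda>s. ennreal (indicator {0..1} s * m s)) = (\<lambda>s. indicator {0..1} s * ennreal (norm (grad \<psi> (x + s *\<^sub>R h))))"
    by (auto simp: fun_eq_iff indicator_def m_def)
  finally have eq: "(\<integral>\<^sup>+s. indicator {0..1} s * ennreal (norm (grad \<psi> (x + s *\<^sub>R h))) \<partial>lborel) = ennreal (integral {0..1} m)" .
  have "integral {0..1} m \<ge> 0" using mi by (intro integral_nonneg) (auto simp: m_def)
  then show ?thesis unfolding eq using le by (simp flip: ennreal_mult add: ennreal_leI)
qed

text \<open>The increment is at most the length of h times the integral of the norm of the gradient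
  along the segment; after integrating in x and exchanging the order, all slices contribute equally
  by translation invariance.\<close>

lemma test_function_translation_L1:
  fixes \<psi> :: "'a::euclidean_space \<Rightarrow> real"
  assumes \<psi>: "test_function \<Omega> \<psi>"
  shows "(\<integral>\<^sup>+x. ennreal \<bar>\<psi> (x + h) - \<psi> x\<bar> \<partial>lborel) \<le> ennreal (norm h) * (\<integral>\<^sup>+x. ennreal (norm (grad \<psi> x)) \<partial>lborel)"
proof -
  note [measurable] = borel_measurable_test_function[OF \<psi>]
  have "(\<integral>\<^sup>+x. ennreal \<bar>\<psi> (x + h) - \<psi> x\<bar> \<partial>lborel) \<le>
     (\<integral>\<^sup>+x. ennreal (norm h) * (\<integral>\<^sup>+s. indicator {0..1::real} s * ennreal (norm (grad \<psi> (x + s *\<^sub>R h))) \<partial>lborel) \<partial>lborel)"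
    by (intro nn_integral_mono test_function_increment_le[OF \<psi>])
  also have "\<dots> = ennreal (norm h) * (\<integral>\<^sup>+x. \<integral>\<^sup>+s. indicator {0..1::real} s * ennreal (norm (grad \<psi> (x + s *\<^sub>R h))) \<partial>lborel \<partial>lborel)"
    by (rule nn_integral_cmult) measurable
  also have "(\<integral>\<^sup>+x. \<integral>\<^sup>+s. indicator {0..1::real} s * ennreal (norm (grad \<psi> (x + s *\<^sub>R h))) \<partial>lborel \<partial>lborel)
      = (\<integral>\<^sup>+s. \<integral>\<^sup>+x. indicator {0..1::real} s * ennreal (norm (grad \<psi> (x + s *\<^sub>R h))) \<partial>lborel \<partial>lborel)"
    by (rule lborel_pair.Fubini'[symmetric]) measurable
  also have "\<dots> = (\<integral>\<^sup>+s. indicator {0..1::real} s * (\<integral>\<^sup>+x. ennreal (norm (grad \<psi> x)) \<partial>lborel) \<partial>lborel)"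
  proof (rule nn_integral_cong)
    fix s :: real
    have "(\<integral>\<^sup>+x. indicator {0..1::real} s * ennreal (norm (grad \<psi> (x + s *\<^sub>R h))) \<partial>lborel)
        = indicator {0..1::real} s * (\<integral>\<^sup>+x. ennreal (norm (grad \<psi> (x + s *\<^sub>R h))) \<partial>lborel)"
      by (rule nn_integral_cmult) measurable
    also have "(\<integral>\<^sup>+x. ennreal (norm (grad \<psi> (x + s *\<^sub>R h))) \<partial>lborel) = (\<integral>\<^sup>+x. ennreal (norm (grad \<psi> x)) \<partial>lborel)"
      by (rule nn_integral_translation) measurable
    finally show "(\<integral>\<^sup>+x. indicator {0..1::real} s * ennreal (norm (grad \<psi> (x + s *\<^sub>R h))) \<partial>lborel)
        = indicator {0..1::real} s * (\<integral>\<^sup>+x. ennreal (norm (grad \<psi> x)) \<partial>lborel)" .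
  qed
  also have "\<dots> = (\<integral>\<^sup>+x. ennreal (norm (grad \<psi> x)) \<partial>lborel)"
    by (simp add: nn_integral_multc)
  finally show ?thesis .
qed

text \<open>If the support of \<open>f\<close> fills at most half of a ball of radius \<open>r\<close>, then for a typical shift
  \<open>h\<close> of length at most \<open>r\<close> at most half of a superlevel set is shifted back into the support.\<close>

lemma superlevel_measure_le:
  fixes f :: "'a::euclidean_space \<Rightarrow> real"
  assumes [measurable]: "f \<in> borel_measurable borel"
    and tr: "\<And>h. h \<in> ball 0 r \<Longrightarrow> (\<integral>\<^sup>+x. ennreal \<bar>f (x + h) - f x\<bar> \<partial>lborel) \<le> ennreal (r * G)"
    and r: "r > 0" and \<delta>: "\<delta> > 0" and G: "G \<ge> 0"
    and T: "emeasure lborel {x. f x > 0} \<le> ennreal A" and A: "2 * A \<le> measure lborel (ball (0::'a) r)" "A \<ge> 0"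
  shows "emeasure lborel {x. f x > \<delta>} \<le> ennreal (2 * r * G / \<delta>)"
proof -
  define B where "B = ball (0::'a) r"
  define b where "b = measure lborel B"
  have b: "b > 0" using r by (simp add: b_def B_def content_ball_pos)
  have [measurable]: "B \<in> sets borel" by (simp add: B_def)
  have eB: "emeasure lborel B = ennreal b"
    unfolding b_def B_def using emeasure_lborel_ball_finite by (intro emeasure_eq_ennreal_measure) (simp add: less_top)
  define S where "S = {x. f x > \<delta>}"
  define U where "U = {x. f x > 0}"
  have [measurable]: "S \<in> sets borel" "U \<in> sets borel" unfolding S_def U_def by measurable
  have SU: "S \<subseteq> U" using \<delta> by (auto simp: S_def U_def)
  have "emeasure lborel S \<le> emeasure lborel U" using SU by (intro emeasure_mono) auto
  also have "\<dots> \<le> ennreal A" using T by (simp add: U_def)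
  finally have "emeasure lborel S < \<infinity>" by (rule le_less_trans) simp
  then obtain s where s: "emeasure lborel S = ennreal s" "s \<ge> 0"
    by (cases "emeasure lborel S" rule: ennreal_cases) auto
  \<comment> \<open>If x lies in S and x + h outside U, then f drops by more than \<delta> between
    the two points, so the increment pays for \<delta>.\<close>
  have ptw: "ennreal \<delta> * indicator S x \<le> ennreal \<delta> * (indicator S x * indicator U (x + h)) + ennreal \<bar>f (x + h) - f x\<bar>" for x h
  proof (cases "x \<in> S \<and> x + h \<notin> U")
    case True
    then have "\<delta> \<le> \<bar>f (x + h) - f x\<bar>" by (auto simp: S_def U_def)
    then show ?thesis using True by (simp add: ennreal_leI)
  qed (auto simp: indicator_def)
  \<comment> \<open>Integrates \<open>ptw\<close> over x and then over all shifts h in the ball B;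
    after exchanging the order, the shifts leading from a fixed x into U have measure at most
    A.\<close>
  have "ennreal (b * (\<delta> * s)) = (\<integral>\<^sup>+h. indicator B h * (\<integral>\<^sup>+x. ennreal \<delta> * indicator S x \<partial>lborel) \<partial>lborel)"
    using b \<delta> s by (simp add: nn_integral_cmult nn_integral_multc eB ennreal_mult)
  also have "\<dots> \<le> (\<integral>\<^sup>+h. indicator B h * (ennreal \<delta> * (\<integral>\<^sup>+x. indicator S x * indicator U (x + h) \<partial>lborel) + ennreal (r * G)) \<partial>lborel)"
  proof (rule nn_integral_mono)
    fix h :: 'a
    show "indicator B h * (\<integral>\<^sup>+x. ennreal \<delta> * indicator S x \<partial>lborel)
      \<le> indicator B h * (ennreal \<delta> * (\<integral>\<^sup>+x. indicator S x * indicator U (x + h) \<partial>lborel) + ennreal (r * G))"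
    proof (cases "h \<in> B")
      case True
      have "(\<integral>\<^sup>+x. ennreal \<delta> * indicator S x \<partial>lborel) \<le>
          (\<integral>\<^sup>+x. ennreal \<delta> * (indicator S x * indicator U (x + h)) + ennreal \<bar>f (x + h) - f x\<bar> \<partial>lborel)"
        by (intro nn_integral_mono ptw)
      also have "\<dots> = ennreal \<delta> * (\<integral>\<^sup>+x. indicator S x * indicator U (x + h) \<partial>lborel) + (\<integral>\<^sup>+x. ennreal \<bar>f (x + h) - f x\<bar> \<partial>lborel)"
        by (subst nn_integral_add) (auto simp: nn_integral_cmult)
      also have "\<dots> \<le> ennreal \<delta> * (\<integral>\<^sup>+x. indicator S x * indicator U (x + h) \<partial>lborel) + ennreal (r * G)"
        using True by (intro add_left_mono tr) (simp add: B_def)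
      finally show ?thesis using True by simp
    qed simp
  qed
  also have "\<dots> = ennreal \<delta> * (\<integral>\<^sup>+h. \<integral>\<^sup>+x. indicator B h * (indicator S x * indicator U (x + h)) \<partial>lborel \<partial>lborel) + ennreal (b * (r * G))"
  proof -
    have "(\<integral>\<^sup>+h. indicator B h * (ennreal \<delta> * (\<integral>\<^sup>+x. indicator S x * indicator U (x + h) \<partial>lborel) + ennreal (r * G)) \<partial>lborel)
       = (\<integral>\<^sup>+h. ennreal \<delta> * (\<integral>\<^sup>+x. indicator B h * (indicator S x * indicator U (x + h)) \<partial>lborel) + indicator B h * ennreal (r * G) \<partial>lborel)"
      by (intro nn_integral_cong) (auto simp: indicator_def)
    also have "\<dots> = (\<integral>\<^sup>+h. ennreal \<delta> * (\<integral>\<^sup>+x. indicator B h * (indicator S x * indicator U (x + h)) \<partial>lborel) \<partial>lborel)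
       + (\<integral>\<^sup>+h. indicator B h * ennreal (r * G) \<partial>lborel)"
      by (rule nn_integral_add) measurable
    also have "(\<integral>\<^sup>+h. indicator B h * ennreal (r * G) \<partial>lborel) = ennreal (b * (r * G))"
      using b r G by (simp add: nn_integral_multc eB ennreal_mult)
    also have "(\<integral>\<^sup>+h. ennreal \<delta> * (\<integral>\<^sup>+x. indicator B h * (indicator S x * indicator U (x + h)) \<partial>lborel) \<partial>lborel)
       = ennreal \<delta> * (\<integral>\<^sup>+h. \<integral>\<^sup>+x. indicator B h * (indicator S x * indicator U (x + h)) \<partial>lborel \<partial>lborel)"
      by (rule nn_integral_cmult) measurable
    finally show ?thesis .
  qed
  also have "(\<integral>\<^sup>+h. \<integral>\<^sup>+x. indicator B h * (indicator S x * indicator U (x + h)) \<partial>lborel \<partial>lborel)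
      = (\<integral>\<^sup>+x. \<integral>\<^sup>+h. indicator B h * (indicator S x * indicator U (x + h)) \<partial>lborel \<partial>lborel)"
    by (rule lborel_pair.Fubini') measurable
  also have "\<dots> \<le> (\<integral>\<^sup>+x. indicator S x * ennreal A \<partial>lborel)"
  proof (rule nn_integral_mono)
    fix x :: 'a
    have "(\<integral>\<^sup>+h. indicator B h * (indicator S x * indicator U (x + h)) \<partial>lborel)
        \<le> (\<integral>\<^sup>+h. indicator S x * indicator U (h + x) \<partial>lborel)"
      by (intro nn_integral_mono) (auto simp: indicator_def add.commute)
    also have "\<dots> = indicator S x * (\<integral>\<^sup>+h. indicator U (h + x) \<partial>lborel)"
      by (rule nn_integral_cmult) measurable
    also have "(\<integral>\<^sup>+h. indicator U (h + x) \<partial>lborel) = (\<integral>\<^sup>+h. indicator U h \<partial>lborel)"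
      by (rule nn_integral_translation) measurable
    also have "\<dots> \<le> ennreal A" using T by (simp add: U_def)
    finally show "(\<integral>\<^sup>+h. indicator B h * (indicator S x * indicator U (x + h)) \<partial>lborel) \<le> indicator S x * ennreal A"
      by (simp add: mult_left_mono)
  qed
  also have "(\<integral>\<^sup>+x. indicator S x * ennreal A \<partial>lborel) = ennreal (s * A)"
    using s A by (simp add: nn_integral_multc ennreal_mult)
  finally have "ennreal (b * (\<delta> * s)) \<le> ennreal (\<delta> * (s * A) + b * (r * G))"
    using \<delta> s A b r G by (simp add: add_left_mono mult_left_mono ennreal_mult[symmetric] ennreal_plus[symmetric] del: ennreal_plus)
  then have "b * (\<delta> * s) \<le> \<delta> * (s * A) + b * (r * G)"
    using \<delta> s A b r G by (subst (asm) ennreal_le_iff) auto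
  \<comment> \<open>Since 2 A \<le> b, half of the left-hand side absorbs this term.\<close>
  also have "\<dots> \<le> \<delta> * (s * (b / 2)) + b * (r * G)"
    using \<delta> s A by (intro add_right_mono mult_left_mono) (auto simp: b_def B_def)
  finally have "b * (\<delta> * s) \<le> b * (2 * r * G)" by (simp add: algebra_simps)
  then have "\<delta> * s \<le> 2 * r * G" using b by simp
  then have "s \<le> 2 * r * G / \<delta>" using \<delta> by (simp add: pos_le_divide_eq mult.commute)
  then show ?thesis using s by (simp add: S_def[symmetric] ennreal_leI)
qed

section \<open>Superlevel sets inside the domain\<close>

context finite_domain
begin

lemma nn_integral_domain_eq_lborel:
  assumes "f \<in> borel_measurable borel" "\<And>x. x \<notin> \<Omega> \<Longrightarrow> f x = 0"
  shows "(\<integral>\<^sup>+x. f x \<partial>M) = (\<integral>\<^sup>+x. f x \<partial>lborel)"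
proof -
  have "(\<integral>\<^sup>+x. f x \<partial>M) = (\<integral>\<^sup>+x. f x * indicator \<Omega> x \<partial>lebesgue)"
    by (subst nn_integral_restrict_space) auto
  also have "(\<lambda>x. f x * indicator \<Omega> x) = f"
  proof
    show "f x * indicator \<Omega> x = f x" for x using assms(2)[of x] by (cases "x \<in> \<Omega>") auto
  qed
  finally show ?thesis by (simp add: nn_integral_completion)
qed

text \<open>f' is the extension of f by zero, in a Borel version so that it can be translated. No
  boundary term appears because f is approximated by functions supported in \<Omega>, for which the
  estimate holds on the whole space.\<close>

lemma sobolev0_translation_L1:
  assumes s: "sobolev0 f g" and f': "f' \<in> borel_measurable borel" "\<And>x. x \<notin> \<Omega> \<Longrightarrow> f' x = 0" "AE x in M. f' x = f x"
  shows "(\<integral>\<^sup>+x. ennreal \<bar>f' (x + h) - f' x\<bar> \<partial>lborel) \<le> ennreal (norm h * (\<integral>x. norm (g x) \<partial>M))"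
proof -
  note [measurable] = sobolev0_measurable[OF s] f'(1)
  obtain \<psi> where \<psi>: "\<forall>n. test_function \<Omega> (\<psi> n)" "(\<lambda>n. pint M p (\<lambda>x. \<psi> n x - f x)) \<longlonglongrightarrow> 0"
    "(\<lambda>n. pint M p (\<lambda>x. grad (\<psi> n) x - g x)) \<longlonglongrightarrow> 0"
    using sobolev0_sequence[OF s] by blast
  note t = \<psi>(1)[rule_format]
  note [measurable] = borel_measurable_test[OF t] borel_measurable_test_function[OF t]
  define a where "a n = (\<integral>\<^sup>+x. ennreal (norm (\<psi> n x - f x)) \<partial>M)" for n
  define c where "c n = (\<integral>\<^sup>+x. ennreal (norm (grad (\<psi> n) x - g x)) \<partial>M)" for n
  have al: "a \<longlonglongrightarrow> 0" unfolding a_def[abs_def] by (rule pint_tendsto_0_imp_L1[OF _ \<psi>(2) p_gt_1]) measurable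
  have cl: "c \<longlonglongrightarrow> 0" unfolding c_def[abs_def] by (rule pint_tendsto_0_imp_L1[OF _ \<psi>(3) p_gt_1]) measurable
  have z: "\<psi> n x = 0" "grad (\<psi> n) x = 0" if "x \<notin> \<Omega>" for n x
  proof -
    obtain K where "K \<subseteq> \<Omega>" "\<And>x. x \<notin> K \<Longrightarrow> \<psi> n x = 0" "\<And>x. x \<notin> K \<Longrightarrow> grad (\<psi> n) x = 0"
      using test_function_support[OF t[of n]] by metis
    moreover from this that have "x \<notin> K" by blast
    ultimately show "\<psi> n x = 0" "grad (\<psi> n) x = 0" by simp_all
  qed
  have a': "(\<integral>\<^sup>+x. ennreal \<bar>\<psi> n x - f' x\<bar> \<partial>lborel) = a n" for n
  proof -
    have "(\<integral>\<^sup>+x. ennreal \<bar>\<psi> n x - f' x\<bar> \<partial>lborel) = (\<integral>\<^sup>+x. ennreal \<bar>\<psi> n x - f' x\<bar> \<partial>M)"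
      by (rule nn_integral_domain_eq_lborel[symmetric]) (auto simp: z f'(2))
    also have "\<dots> = a n" unfolding a_def using f'(3) by (intro nn_integral_cong_AE) (auto elim!: eventually_mono)
    finally show ?thesis .
  qed
  have gi: "(\<integral>\<^sup>+x. ennreal (norm (g x)) \<partial>M) = ennreal (\<integral>x. norm (g x) \<partial>M)"
    using sobolev0_integrable(2)[OF s] by (intro nn_integral_eq_integral) auto
  have le: "(\<integral>\<^sup>+x. ennreal \<bar>f' (x + h) - f' x\<bar> \<partial>lborel)
      \<le> a n + (ennreal (norm h) * (ennreal (\<integral>x. norm (g x) \<partial>M) + c n) + a n)" for n
  proof -
    have "(\<integral>\<^sup>+x. ennreal \<bar>f' (x + h) - f' x\<bar> \<partial>lborel) \<le>
       (\<integral>\<^sup>+x. ennreal \<bar>\<psi> n (x + h) - f' (x + h)\<bar> + (ennreal \<bar>\<psi> n (x + h) - \<psi> n x\<bar> + ennreal \<bar>\<psi> n x - f' x\<bar>) \<partial>lborel)"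
    proof (rule nn_integral_mono)
      fix x
      have "\<bar>f' (x + h) - f' x\<bar> \<le> \<bar>\<psi> n (x + h) - f' (x + h)\<bar> + (\<bar>\<psi> n (x + h) - \<psi> n x\<bar> + \<bar>\<psi> n x - f' x\<bar>)" by linarith
      then show "ennreal \<bar>f' (x + h) - f' x\<bar>
          \<le> ennreal \<bar>\<psi> n (x + h) - f' (x + h)\<bar> + (ennreal \<bar>\<psi> n (x + h) - \<psi> n x\<bar> + ennreal \<bar>\<psi> n x - f' x\<bar>)"
        by (simp flip: ennreal_plus add: ennreal_leI)
    qed
    also have "\<dots> = (\<integral>\<^sup>+x. ennreal \<bar>\<psi> n (x + h) - f' (x + h)\<bar> \<partial>lborel)
      + ((\<integral>\<^sup>+x. ennreal \<bar>\<psi> n (x + h) - \<psi> n x\<bar> \<partial>lborel) + (\<integral>\<^sup>+x. ennreal \<bar>\<psi> n x - f' x\<bar> \<partial>lborel))"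
      by (subst nn_integral_add; (subst nn_integral_add)?; measurable)
    also have "(\<integral>\<^sup>+x. ennreal \<bar>\<psi> n (x + h) - f' (x + h)\<bar> \<partial>lborel) = (\<integral>\<^sup>+x. ennreal \<bar>\<psi> n x - f' x\<bar> \<partial>lborel)"
      by (rule nn_integral_translation[of "\<lambda>x. ennreal \<bar>\<psi> n x - f' x\<bar>"]) measurable
    also have "(\<integral>\<^sup>+x. ennreal \<bar>\<psi> n x - f' x\<bar> \<partial>lborel) = a n" by (rule a')
    also have "(\<integral>\<^sup>+x. ennreal \<bar>\<psi> n (x + h) - \<psi> n x\<bar> \<partial>lborel) \<le> ennreal (norm h) * (\<integral>\<^sup>+x. ennreal (norm (grad (\<psi> n) x)) \<partial>lborel)"
      by (rule test_function_translation_L1[OF t])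
    also have "(\<integral>\<^sup>+x. ennreal (norm (grad (\<psi> n) x)) \<partial>lborel) = (\<integral>\<^sup>+x. ennreal (norm (grad (\<psi> n) x)) \<partial>M)"
      by (rule nn_integral_domain_eq_lborel[symmetric]) (auto simp: z)
    also have "\<dots> \<le> (\<integral>\<^sup>+x. ennreal (norm (g x)) + ennreal (norm (grad (\<psi> n) x - g x)) \<partial>M)"
    proof (rule nn_integral_mono)
      fix x
      have "norm (grad (\<psi> n) x) \<le> norm (g x) + norm (grad (\<psi> n) x - g x)"
        using norm_triangle_ineq[of "g x" "grad (\<psi> n) x - g x"] by simp
      then show "ennreal (norm (grad (\<psi> n) x)) \<le> ennreal (norm (g x)) + ennreal (norm (grad (\<psi> n) x - g x))"
        by (simp flip: ennreal_plus add: ennreal_leI)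
    qed
    also have "\<dots> = ennreal (\<integral>x. norm (g x) \<partial>M) + c n"
      unfolding gi[symmetric] c_def by (rule nn_integral_add) measurable
    finally show ?thesis by (simp add: add_left_mono add_right_mono mult_left_mono)
  qed
  have "(\<lambda>n. a n + (ennreal (norm h) * (ennreal (\<integral>x. norm (g x) \<partial>M) + c n) + a n))
      \<longlonglongrightarrow> 0 + (ennreal (norm h) * (ennreal (\<integral>x. norm (g x) \<partial>M) + 0) + 0)"
    by (intro tendsto_add al cl ennreal_tendsto_cmult tendsto_const) simp
  from tendsto_lowerbound[OF this always_eventually[OF allI[OF le]]] show ?thesis
    by (simp add: ennreal_mult)
qed

text \<open>Takes the place of a Sobolev inequality in the iteration: r is free as long as a ball of
  radius r has at least twice the measure of the set where f is positive, so a small set permits a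
  small r and hence a gain.\<close>

lemma sobolev0_superlevel:
  assumes s: "sobolev0 f g" and r: "r > 0" and \<delta>: "\<delta> > 0"
    and A: "2 * measure M {x \<in> \<Omega>. f x > 0} \<le> measure lborel (ball (0::'a) r)"
  shows "measure M {x \<in> \<Omega>. f x > \<delta>} \<le> 2 * r * (\<integral>x. norm (g x) \<partial>M) / \<delta>"
proof -
  note [measurable] = sobolev0_measurable[OF s]
  have "(\<lambda>x. indicator \<Omega> x *\<^sub>R f x) \<in> borel_measurable lebesgue"
    using sobolev0_measurable(1)[OF s] by (subst (asm) borel_measurable_restrict_space_iff) auto
  from completion_ex_borel_measurable_real[OF this]
  obtain f0 where f0: "f0 \<in> borel_measurable borel" "AE x in lborel. indicator \<Omega> x *\<^sub>R f x = f0 x" by auto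
  define f' where "f' x = indicator \<Omega> x * f0 x" for x
  have \<Omega>b: "\<Omega> \<in> sets borel" using open_domain by simp
  have f'b [measurable]: "f' \<in> borel_measurable borel" unfolding f'_def using f0(1) \<Omega>b by measurable
  have f'0: "f' x = 0" if "x \<notin> \<Omega>" for x using that by (simp add: f'_def)
  have "AE x in lebesgue. x \<in> \<Omega> \<longrightarrow> f' x = f x"
    using AE_completion[OF f0(2)] by eventually_elim (auto simp: f'_def)
  then have f'f: "AE x in M. f' x = f x" by (subst AE_restrict_space_iff) auto
  define G where "G = (\<integral>x. norm (g x) \<partial>M)"
  have G: "G \<ge> 0" by (simp add: G_def)
  have em: "emeasure lborel {x. f' x > c} = ennreal (measure M {x \<in> \<Omega>. f x > c})" if c: "c \<ge> 0" for c
  proof -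
    have "emeasure lborel {x. f' x > c} = (\<integral>\<^sup>+x. indicator {x. f' x > c} x \<partial>lborel)"
      by (subst nn_integral_indicator) auto
    also have "\<dots> = (\<integral>\<^sup>+x. indicator {x. f' x > c} x \<partial>M)"
      by (rule nn_integral_domain_eq_lborel[symmetric]) (use c f'0 in \<open>auto simp: indicator_def\<close>)
    also have "\<dots> = (\<integral>\<^sup>+x. indicator {x \<in> \<Omega>. f x > c} x \<partial>M)"
    proof (rule nn_integral_cong_AE)
      show "AE x in M. (indicator {x. f' x > c} x :: ennreal) = indicator {x \<in> \<Omega>. f x > c} x"
        using f'f AE_space[of M] by eventually_elim (auto simp: indicator_def)
    qed
    also have "\<dots> = emeasure M {x \<in> \<Omega>. f x > c}"
    proof (rule nn_integral_indicator)
      have "{x \<in> space M. f x > c} \<in> sets M" by measurable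
      then show "{x \<in> \<Omega>. f x > c} \<in> sets M" by simp
    qed
    finally show ?thesis by (simp add: emeasure_eq_measure)
  qed
  have "emeasure lborel {x. f' x > \<delta>} \<le> ennreal (2 * r * G / \<delta>)"
  proof (rule superlevel_measure_le[OF f'b _ r \<delta> G])
    show "(\<integral>\<^sup>+x. ennreal \<bar>f' (x + h) - f' x\<bar> \<partial>lborel) \<le> ennreal (r * G)" if "h \<in> ball 0 r" for h
    proof -
      have "(\<integral>\<^sup>+x. ennreal \<bar>f' (x + h) - f' x\<bar> \<partial>lborel) \<le> ennreal (norm h * G)"
        unfolding G_def by (rule sobolev0_translation_L1[OF s f'b f'0 f'f])
      also have "\<dots> \<le> ennreal (r * G)" using that G by (intro ennreal_leI mult_right_mono) auto
      finally show ?thesis .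
    qed
    show "emeasure lborel {x. f' x > 0} \<le> ennreal (measure M {x \<in> \<Omega>. f x > 0})" by (simp add: em)
  qed (use A in auto)
  then show ?thesis
    using em[of \<delta>] \<delta> r G by (simp add: G_def[symmetric] ennreal_le_iff)
qed

end

section \<open>Local lower bounds for the minimizer\<close>

context minimizer
begin

context
  fixes \<eta> :: "'a \<Rightarrow> real" and L :: real
  assumes \<eta>: "test_function \<Omega> \<eta>" and L: "L > 0" "\<And>x. norm (grad \<eta> x) \<le> L"
begin

text \<open>For k > 0 and \<tau> \<ge> 0 the set lies, up to a null set, where \<eta> > 0, so that
  \<eta> localises the comparison. The iteration raises \<tau> at fixed k, which keeps the slope of
  the obstacle k (\<eta> - \<tau>) bounded by k L.\<close>

definition sublevel_measure :: "real \<Rightarrow> real \<Rightarrow> real" where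
  "sublevel_measure k \<tau> = measure M {x \<in> \<Omega>. \<phi> x < k * (\<eta> x - \<tau>)}"

text \<open>Comparison of \<open>\<phi>\<close> with the larger function \<open>max \<phi> (k (\<eta> - \<tau>))\<close>, whose gradient is bounded by
  \<open>k L\<close> where the two differ, bounds the energy of \<open>\<phi>\<close> there.\<close>

lemma sublevel_energy:
  assumes k: "k > 0" and \<tau>: "\<tau> \<ge> 0"
  obtains g where "sobolev0 (\<lambda>x. max (k * \<eta> x + (-1) * \<phi> x - k * \<tau>) 0) g"
    "(\<integral>x. norm (g x) \<partial>M) \<le> 3 * k * L * sublevel_measure k \<tau>"
proof -
  define s where "s = (\<lambda>x. k * \<eta> x + (-1) * \<phi> x)"
  define D where "D = (\<lambda>x. k *\<^sub>R grad \<eta> x + (-1) *\<^sub>R d\<phi> x)"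
  define g where "g = (\<lambda>x. if s x > k * \<tau> then D x else 0)"
  define S where "S = {x \<in> \<Omega>. s x > k * \<tau>}"
  have kt: "k * \<tau> \<ge> 0" using k \<tau> by simp
  have "sobolev0 s D" unfolding s_def D_def
    by (rule sobolev0_linear[OF sobolev0_test_function[OF \<eta>] sobolev0_minimizer])
  note f = sobolev0_pos_part[OF this kt, folded g_def]
  have w: "sobolev0 (\<lambda>x. 1 * \<phi> x + 1 * max (s x - k * \<tau>) 0) (\<lambda>x. 1 *\<^sub>R d\<phi> x + 1 *\<^sub>R g x)"
    by (rule sobolev0_linear[OF sobolev0_minimizer f])
  note [measurable] = sobolev0_measurable[OF f] sobolev0_measurable[OF sobolev0_minimizer]
    sobolev0_measurable[OF \<open>sobolev0 s D\<close>]
  have [measurable]: "S \<in> sets M"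
  proof -
    have "{x \<in> space M. s x > k * \<tau>} \<in> sets M" by measurable
    then show ?thesis by (simp add: S_def)
  qed
  have mS: "measure M S = sublevel_measure k \<tau>"
    unfolding S_def sublevel_measure_def s_def
    by (rule arg_cong[where f = "measure M"]) (auto simp: algebra_simps)
  have iS: "integrable M (\<lambda>x. c * indicator S x :: real)" for c
    by (intro integrable_mult_right integrable_real_indicator) (auto simp: emeasure_eq_measure)
  have intS: "(\<integral>x. c * indicator S x \<partial>M) = c * measure M S" for c :: real
    using sets.sets_into_space[of S M] by (simp add: Int_absorb2)
  note id\<phi> = sobolev0_integrable_powr(2)[OF sobolev0_minimizer q_pos q(2)]
  have idS: "integrable M (\<lambda>x. indicator S x * norm (d\<phi> x) powr p)"
    by (rule Bochner_Integration.integrable_bound[OF id\<phi>]) (auto simp: indicator_def)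
  \<comment> \<open>Enlarging a positive function increases its L^q norm, so the energy of the
    larger function cannot be below that of \<phi>; outside S the two gradients agree and their
    energies cancel.\<close>
  have "(\<integral>x. norm (d\<phi> x) powr p \<partial>M) = lam * (\<integral>x. \<bar>\<phi> x\<bar> powr q \<partial>M) powr (p / q)"
    by (rule minimizer_energy)
  also have "\<dots> \<le> lam * (\<integral>x. \<bar>1 * \<phi> x + 1 * max (s x - k * \<tau>) 0\<bar> powr q \<partial>M) powr (p / q)"
  proof (intro mult_left_mono powr_mono2 lambda_nonneg integral_mono_AE)
    show "AE x in M. \<bar>\<phi> x\<bar> powr q \<le> \<bar>1 * \<phi> x + 1 * max (s x - k * \<tau>) 0\<bar> powr q"
      using minimizer_pos by eventually_elim (use q in \<open>auto intro!: powr_mono2\<close>)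
  qed (use q sobolev0_integrable_powr(1)[OF w q_pos q(2)] sobolev0_integrable_powr(1)[OF sobolev0_minimizer q_pos q(2)] in auto)
  also have "\<dots> \<le> (\<integral>x. norm (1 *\<^sub>R d\<phi> x + 1 *\<^sub>R g x) powr p \<partial>M)"
    by (rule lambda1_le[OF w q_pos q(2)])
  also have "\<dots> \<le> (\<integral>x. norm (d\<phi> x) powr p - indicator S x * norm (d\<phi> x) powr p + (k * L) powr p * indicator S x \<partial>M)"
  proof (rule integral_mono)
    fix x assume "x \<in> space M"
    then have x: "x \<in> \<Omega>" by simp
    show "norm (1 *\<^sub>R d\<phi> x + 1 *\<^sub>R g x) powr p
        \<le> norm (d\<phi> x) powr p - indicator S x * norm (d\<phi> x) powr p + (k * L) powr p * indicator S x"
    proof (cases "x \<in> S")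
      case True
      then have "1 *\<^sub>R d\<phi> x + 1 *\<^sub>R g x = k *\<^sub>R grad \<eta> x" by (simp add: g_def S_def D_def)
      moreover have "norm (k *\<^sub>R grad \<eta> x) powr p \<le> (k * L) powr p"
        using k L(2)[of x] p_gt_1 by (intro powr_mono2) auto
      ultimately show ?thesis using True by simp
    next
      case False
      then show ?thesis using x by (simp add: g_def S_def)
    qed
  qed (use sobolev0_integrable_powr(2)[OF w q_pos q(2)] id\<phi> idS iS in auto)
  also have "\<dots> = (\<integral>x. norm (d\<phi> x) powr p \<partial>M) - (\<integral>x. indicator S x * norm (d\<phi> x) powr p \<partial>M) + (k * L) powr p * measure M S"
    using id\<phi> idS iS[of "(k * L) powr p"] intS[of "(k * L) powr p"] by simp
  finally have cacc: "(\<integral>x. indicator S x * norm (d\<phi> x) powr p \<partial>M) \<le> (k * L) powr p * measure M S" by simp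
  have kL: "k * L > 0" using k L by simp
  \<comment> \<open>Splitting the norm of \<nabla>\<phi> at the level k L gives k L plus a p-th
    power whose integral over S costs another k L per unit of measure; with the gradient of the
    obstacle this makes 3 k L.\<close>
  have "(\<integral>x. norm (g x) \<partial>M) \<le> (\<integral>x. (2 * (k * L)) * indicator S x + (k * L) powr (1 - p) * (indicator S x * norm (d\<phi> x) powr p) \<partial>M)"
  proof (rule integral_mono)
    fix x assume "x \<in> space M"
    then have x: "x \<in> \<Omega>" by simp
    show "norm (g x) \<le> (2 * (k * L)) * indicator S x + (k * L) powr (1 - p) * (indicator S x * norm (d\<phi> x) powr p)"
    proof (cases "x \<in> S")
      case True
      then have "norm (g x) = norm (k *\<^sub>R grad \<eta> x - d\<phi> x)" by (simp add: g_def S_def D_def)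
      also have "\<dots> \<le> norm (k *\<^sub>R grad \<eta> x) + norm (d\<phi> x)" by (rule norm_triangle_ineq4)
      also have "\<dots> \<le> k * L + (k * L + (k * L) powr (1 - p) * norm (d\<phi> x) powr p)"
        using k L(2)[of x] le_add_powr[OF _ kL p_gt_1, of "norm (d\<phi> x)"] by (intro add_mono) auto
      finally show ?thesis using True by (simp add: mult.commute[of L])
    next
      case False
      then show ?thesis using x by (simp add: g_def S_def)
    qed
  qed (use sobolev0_integrable(2)[OF f] idS iS in auto)
  also have "\<dots> = (2 * (k * L)) * measure M S + (k * L) powr (1 - p) * (\<integral>x. indicator S x * norm (d\<phi> x) powr p \<partial>M)"
    using idS iS[of "2 * (k * L)"] intS[of "2 * (k * L)"] by simp
  also have "\<dots> \<le> (2 * (k * L)) * measure M S + (k * L) powr (1 - p) * ((k * L) powr p * measure M S)"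
    by (intro add_left_mono mult_left_mono cacc) simp
  also have "(k * L) powr (1 - p) * ((k * L) powr p * measure M S) = (k * L) * measure M S"
    using kL powr_add[of "k * L" "1 - p" p] by (simp flip: mult.assoc)
  finally have "(\<integral>x. norm (g x) \<partial>M) \<le> 3 * k * L * sublevel_measure k \<tau>" by (simp add: mS mult_ac)
  with f show ?thesis unfolding s_def by (rule that)
qed

text \<open>The gradient bound and the height k \<delta> of the step are both proportional to k,
  which therefore cancels. The factor 6 is the 2 of the superlevel estimate times the 3 of the
  energy estimate.\<close>

lemma sublevel_decay:
  assumes k: "k > 0" and \<tau>: "\<tau> \<ge> 0" and r: "r > 0" and \<delta>: "\<delta> > 0"
    and A: "2 * sublevel_measure k \<tau> \<le> measure lborel (ball (0::'a) r)"
  shows "sublevel_measure k (\<tau> + \<delta>) \<le> 6 * r * L / \<delta> * sublevel_measure k \<tau>"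
proof -
  define f where "f = (\<lambda>x. max (k * \<eta> x + (-1) * \<phi> x - k * \<tau>) 0)"
  obtain g where g: "sobolev0 f g" "(\<integral>x. norm (g x) \<partial>M) \<le> 3 * k * L * sublevel_measure k \<tau>"
    unfolding f_def by (rule sublevel_energy[OF k \<tau>])
  have e0: "{x \<in> \<Omega>. f x > 0} = {x \<in> \<Omega>. \<phi> x < k * (\<eta> x - \<tau>)}"
    by (auto simp: f_def algebra_simps)
  have e1: "{x \<in> \<Omega>. f x > k * \<delta>} = {x \<in> \<Omega>. \<phi> x < k * (\<eta> x - (\<tau> + \<delta>))}"
    using k \<delta> by (auto simp: f_def algebra_simps less_max_iff_disj mult_less_0_iff)
  have "sublevel_measure k (\<tau> + \<delta>) \<le> 2 * r * (\<integral>x. norm (g x) \<partial>M) / (k * \<delta>)"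
    unfolding sublevel_measure_def e1[symmetric]
    by (rule sobolev0_superlevel[OF g(1) r]) (use k \<delta> A in \<open>auto simp: e0 sublevel_measure_def\<close>)
  also have "\<dots> \<le> 2 * r * (3 * k * L * sublevel_measure k \<tau>) / (k * \<delta>)"
    using g(2) k \<delta> r by (intro divide_right_mono mult_left_mono) auto
  also have "\<dots> = 6 * r * L / \<delta> * sublevel_measure k \<tau>" using k \<delta> by (simp add: field_simps)
  finally show ?thesis .
qed

lemma sublevel_measure_antimono:
  assumes "k > 0" "\<tau> \<le> \<tau>'" shows "sublevel_measure k \<tau>' \<le> sublevel_measure k \<tau>"
  unfolding sublevel_measure_def
proof (rule finite_measure_mono)
  note [measurable] = sobolev0_measurable[OF sobolev0_minimizer] borel_measurable_test[OF \<eta>]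
  have "{x \<in> space M. \<phi> x < k * (\<eta> x - \<tau>)} \<in> sets M" by measurable
  then show "{x \<in> \<Omega>. \<phi> x < k * (\<eta> x - \<tau>)} \<in> sets M" by simp
  have "k * (\<eta> x - \<tau>') \<le> k * (\<eta> x - \<tau>)" for x using assms by (intro mult_left_mono) auto
  then show "{x \<in> \<Omega>. \<phi> x < k * (\<eta> x - \<tau>')} \<subseteq> {x \<in> \<Omega>. \<phi> x < k * (\<eta> x - \<tau>)}"
    by (auto intro: less_le_trans)
qed

text \<open>De Giorgi iteration with levels \<open>\<tau>\<^sub>j = (1 - 2\<^sup>-\<^sup>j) / 2\<close> and radii proportional to \<open>2\<^sup>-\<^sup>j\<close>;
  the smallness threshold does not depend on \<open>k\<close>.\<close>

lemma sublevel_iteration: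
  "\<exists>\<nu>>0. \<forall>k>0. sublevel_measure k 0 \<le> \<nu> \<longrightarrow> sublevel_measure k (1/2) = 0"
proof -
  define b where "b = measure lborel (ball (0::'a) 1)"
  have b: "b > 0" by (simp add: b_def content_ball_pos)
  \<comment> \<open>The volume ratio of balls when the radius is halved; the measures must decay at
    this rate to stay below the volumes of the shrinking balls.\<close>
  define \<mu> where "\<mu> = (1/2 :: real) ^ DIM('a)"
  have \<mu>: "\<mu> > 0" "\<mu> < 1" by (auto simp: \<mu>_def power_Suc_less_one power_less_one_iff)
  \<comment> \<open>Half the volume of the ball with the initial radius \<mu> / (24 L).\<close>
  define \<nu> where "\<nu> = (\<mu> / (24 * L)) ^ DIM('a) * b / 2"
  have \<nu>: "\<nu> > 0" using \<mu> L b by (simp add: \<nu>_def)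
  have "sublevel_measure k (1/2) = 0" if k: "k > 0" and A0: "sublevel_measure k 0 \<le> \<nu>" for k
  proof -
    define \<tau> where "\<tau> j = (1 - (1/2) ^ j) / (2::real)" for j :: nat
    \<comment> \<open>Chosen so that the decay factor 6 r L / \<delta> equals \<mu> for the step
      \<delta> = 2^(-j-2) from \<tau> j to \<tau> (j + 1).\<close>
    define r where "r j = \<mu> * (1/2) ^ (j + 2) / (6 * L)" for j :: nat
    have r: "r j > 0" for j using \<mu> L by (simp add: r_def)
    have ball: "measure lborel (ball (0::'a) (r j)) = 2 * (\<mu> ^ j * \<nu>)" for j
    proof -
      have "r j = (\<mu> / (24 * L)) * (1/2) ^ j" by (simp add: r_def field_simps)
      then have "r j ^ DIM('a) = (\<mu> / (24 * L)) ^ DIM('a) * \<mu> ^ j"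
        by (simp add: power_mult_distrib \<mu>_def power_divide flip: power_mult add: mult.commute)
      moreover have "measure lborel (ball (0::'a) (r j)) = r j ^ DIM('a) * b"
        unfolding b_def using r[of j] by (intro content_ball_conv_unit_ball) simp
      ultimately show ?thesis by (simp add: \<nu>_def)
    qed
    have A: "sublevel_measure k (\<tau> j) \<le> \<mu> ^ j * \<nu>" for j
    proof (induction j)
      case 0 then show ?case using A0 by (simp add: \<tau>_def)
    next
      case (Suc j)
      have "\<tau> (Suc j) = \<tau> j + (1/2) ^ (j + 2)" by (simp add: \<tau>_def field_simps)
      then have "sublevel_measure k (\<tau> (Suc j)) = sublevel_measure k (\<tau> j + (1/2) ^ (j + 2))" by simp
      also have "\<dots> \<le> 6 * r j * L / (1/2) ^ (j + 2) * sublevel_measure k (\<tau> j)"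
      proof (rule sublevel_decay[OF k _ r])
        show "\<tau> j \<ge> 0" by (simp add: \<tau>_def power_le_one)
        show "2 * sublevel_measure k (\<tau> j) \<le> measure lborel (ball (0::'a) (r j))"
          unfolding ball using Suc by simp
      qed simp
      also have "6 * r j * L / (1/2) ^ (j + 2) = \<mu>" using L by (simp add: r_def)
      also have "\<mu> * sublevel_measure k (\<tau> j) \<le> \<mu> * (\<mu> ^ j * \<nu>)"
        using \<mu> Suc by (intro mult_left_mono) auto
      finally show ?case by simp
    qed
    have "sublevel_measure k (1/2) \<le> \<mu> ^ j * \<nu>" for j
    proof -
      have "\<tau> j \<le> 1/2" by (simp add: \<tau>_def)
      from order_trans[OF sublevel_measure_antimono[OF k this] A] show ?thesis .
    qed
    moreover have "(\<lambda>j. \<mu> ^ j * \<nu>) \<longlonglongrightarrow> 0 * \<nu>"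
      using \<mu> by (intro tendsto_intros LIMSEQ_power_zero) auto
    ultimately have "sublevel_measure k (1/2) \<le> 0"
      by (intro LIMSEQ_le_const[of "\<lambda>j. \<mu> ^ j * \<nu>" 0]) auto
    moreover have "sublevel_measure k (1/2) \<ge> 0" by (simp add: sublevel_measure_def)
    ultimately show ?thesis by simp
  qed
  with \<nu> show ?thesis by blast
qed

lemma minimizer_lower_bound:
  "\<exists>k>0. AE x in M. \<phi> x \<ge> k * (\<eta> x - 1/2)"
proof -
  note [measurable] = sobolev0_measurable[OF sobolev0_minimizer] borel_measurable_test[OF \<eta>]
  obtain B where B: "B > 0" "\<And>x. \<bar>\<eta> x\<bar> \<le> B" using test_function_bounded[OF \<eta>] by metis
  obtain \<nu> where \<nu>: "\<nu> > 0" "\<And>k. k > 0 \<Longrightarrow> sublevel_measure k 0 \<le> \<nu> \<Longrightarrow> sublevel_measure k (1/2) = 0"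
    using sublevel_iteration by blast
  define E where "E n = {x \<in> \<Omega>. \<phi> x < 1 / real (Suc n)}" for n
  have E [measurable]: "E n \<in> sets M" for n
  proof -
    have "{x \<in> space M. \<phi> x < 1 / real (Suc n)} \<in> sets M" by measurable
    then show ?thesis by (simp add: E_def)
  qed
  have "decseq E"
  proof (rule decseq_SucI)
    fix n
    have "1 / real (Suc (Suc n)) \<le> 1 / real (Suc n)" by (simp add: field_simps)
    then show "E (Suc n) \<subseteq> E n" unfolding E_def by (auto intro: less_le_trans)
  qed
  have "(\<lambda>n. measure M (E n)) \<longlonglongrightarrow> measure M (\<Inter>n. E n)"
    by (rule finite_Lim_measure_decseq) (use E \<open>decseq E\<close> in auto)
  also have "measure M (\<Inter>n. E n) = 0"
  proof -
    have "AE x in M. x \<notin> (\<Inter>n. E n)"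
      using minimizer_pos
    proof eventually_elim
      case (elim x)
      then obtain n where "1 / real (Suc n) < \<phi> x" using nat_approx_posE by metis
      then have "x \<notin> E n" by (simp add: E_def)
      then show ?case by blast
    qed
    moreover have "(\<Inter>n. E n) \<in> sets M" by measurable
    ultimately show ?thesis
      using AE_iff_null_sets[of "\<Inter>n. E n" M] by (simp add: measure_eq_0_null_sets)
  qed
  finally have "\<forall>\<^sub>F n in sequentially. measure M (E n) < \<nu>" using \<nu>(1) by (rule order_tendstoD)
  then obtain n where n: "measure M (E n) < \<nu>" by (auto dest: eventually_happens)
  \<comment> \<open>Then k \<eta> \<le> 1 / \<open>Suc n\<close> everywhere, so the starting set of
    the iteration is contained in \<open>E n\<close> and has measure below \<nu>.\<close>
  define k where "k = 1 / (real (Suc n) * B)"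
  have k: "k > 0" using B by (simp add: k_def)
  have "sublevel_measure k 0 \<le> measure M (E n)"
    unfolding sublevel_measure_def
  proof (rule finite_measure_mono[OF _ E])
    have "k * (\<eta> x - 0) \<le> 1 / real (Suc n)" for x
    proof -
      have "k * (\<eta> x - 0) \<le> k * B" using B(2)[of x] k by (intro mult_left_mono) auto
      also have "k * B = 1 / real (Suc n)" using B by (simp add: k_def)
      finally show ?thesis .
    qed
    then show "{x \<in> \<Omega>. \<phi> x < k * (\<eta> x - 0)} \<subseteq> E n" unfolding E_def by (auto intro: less_le_trans)
  qed
  then have "sublevel_measure k (1/2) = 0" using n \<nu>(2)[OF k] by simp
  moreover have S: "{x \<in> \<Omega>. \<phi> x < k * (\<eta> x - 1/2)} \<in> sets M"
  proof -
    have "{x \<in> space M. \<phi> x < k * (\<eta> x - 1/2)} \<in> sets M" by measurable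
    then show ?thesis by simp
  qed
  ultimately have "{x \<in> \<Omega>. \<phi> x < k * (\<eta> x - 1/2)} \<in> null_sets M"
    by (simp add: sublevel_measure_def null_sets_def emeasure_eq_measure)
  then have "AE x in M. x \<notin> {x \<in> \<Omega>. \<phi> x < k * (\<eta> x - 1/2)}" by (rule AE_not_in)
  then have "AE x in M. \<phi> x \<ge> k * (\<eta> x - 1/2)"
    using AE_space[of M] by eventually_elim (auto simp: not_less)
  with k show ?thesis by blast
qed

end

text \<open>A bump normalised to the value 1 at z exceeds 3/4 near z, so the obstacle bound gives
  \<phi> \<ge> k/4 there; finitely many such neighbourhoods cover K.\<close>

lemma minimizer_locally_bounded_below:
  assumes K: "compact K" "K \<subseteq> \<Omega>"
  shows "\<exists>c>0. AE x in M. x \<in> K \<longrightarrow> \<phi> x \<ge> c"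
proof -
  have loc: "\<exists>U c. open U \<and> z \<in> U \<and> c > 0 \<and> (AE x in M. x \<in> U \<longrightarrow> \<phi> x \<ge> c)" if z: "z \<in> K" for z
  proof -
    have "z \<in> \<Omega>" using z K by blast
    then obtain a b where ab: "z \<in> box a b" "cbox a b \<subseteq> \<Omega>"
      using open_domain open_contains_cbox[of \<Omega>] by metis
    define m where "m = bump 0 a b z"
    have m: "m > 0" using bump_pos_iff[of 0 a b z] bump_nonneg[of 0 a b z] ab by (simp add: m_def)
    define \<eta> where "\<eta> = (\<lambda>x. (1 / m) * bump 0 a b x)"
    have \<eta>: "test_function \<Omega> \<eta>"
      unfolding \<eta>_def by (intro test_function_mult test_function_bump ab Ck_const)
    obtain L where L: "L > 0" "\<And>x. norm (grad \<eta> x) \<le> L" using test_function_bounded[OF \<eta>] by metis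
    obtain k where k: "k > 0" "AE x in M. \<phi> x \<ge> k * (\<eta> x - 1/2)"
      using minimizer_lower_bound[OF \<eta> L] by blast
    define U where "U = {x. \<eta> x > 3/4}"
    have "open U" unfolding U_def
      by (rule open_Collect_less[OF continuous_on_const test_function_continuous[OF \<eta>]])
    moreover have "z \<in> U" using m by (simp add: U_def \<eta>_def m_def)
    moreover have "AE x in M. x \<in> U \<longrightarrow> \<phi> x \<ge> k * (1/4)"
      using k(2)
    proof eventually_elim
      case (elim x)
      have "k * (1/4) \<le> k * (\<eta> x - 1/2)" if "x \<in> U"
        using that k(1) by (intro mult_left_mono) (auto simp: U_def)
      with elim show ?case by linarith
    qed
    ultimately show ?thesis using k(1) by (intro exI[of _ U] exI[of _ "k * (1/4)"]) auto
  qed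
  then obtain U c where Uc: "\<And>z. z \<in> K \<Longrightarrow> open (U z) \<and> z \<in> U z \<and> c z > (0::real) \<and> (AE x in M. x \<in> U z \<longrightarrow> \<phi> x \<ge> c z)"
    by metis
  obtain T where T: "T \<subseteq> K" "finite T" "K \<subseteq> (\<Union>z\<in>T. U z)"
    by (rule compactE_image[OF K(1), of K U]) (use Uc in auto)
  define c0 where "c0 = Min (insert 1 (c ` T))"
  have c0: "c0 > 0" "\<And>z. z \<in> T \<Longrightarrow> c0 \<le> c z"
    using T Uc by (auto simp: c0_def)
  have "AE x in M. \<forall>z\<in>T. x \<in> U z \<longrightarrow> \<phi> x \<ge> c z"
    using T Uc by (intro AE_finite_allI) auto
  then have "AE x in M. x \<in> K \<longrightarrow> \<phi> x \<ge> c0"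
  proof eventually_elim
    case (elim x)
    show ?case
    proof
      assume "x \<in> K"
      then obtain z where "z \<in> T" "x \<in> U z" using T(3) by blast
      with elim c0(2)[of z] show "\<phi> x \<ge> c0" by force
    qed
  qed
  with c0(1) show ?thesis by blast
qed

end

section \<open>Quotients by the minimizer\<close>

text \<open>The majorant may depend on the compact set, as do the lower bounds for \<phi> from which
  the majorants for quotients are built.\<close>

lemma loc_dominated_convergence:
  fixes F :: "nat \<Rightarrow> 'a::euclidean_space \<Rightarrow> 'b::euclidean_space"
  assumes \<Omega>: "\<Omega> \<in> sets lebesgue"
    and [measurable]: "\<And>n. F n \<in> borel_measurable (lebesgue_on \<Omega>)" "f \<in> borel_measurable (lebesgue_on \<Omega>)"
    and l: "AE x in lebesgue_on \<Omega>. (\<lambda>n. F n x) \<longlonglongrightarrow> f x"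
    and dom: "\<And>K. compact K \<Longrightarrow> K \<subseteq> \<Omega> \<Longrightarrow> \<exists>W. integrable (lebesgue_on \<Omega>) W \<and>
        (AE x in lebesgue_on \<Omega>. x \<in> K \<longrightarrow> (\<forall>n. norm (F n x) \<le> W x))"
  shows "loc_integrable \<Omega> f"
    and "\<And>K. compact K \<Longrightarrow> K \<subseteq> \<Omega> \<Longrightarrow>
      (\<lambda>n. \<integral>\<^sup>+x. ennreal (norm (indicator K x *\<^sub>R (F n x - f x))) \<partial>lebesgue_on \<Omega>) \<longlonglongrightarrow> 0"
proof -
  let ?M = "lebesgue_on \<Omega>"
  have K_meas [measurable]: "indicat_real K \<in> borel_measurable ?M" if "compact K" for K
    using that by (intro borel_measurable_lebesgue_onI borel_measurable_indicator borel_compact)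
  have fW: "AE x in ?M. x \<in> K \<longrightarrow> norm (f x) \<le> W x" if "AE x in ?M. x \<in> K \<longrightarrow> (\<forall>n. norm (F n x) \<le> W x)" for K W
    using l that
  proof eventually_elim
    case (elim x)
    show ?case
    proof
      assume "x \<in> K"
      then show "norm (f x) \<le> W x"
        using elim by (intro tendsto_upperbound[OF tendsto_norm[OF elim(1)]]) auto
    qed
  qed
  show "loc_integrable \<Omega> f"
    unfolding loc_integrable_def
  proof (intro allI impI)
    fix K assume K: "compact K \<and> K \<subseteq> \<Omega>"
    then obtain W where W: "integrable ?M W" "AE x in ?M. x \<in> K \<longrightarrow> (\<forall>n. norm (F n x) \<le> W x)" using dom by blast
    have [measurable]: "indicat_real K \<in> borel_measurable ?M" using K K_meas by blast
    have "integrable ?M (\<lambda>x. indicator K x *\<^sub>R f x)"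
    proof (rule Bochner_Integration.integrable_bound[OF W(1)])
      show "AE x in ?M. norm (indicator K x *\<^sub>R f x) \<le> norm (W x)"
        using fW[OF W(2)] by eventually_elim (auto simp: indicator_def)
    qed measurable
    then have "integrable lebesgue (\<lambda>x. indicator \<Omega> x *\<^sub>R indicator K x *\<^sub>R f x)"
      using \<Omega> by (subst (asm) integrable_restrict_space) auto
    also have "(\<lambda>x. indicator \<Omega> x *\<^sub>R indicator K x *\<^sub>R f x) = (\<lambda>x. indicator K x *\<^sub>R f x)"
      using K by (auto simp: fun_eq_iff indicator_def)
    finally show "set_integrable lebesgue K f" by (simp add: set_integrable_def)
  qed
  show "(\<lambda>n. \<integral>\<^sup>+x. ennreal (norm (indicator K x *\<^sub>R (F n x - f x))) \<partial>?M) \<longlonglongrightarrow> 0"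
    if K: "compact K" "K \<subseteq> \<Omega>" for K
  proof -
    obtain W where W: "integrable ?M W" "AE x in ?M. x \<in> K \<longrightarrow> (\<forall>n. norm (F n x) \<le> W x)" using dom K by blast
    have [measurable]: "indicat_real K \<in> borel_measurable ?M" using K(1) by (rule K_meas)
    have [measurable]: "W \<in> borel_measurable ?M" using W(1) by (rule borel_measurable_integrable)
    have "(\<lambda>n. \<integral>\<^sup>+x. ennreal (norm (indicator K x *\<^sub>R (F n x - f x))) \<partial>?M) \<longlonglongrightarrow> (\<integral>\<^sup>+x. 0 \<partial>?M)"
    proof (rule nn_integral_dominated_convergence[where w = "\<lambda>x. ennreal (norm (2 * W x))"])
      have "integrable ?M (\<lambda>x. 2 * W x)" using W(1) by simp
      then show "(\<integral>\<^sup>+x. ennreal (norm (2 * W x)) \<partial>?M) < \<infinity>"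
        unfolding integrable_iff_bounded by blast
      show "AE x in ?M. ennreal (norm (indicator K x *\<^sub>R (F n x - f x))) \<le> ennreal (norm (2 * W x))" for n
        using fW[OF W(2)] W(2)
      proof eventually_elim
        case (elim x)
        show ?case
        proof (cases "x \<in> K")
          case True
          then have "norm (F n x - f x) \<le> W x + W x"
            using elim norm_triangle_ineq4[of "F n x" "f x"] by (meson add_mono order_trans)
          then show ?thesis using True by (intro ennreal_leI) simp
        qed simp
      qed
      show "AE x in ?M. (\<lambda>n. ennreal (norm (indicator K x *\<^sub>R (F n x - f x)))) \<longlonglongrightarrow> 0"
        using l
      proof eventually_elim
        case (elim x)
        have "(\<lambda>n. norm (indicator K x *\<^sub>R (F n x - f x))) \<longlonglongrightarrow> norm (indicat_real K x *\<^sub>R (f x - f x))"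
          by (intro tendsto_intros elim)
        from tendsto_ennrealI[OF this] show ?case by simp
      qed
    qed measurable
    then show ?thesis by simp
  qed
qed

text \<open>Two kinds of bounds with different purposes: those in \<kappa> give Lipschitz constants
  for a fixed regularisation, those in b are uniform in \<kappa> and serve as majorants where b is
  bounded below.\<close>

lemma shifted_square_bounds:
  fixes b \<kappa> :: real
  assumes \<kappa>: "\<kappa> > 0"
  shows "(b\<^sup>2 + \<kappa>) powr (-1/2) \<le> \<kappa> powr (-1/2)" "\<bar>b * (b\<^sup>2 + \<kappa>) powr (-3/2)\<bar> \<le> 1 / \<kappa>"
    and "b > 0 \<Longrightarrow> (b\<^sup>2 + \<kappa>) powr (-1/2) \<le> 1 / b" "b > 0 \<Longrightarrow> \<bar>b * (b\<^sup>2 + \<kappa>) powr (-3/2)\<bar> \<le> 1 / b\<^sup>2"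
proof -
  have pos: "b\<^sup>2 + \<kappa> > 0" using \<kappa> by (simp add: add_nonneg_pos)
  show "(b\<^sup>2 + \<kappa>) powr (-1/2) \<le> \<kappa> powr (-1/2)" using \<kappa> by (intro powr_mono2') auto
  have "\<bar>b\<bar> = (b\<^sup>2) powr (1/2)" by (simp add: powr_half_sqrt)
  also have "\<dots> \<le> (b\<^sup>2 + \<kappa>) powr (1/2)" using \<kappa> by (intro powr_mono2) auto
  finally have "\<bar>b\<bar> * (b\<^sup>2 + \<kappa>) powr (-3/2) \<le> (b\<^sup>2 + \<kappa>) powr (1/2) * (b\<^sup>2 + \<kappa>) powr (-3/2)"
    by (intro mult_right_mono) auto
  also have "\<dots> = (b\<^sup>2 + \<kappa>) powr (-1)" by (simp flip: powr_add)
  also have "\<dots> = 1 / (b\<^sup>2 + \<kappa>)" using pos by (simp add: powr_minus_divide)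
  finally have le: "\<bar>b * (b\<^sup>2 + \<kappa>) powr (-3/2)\<bar> \<le> 1 / (b\<^sup>2 + \<kappa>)" by (simp add: abs_mult)
  also have "\<dots> \<le> 1 / \<kappa>" using \<kappa> pos by (intro divide_left_mono mult_pos_pos) auto
  finally show "\<bar>b * (b\<^sup>2 + \<kappa>) powr (-3/2)\<bar> \<le> 1 / \<kappa>" .
  assume b: "b > 0"
  have "(b\<^sup>2 + \<kappa>) powr (-1/2) \<le> (b\<^sup>2) powr (-1/2)" using b \<kappa> by (intro powr_mono2') auto
  also have "\<dots> = 1 / b" using b by (simp add: powr_half_sqrt powr_minus_divide)
  finally show "(b\<^sup>2 + \<kappa>) powr (-1/2) \<le> 1 / b" .
  have "1 / (b\<^sup>2 + \<kappa>) \<le> 1 / b\<^sup>2" using b \<kappa> pos by (intro divide_left_mono mult_pos_pos) auto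
  with le show "\<bar>b * (b\<^sup>2 + \<kappa>) powr (-3/2)\<bar> \<le> 1 / b\<^sup>2" by linarith
qed

text \<open>A smooth replacement for the identity that is bounded for fixed \<kappa>, never exceeds
  |a| in absolute value, and has derivative at most 1. Boundedness matters because the derivative of
  a/b in b is proportional to a.\<close>

lemma damped_identity:
  fixes a \<kappa> :: real
  assumes \<kappa>: "\<kappa> > 0"
  shows "((\<lambda>a. a * (1 + \<kappa> * a\<^sup>2) powr (-1/2)) has_real_derivative (1 + \<kappa> * a\<^sup>2) powr (-3/2)) (at a)"
    and "\<bar>a * (1 + \<kappa> * a\<^sup>2) powr (-1/2)\<bar> \<le> \<bar>a\<bar>" "\<bar>a * (1 + \<kappa> * a\<^sup>2) powr (-1/2)\<bar> \<le> \<kappa> powr (-1/2)"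
    and "(1 + \<kappa> * a\<^sup>2) powr (-3/2) \<le> 1"
proof -
  have ge1: "1 + \<kappa> * a\<^sup>2 \<ge> 1" using \<kappa> by simp
  then have pos: "1 + \<kappa> * a\<^sup>2 > 0" by linarith
  have "((\<lambda>a. 1 + \<kappa> * a\<^sup>2) has_real_derivative (2 * \<kappa> * a)) (at a)"
    by (auto intro!: derivative_eq_intros)
  from DERIV_mult[OF DERIV_ident DERIV_fun_powr[OF this pos, of "-1/2"]]
  have "((\<lambda>a. a * (1 + \<kappa> * a\<^sup>2) powr (-1/2)) has_real_derivative
      (1 * (1 + \<kappa> * a\<^sup>2) powr (-1/2) + - 1/2 * (1 + \<kappa> * a\<^sup>2) powr (-1/2 - 1) * (2 * \<kappa> * a) * a)) (at a)"
    by simp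
  moreover have "1 * (1 + \<kappa> * a\<^sup>2) powr (-1/2) + - 1/2 * (1 + \<kappa> * a\<^sup>2) powr (-1/2 - 1) * (2 * \<kappa> * a) * a
      = (1 + \<kappa> * a\<^sup>2) powr (-3/2)"
  proof -
    have e: "(1 + \<kappa> * a\<^sup>2) powr (-1/2) = (1 + \<kappa> * a\<^sup>2) powr (-3/2) * (1 + \<kappa> * a\<^sup>2)"
      using powr_add[of "1 + \<kappa> * a\<^sup>2" "-3/2" 1] pos by simp
    have e': "-1/2 - 1 = (-3/2 :: real)" by simp
    show ?thesis unfolding e e' by (simp add: algebra_simps power2_eq_square)
  qed
  ultimately show "((\<lambda>a. a * (1 + \<kappa> * a\<^sup>2) powr (-1/2)) has_real_derivative (1 + \<kappa> * a\<^sup>2) powr (-3/2)) (at a)" by simp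
  have le1: "(1 + \<kappa> * a\<^sup>2) powr r \<le> 1" if "r \<le> 0" for r
    using powr_mono2'[of r 1 "1 + \<kappa> * a\<^sup>2"] that ge1 by simp
  show "(1 + \<kappa> * a\<^sup>2) powr (-3/2) \<le> 1" by (rule le1) simp
  show "\<bar>a * (1 + \<kappa> * a\<^sup>2) powr (-1/2)\<bar> \<le> \<bar>a\<bar>"
    using le1[of "-1/2"] by (simp add: abs_mult mult_left_le)
  have "\<kappa> powr (1/2) * \<bar>a\<bar> = (\<kappa> * a\<^sup>2) powr (1/2)" using \<kappa> by (simp add: powr_mult powr_half_sqrt)
  also have "\<dots> \<le> (1 + \<kappa> * a\<^sup>2) powr (1/2)" using \<kappa> by (intro powr_mono2) auto
  finally have "\<kappa> powr (1/2) * \<bar>a\<bar> * (1 + \<kappa> * a\<^sup>2) powr (-1/2) \<le> (1 + \<kappa> * a\<^sup>2) powr (1/2) * (1 + \<kappa> * a\<^sup>2) powr (-1/2)"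
    by (intro mult_right_mono) auto
  also have "\<dots> = 1" using pos by (simp flip: powr_add)
  finally have "\<kappa> powr (-1/2) * (\<kappa> powr (1/2) * \<bar>a\<bar> * (1 + \<kappa> * a\<^sup>2) powr (-1/2)) \<le> \<kappa> powr (-1/2) * 1"
    by (intro mult_left_mono) auto
  moreover have "\<kappa> powr (-1/2) * (\<kappa> powr (1/2) * \<bar>a\<bar> * (1 + \<kappa> * a\<^sup>2) powr (-1/2)) = \<bar>a * (1 + \<kappa> * a\<^sup>2) powr (-1/2)\<bar>"
  proof -
    have "\<kappa> powr (-1/2) * \<kappa> powr (1/2) = 1" using \<kappa> by (simp flip: powr_add)
    then show ?thesis by (simp add: abs_mult flip: mult.assoc)
  qed
  ultimately show "\<bar>a * (1 + \<kappa> * a\<^sup>2) powr (-1/2)\<bar> \<le> \<kappa> powr (-1/2)" by simp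
qed

section \<open>Regularised quotients\<close>

context finite_domain
begin

text \<open>This Lipschitz bound blows up as \<kappa> tends to 0, so the hypotheses of
  \<open>sobolev0_chain_limit\<close> fail for it; the limit is taken for weak gradients on compact
  subsets instead.\<close>

lemma smooth_lipschitz2_quotient:
  assumes \<kappa>: "\<kappa> > 0"
  shows "smooth_lipschitz2
     (\<lambda>a b. a * (1 + \<kappa> * a\<^sup>2) powr (-1/2) * (b\<^sup>2 + \<kappa>) powr (-1/2))
     (\<lambda>a b. (1 + \<kappa> * a\<^sup>2) powr (-3/2) * (b\<^sup>2 + \<kappa>) powr (-1/2))
     (\<lambda>a b. a * (1 + \<kappa> * a\<^sup>2) powr (-1/2) * (- (b * (b\<^sup>2 + \<kappa>) powr (-3/2))))
     (\<kappa> powr (-1/2) + \<kappa> powr (-1/2) * (1 / \<kappa>))"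
  unfolding smooth_lipschitz2_def
proof (intro conjI allI impI)
  have pos1: "1 + \<kappa> * a\<^sup>2 > 0" for a :: real using \<kappa> by (simp add: add_pos_nonneg)
  have pos2: "b\<^sup>2 + \<kappa> > 0" for b :: real using \<kappa> by (simp add: add_nonneg_pos)
  show "Ck k (\<lambda>x. f x * (1 + \<kappa> * (f x)\<^sup>2) powr (-1/2) * ((g x)\<^sup>2 + \<kappa>) powr (-1/2))"
    if "\<forall>k. Ck k f" "\<forall>k. Ck k g" for f g :: "'a \<Rightarrow> real" and k
    using that pos1 pos2 by (intro Ck_mult Ck_powr Ck_add Ck_power Ck_const Ck_cmult) auto
  show "((\<lambda>z. fst z * (1 + \<kappa> * (fst z)\<^sup>2) powr (-1/2) * ((snd z)\<^sup>2 + \<kappa>) powr (-1/2)) has_derivative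
     (\<lambda>h. (1 + \<kappa> * (fst z)\<^sup>2) powr (-3/2) * ((snd z)\<^sup>2 + \<kappa>) powr (-1/2) * fst h
       + fst z * (1 + \<kappa> * (fst z)\<^sup>2) powr (-1/2) * (- (snd z * ((snd z)\<^sup>2 + \<kappa>) powr (-3/2))) * snd h)) (at z)"
    for z :: "real \<times> real"
  proof -
    have "((\<lambda>s. ((s - 0)\<^sup>2 + \<kappa>) powr (-1/2)) has_real_derivative
        (2 * (-1/2) * (snd z - 0)) * ((snd z - 0)\<^sup>2 + \<kappa>) powr (-1/2 - 1)) (at (snd z))"
      by (rule DERIV_powr_shifted_square[OF \<kappa>])
    then have "((\<lambda>s. (s\<^sup>2 + \<kappa>) powr (-1/2)) has_real_derivative
        - (snd z * ((snd z)\<^sup>2 + \<kappa>) powr (-3/2))) (at (snd z))" by simp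
    from has_derivative_mult[OF has_derivative_fst_compose[OF damped_identity(1)[OF \<kappa>]] has_derivative_snd_compose[OF this]]
    show ?thesis by (rule has_derivative_eq_rhs) (auto simp: fun_eq_iff)
  qed
  show "continuous_on UNIV (\<lambda>z::real \<times> real. (1 + \<kappa> * (fst z)\<^sup>2) powr (-3/2) * ((snd z)\<^sup>2 + \<kappa>) powr (-1/2))"
    "continuous_on UNIV (\<lambda>z::real \<times> real. fst z * (1 + \<kappa> * (fst z)\<^sup>2) powr (-1/2) * (- (snd z * ((snd z)\<^sup>2 + \<kappa>) powr (-3/2))))"
    using pos1 pos2 by (intro continuous_intros; auto simp: less_imp_neq[symmetric])+
  show "\<bar>(1 + \<kappa> * a\<^sup>2) powr (-3/2) * (b\<^sup>2 + \<kappa>) powr (-1/2)\<bar> \<le> \<kappa> powr (-1/2) + \<kappa> powr (-1/2) * (1 / \<kappa>)" for a b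
  proof -
    have "(1 + \<kappa> * a\<^sup>2) powr (-3/2) * (b\<^sup>2 + \<kappa>) powr (-1/2) \<le> 1 * \<kappa> powr (-1/2)"
      by (intro mult_mono damped_identity \<kappa> shifted_square_bounds) auto
    moreover have "\<kappa> powr (-1/2) * (1 / \<kappa>) \<ge> 0" using \<kappa> by simp
    moreover have "\<bar>(1 + \<kappa> * a\<^sup>2) powr (-3/2) * (b\<^sup>2 + \<kappa>) powr (-1/2)\<bar> = (1 + \<kappa> * a\<^sup>2) powr (-3/2) * (b\<^sup>2 + \<kappa>) powr (-1/2)"
      by (simp add: abs_mult)
    ultimately show ?thesis by linarith
  qed
  show "\<bar>a * (1 + \<kappa> * a\<^sup>2) powr (-1/2) * (- (b * (b\<^sup>2 + \<kappa>) powr (-3/2)))\<bar> \<le> \<kappa> powr (-1/2) + \<kappa> powr (-1/2) * (1 / \<kappa>)" for a b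
  proof -
    have "\<bar>a * (1 + \<kappa> * a\<^sup>2) powr (-1/2)\<bar> * \<bar>b * (b\<^sup>2 + \<kappa>) powr (-3/2)\<bar> \<le> \<kappa> powr (-1/2) * (1 / \<kappa>)"
      by (intro mult_mono damped_identity \<kappa> shifted_square_bounds) auto
    moreover have "\<kappa> powr (-1/2) \<ge> 0" by simp
    moreover have "\<bar>a * (1 + \<kappa> * a\<^sup>2) powr (-1/2) * (- (b * (b\<^sup>2 + \<kappa>) powr (-3/2)))\<bar>
        = \<bar>a * (1 + \<kappa> * a\<^sup>2) powr (-1/2)\<bar> * \<bar>b * (b\<^sup>2 + \<kappa>) powr (-3/2)\<bar>" by (simp add: abs_mult)
    ultimately show ?thesis by linarith
  qed
qed simp

text \<open>The quotient \<open>u / w\<close> is approximated by functions of \<open>(u, w)\<close> with bounded derivatives;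
  \<open>p \<ge> 2\<close> makes the product \<open>u \<nabla>w\<close> integrable.\<close>

lemma has_weak_grad_quotient:
  assumes u: "sobolev0 u g" and w: "sobolev0 w h" and p2: "p \<ge> 2"
    and w0: "AE x in M. w x > 0"
    and lower: "\<And>K. compact K \<Longrightarrow> K \<subseteq> \<Omega> \<Longrightarrow> \<exists>c>0. AE x in M. x \<in> K \<longrightarrow> w x \<ge> c"
  shows "has_weak_grad \<Omega> (\<lambda>x. u x / w x) (\<lambda>x. (1 / w x) *\<^sub>R g x + (- (u x / (w x)\<^sup>2)) *\<^sub>R h x)"
proof -
  note [measurable] = sobolev0_measurable[OF u] sobolev0_measurable[OF w]
  define \<kappa> where "\<kappa> = (\<lambda>n::nat. 1 / real (Suc n))"
  have \<kappa>: "\<kappa> n > 0" for n by (simp add: \<kappa>_def)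
  have \<kappa>l: "\<kappa> \<longlonglongrightarrow> 0" unfolding \<kappa>_def using LIMSEQ_inverse_real_of_nat by (simp add: inverse_eq_divide)
  define V where "V n x = u x * (1 + \<kappa> n * (u x)\<^sup>2) powr (-1/2) * ((w x)\<^sup>2 + \<kappa> n) powr (-1/2)" for n x
  define k where "k n x = ((1 + \<kappa> n * (u x)\<^sup>2) powr (-3/2) * ((w x)\<^sup>2 + \<kappa> n) powr (-1/2)) *\<^sub>R g x
    + (u x * (1 + \<kappa> n * (u x)\<^sup>2) powr (-1/2) * (- (w x * ((w x)\<^sup>2 + \<kappa> n) powr (-3/2)))) *\<^sub>R h x" for n x
  have s: "sobolev0 (V n) (k n)" for n
    unfolding V_def[abs_def] k_def[abs_def] by (rule sobolev0_chain[OF smooth_lipschitz2_quotient[OF \<kappa>] u w])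
  note [measurable] = sobolev0_measurable[OF s]
  have d1: "(\<lambda>n. (1 + \<kappa> n * a\<^sup>2) powr r) \<longlonglongrightarrow> 1" for a r :: real
  proof -
    have "(\<lambda>n. (1 + \<kappa> n * a\<^sup>2) powr r) \<longlonglongrightarrow> (1 + 0 * a\<^sup>2) powr r"
      by (intro tendsto_intros \<kappa>l) auto
    then show ?thesis by simp
  qed
  have d2: "(\<lambda>n. (b\<^sup>2 + \<kappa> n) powr (-1/2)) \<longlonglongrightarrow> 1 / b" "(\<lambda>n. b * (b\<^sup>2 + \<kappa> n) powr (-3/2)) \<longlonglongrightarrow> 1 / b\<^sup>2" if b: "b > 0" for b
  proof -
    have l: "(\<lambda>n. (b\<^sup>2 + \<kappa> n) powr r) \<longlonglongrightarrow> (b\<^sup>2 + 0) powr r" for r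
      using b by (intro tendsto_intros \<kappa>l) auto
    have b2: "b\<^sup>2 powr (r/2) = b powr r" for r using norm_square_powr_half[of b r] b by simp
    have "(b\<^sup>2 + 0) powr (-1/2) = 1 / b" using b2[of "-1"] b by (simp add: powr_minus_divide)
    with l[of "-1/2"] show "(\<lambda>n. (b\<^sup>2 + \<kappa> n) powr (-1/2)) \<longlonglongrightarrow> 1 / b" by simp
    have "b * (b\<^sup>2 + 0) powr (-3/2) = b powr 1 * b powr (-3)" using b2[of "-3"] b by simp
    also have "\<dots> = b powr (-2)" unfolding powr_add[symmetric] by simp
    also have "\<dots> = 1 / b\<^sup>2" using b by (simp add: powr_minus_divide powr_numeral)
    finally show "(\<lambda>n. b * (b\<^sup>2 + \<kappa> n) powr (-3/2)) \<longlonglongrightarrow> 1 / b\<^sup>2"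
      using tendsto_mult[OF tendsto_const[of b] l[of "-3/2"]] by simp
  qed
  have Vl: "AE x in M. (\<lambda>n. V n x) \<longlonglongrightarrow> u x / w x"
    using w0
  proof eventually_elim
    case (elim x)
    have "(\<lambda>n. V n x) \<longlonglongrightarrow> u x * 1 * (1 / w x)"
      unfolding V_def by (intro tendsto_mult tendsto_const d1 d2 elim)
    then show ?case by simp
  qed
  have kl: "AE x in M. (\<lambda>n. k n x) \<longlonglongrightarrow> (1 / w x) *\<^sub>R g x + (- (u x / (w x)\<^sup>2)) *\<^sub>R h x"
    using w0
  proof eventually_elim
    case (elim x)
    have "(\<lambda>n. k n x) \<longlonglongrightarrow> (1 * (1 / w x)) *\<^sub>R g x + (u x * 1 * (- (1 / (w x)\<^sup>2))) *\<^sub>R h x"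
      unfolding k_def by (intro tendsto_add tendsto_scaleR tendsto_mult tendsto_minus tendsto_const d1 d2 elim)
    then show ?case by simp
  qed
  have ui: "integrable M u" "integrable M g" using sobolev0_integrable[OF u] by auto
  have u2: "integrable M (\<lambda>x. (u x)\<^sup>2)"
    using sobolev0_integrable_powr(1)[OF u, of 2] p2 by (simp add: powr_numeral)
  have h2: "integrable M (\<lambda>x. (norm (h x))\<^sup>2)"
  proof (rule Bochner_Integration.integrable_bound)
    show "integrable M (\<lambda>x. 1 + norm (h x) powr p)"
      using sobolev0_integrable_powr(2)[OF w, of p] p2 by simp
    have "(norm (h x))\<^sup>2 \<le> 1 + norm (h x) powr p" for x
    proof (cases "norm (h x) \<le> 1")
      case True
      then have "(norm (h x))\<^sup>2 \<le> 1" by (simp add: power_le_one)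
      moreover have "norm (h x) powr p \<ge> 0" by simp
      ultimately show ?thesis by linarith
    next
      case False
      then have "norm (h x) powr 2 \<le> norm (h x) powr p" using p2 by (intro powr_mono) auto
      moreover have "norm (h x) powr 2 = (norm (h x))\<^sup>2" by (rule powr_numeral) (use False in auto)
      ultimately show ?thesis by linarith
    qed
    then show "AE x in M. norm ((norm (h x))\<^sup>2) \<le> norm (1 + norm (h x) powr p)" by simp
  qed measurable
  \<comment> \<open>Both factors are square integrable, since p \<ge> 2 and \<Omega> has finite
    measure.\<close>
  have uh: "integrable M (\<lambda>x. \<bar>u x\<bar> * norm (h x))"
  proof (rule Bochner_Integration.integrable_bound)
    show "integrable M (\<lambda>x. (u x)\<^sup>2 + (norm (h x))\<^sup>2)" using u2 h2 by simp
    have "\<bar>u x\<bar> * norm (h x) \<le> (u x)\<^sup>2 + (norm (h x))\<^sup>2" for x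
    proof -
      have "2 * (\<bar>u x\<bar> * norm (h x)) \<le> (u x)\<^sup>2 + (norm (h x))\<^sup>2"
        using sum_squares_bound[of "\<bar>u x\<bar>" "norm (h x)"] by (simp add: mult.assoc)
      moreover have "\<bar>u x\<bar> * norm (h x) \<ge> 0" by simp
      ultimately show ?thesis by linarith
    qed
    then show "AE x in M. norm (\<bar>u x\<bar> * norm (h x)) \<le> norm ((u x)\<^sup>2 + (norm (h x))\<^sup>2)"
      by (intro AE_I2) simp
  qed measurable
  have domV: "\<exists>W. integrable M W \<and> (AE x in M. x \<in> K \<longrightarrow> (\<forall>n. norm (V n x) \<le> W x))"
    if K: "compact K" "K \<subseteq> \<Omega>" for K
  proof -
    obtain c where c: "c > 0" "AE x in M. x \<in> K \<longrightarrow> w x \<ge> c" using lower[OF K] by blast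
    have "AE x in M. x \<in> K \<longrightarrow> (\<forall>n. norm (V n x) \<le> norm (u x) * (1 / c))"
      using c(2)
    proof eventually_elim
      case (elim x)
      show ?case
      proof (intro impI allI)
        fix n assume "x \<in> K"
        then have wc: "w x \<ge> c" "w x > 0" using elim c(1) by auto
        have "norm (V n x) = \<bar>u x * (1 + \<kappa> n * (u x)\<^sup>2) powr (-1/2)\<bar> * ((w x)\<^sup>2 + \<kappa> n) powr (-1/2)"
          by (simp add: V_def abs_mult)
        also have "\<dots> \<le> \<bar>u x\<bar> * (1 / w x)"
          by (intro mult_mono damped_identity \<kappa> shifted_square_bounds wc) auto
        also have "\<dots> \<le> \<bar>u x\<bar> * (1 / c)" using wc c(1) by (intro mult_left_mono divide_left_mono) auto
        finally show "norm (V n x) \<le> norm (u x) * (1 / c)" by simp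
      qed
    qed
    moreover have "integrable M (\<lambda>x. norm (u x) * (1 / c))" using ui(1) by (intro integrable_mult_left integrable_norm)
    ultimately show ?thesis by blast
  qed
  have domk: "\<exists>W. integrable M W \<and> (AE x in M. x \<in> K \<longrightarrow> (\<forall>n. norm (k n x) \<le> W x))"
    if K: "compact K" "K \<subseteq> \<Omega>" for K
  proof -
    obtain c where c: "c > 0" "AE x in M. x \<in> K \<longrightarrow> w x \<ge> c" using lower[OF K] by blast
    have "AE x in M. x \<in> K \<longrightarrow> (\<forall>n. norm (k n x) \<le> norm (g x) * (1 / c) + \<bar>u x\<bar> * norm (h x) * (1 / c\<^sup>2))"
      using c(2)
    proof eventually_elim
      case (elim x)
      show ?case
      proof (intro impI allI)
        fix n assume "x \<in> K"
        then have wc: "w x \<ge> c" "w x > 0" using elim c(1) by auto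
        have "(1 + \<kappa> n * (u x)\<^sup>2) powr (-3/2) * ((w x)\<^sup>2 + \<kappa> n) powr (-1/2) \<le> 1 * (1 / w x)"
          by (intro mult_mono damped_identity \<kappa> shifted_square_bounds wc) auto
        also have "\<dots> \<le> 1 / c" using wc c(1) by (simp add: divide_left_mono)
        finally have 1: "\<bar>(1 + \<kappa> n * (u x)\<^sup>2) powr (-3/2) * ((w x)\<^sup>2 + \<kappa> n) powr (-1/2)\<bar> \<le> 1 / c"
          by (simp add: abs_mult)
        have "\<bar>u x * (1 + \<kappa> n * (u x)\<^sup>2) powr (-1/2)\<bar> * \<bar>w x * ((w x)\<^sup>2 + \<kappa> n) powr (-3/2)\<bar> \<le> \<bar>u x\<bar> * (1 / (w x)\<^sup>2)"
          by (intro mult_mono damped_identity \<kappa> shifted_square_bounds wc) auto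
        also have "\<dots> \<le> \<bar>u x\<bar> * (1 / c\<^sup>2)"
          using wc c(1) by (intro mult_left_mono divide_left_mono power_mono) auto
        finally have 2: "\<bar>u x * (1 + \<kappa> n * (u x)\<^sup>2) powr (-1/2) * (- (w x * ((w x)\<^sup>2 + \<kappa> n) powr (-3/2)))\<bar> \<le> \<bar>u x\<bar> * (1 / c\<^sup>2)"
          by (simp add: abs_mult)
        have "norm (k n x) \<le> (1 / c) * norm (g x) + (\<bar>u x\<bar> * (1 / c\<^sup>2)) * norm (h x)"
          unfolding k_def
          by (intro norm_triangle_le add_mono; unfold norm_scaleR; intro mult_right_mono 1 2 norm_ge_zero)
        then show "norm (k n x) \<le> norm (g x) * (1 / c) + \<bar>u x\<bar> * norm (h x) * (1 / c\<^sup>2)" by (simp add: mult_ac)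
      qed
    qed
    moreover have "integrable M (\<lambda>x. norm (g x) * (1 / c) + \<bar>u x\<bar> * norm (h x) * (1 / c\<^sup>2))"
      using ui(2) uh by (intro Bochner_Integration.integrable_add integrable_mult_left integrable_norm)
    ultimately show ?thesis by blast
  qed
  have mU: "(\<lambda>x. u x / w x) \<in> borel_measurable M"
    "(\<lambda>x. (1 / w x) *\<^sub>R g x + (- (u x / (w x)\<^sup>2)) *\<^sub>R h x) \<in> borel_measurable M" by measurable
  note LV = loc_dominated_convergence[OF domain_sets sobolev0_measurable(1)[OF s] mU(1) Vl domV]
  note Lk = loc_dominated_convergence[OF domain_sets sobolev0_measurable(2)[OF s] mU(2) kl domk]
  show ?thesis
    by (rule has_weak_grad_limit[OF domain_sets sobolev0_has_weak_grad[OF s] LV(1) Lk(1) LV(2) Lk(2)])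
qed

end

section \<open>From nonnegative normalised functions to arbitrary ones\<close>

context minimizer
begin

text \<open>By the quotient rule, \<phi>^2 times the gradient of u/\<phi> is \<phi> \<nabla>u - u
  \<nabla>\<phi>. Passing to |u| multiplies this vector by the sign of u, which does not change its
  norm; where u = 0 the gradient of u vanishes too.\<close>

lemma quotient_gradient_eq_Rp:
  assumes u: "sobolev0 u g" and p2: "p \<ge> 2"
  shows "AE x in M. norm (weak_grad \<Omega> (\<lambda>y. u y / \<phi> y) x) powr p * \<phi> x powr p = Rp \<Omega> p (\<lambda>x. \<bar>u x\<bar>) \<phi> 1 x"
proof -
  have "AE x in M. weak_grad \<Omega> (\<lambda>y. u y / \<phi> y) x = (1 / \<phi> x) *\<^sub>R g x + (- (u x / (\<phi> x)\<^sup>2)) *\<^sub>R d\<phi> x"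
    by (intro weak_grad_AE_eq[OF open_domain] has_weak_grad_quotient[OF u sobolev0_minimizer p2 minimizer_pos]
        minimizer_locally_bounded_below)
  then show ?thesis
    using sobolev0_weak_grad[OF sobolev0_abs_gradient[OF u]] sobolev0_gradient_zero[OF u] minimizer_pos
  proof eventually_elim
    case (elim x)
    have "(1 / \<phi> x) *\<^sub>R g x + (- (u x / (\<phi> x)\<^sup>2)) *\<^sub>R d\<phi> x = (1 / (\<phi> x)\<^sup>2) *\<^sub>R (\<phi> x *\<^sub>R g x - u x *\<^sub>R d\<phi> x)"
      using elim(4) by (simp add: scaleR_diff_right power2_eq_square)
    then have "norm (weak_grad \<Omega> (\<lambda>y. u y / \<phi> y) x) * \<phi> x = norm (\<phi> x *\<^sub>R g x - u x *\<^sub>R d\<phi> x) / \<phi> x"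
      using elim(1,4) by (simp add: power2_eq_square)
    then have "norm (weak_grad \<Omega> (\<lambda>y. u y / \<phi> y) x) powr p * \<phi> x powr p
        = (norm (\<phi> x *\<^sub>R g x - u x *\<^sub>R d\<phi> x) / \<phi> x) powr p"
      using elim(4) by (simp flip: powr_mult)
    also have "\<dots> = norm (\<phi> x *\<^sub>R g x - u x *\<^sub>R d\<phi> x) powr p / \<phi> x powr p"
      by (rule powr_divide)
    also have "norm (\<phi> x *\<^sub>R g x - u x *\<^sub>R d\<phi> x) = norm (\<phi> x *\<^sub>R sgn (u x) *\<^sub>R g x - \<bar>u x\<bar> *\<^sub>R d\<phi> x)"
    proof (cases "u x = 0")
      case True
      then show ?thesis using elim(3) by simp
    next
      case False
      then have "\<phi> x *\<^sub>R sgn (u x) *\<^sub>R g x - \<bar>u x\<bar> *\<^sub>R d\<phi> x = sgn (u x) *\<^sub>R (\<phi> x *\<^sub>R g x - u x *\<^sub>R d\<phi> x)"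
        by (simp add: scaleR_diff_right abs_sgn mult.commute)
      then show ?thesis using False by (simp add: abs_sgn_eq)
    qed
    finally show ?case using p2 elim(2) by (simp add: Rp_eq_remainder_num remainder_num_def)
  qed
qed

lemma scaled_abs:
  assumes u: "sobolev0 u g" and c: "c \<ge> 0"
  shows "sobolev0 (\<lambda>x. c * \<bar>u x\<bar>) (weak_grad \<Omega> (\<lambda>x. c * \<bar>u x\<bar>))"
    and "(\<integral>x. norm (weak_grad \<Omega> (\<lambda>x. c * \<bar>u x\<bar>) x) powr p \<partial>M) = c powr p * (\<integral>x. norm (g x) powr p \<partial>M)"
    and "(\<integral>x. \<bar>c * \<bar>u x\<bar>\<bar> powr q \<partial>M) = c powr q * (\<integral>x. \<bar>u x\<bar> powr q \<partial>M)"
proof -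
  have s: "sobolev0 (\<lambda>x. c * \<bar>u x\<bar>) (\<lambda>x. c *\<^sub>R sgn (u x) *\<^sub>R g x)"
    by (rule sobolev0_cmult[OF sobolev0_abs_gradient[OF u]])
  show "sobolev0 (\<lambda>x. c * \<bar>u x\<bar>) (weak_grad \<Omega> (\<lambda>x. c * \<bar>u x\<bar>))"
    by (rule W1_0_imp_sobolev0[OF sobolev0_imp_W1_0[OF s]])
  have "(\<integral>x. norm (weak_grad \<Omega> (\<lambda>x. c * \<bar>u x\<bar>) x) powr p \<partial>M) = (\<integral>x. norm (c *\<^sub>R sgn (u x) *\<^sub>R g x) powr p \<partial>M)"
    by (rule integral_norm_weak_grad[OF s])
  also have "\<dots> = (\<integral>x. c powr p * norm (g x) powr p \<partial>M)"
  proof (rule integral_cong_AE)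
    note [measurable] = sobolev0_measurable[OF u]
    show "(\<lambda>x. norm (c *\<^sub>R sgn (u x) *\<^sub>R g x) powr p) \<in> borel_measurable M"
      "(\<lambda>x. c powr p * norm (g x) powr p) \<in> borel_measurable M"
      using sobolev0_measurable(2)[OF s] by measurable
    show "AE x in M. norm (c *\<^sub>R sgn (u x) *\<^sub>R g x) powr p = c powr p * norm (g x) powr p"
      using sobolev0_gradient_zero[OF u]
    proof eventually_elim
      case (elim x)
      have "norm (c *\<^sub>R sgn (u x) *\<^sub>R g x) = c * norm (g x)"
        using elim c unfolding norm_scaleR by (cases "u x = 0") (simp_all add: abs_sgn_eq)
      then show ?case using c by (simp only: powr_mult)
    qed
  qed
  finally show "(\<integral>x. norm (weak_grad \<Omega> (\<lambda>x. c * \<bar>u x\<bar>) x) powr p \<partial>M) = c powr p * (\<integral>x. norm (g x) powr p \<partial>M)" by simp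
  show "(\<integral>x. \<bar>c * \<bar>u x\<bar>\<bar> powr q \<partial>M) = c powr q * (\<integral>x. \<bar>u x\<bar> powr q \<partial>M)"
    using c by (simp add: abs_mult powr_mult)
qed

lemma Lnorm_powr_p:
  "Lnorm \<Omega> q u powr p = (\<integral>x. \<bar>u x\<bar> powr q \<partial>M) powr (p / q)" for u :: "'a \<Rightarrow> real"
  by (simp add: Lnorm_def powr_powr)

text \<open>The deficit is homogeneous of degree p. The factor c equalises the L^q norms, and
  dividing the bound for c |u| by c^p produces the quotient of norms in front of the
  maximum.\<close>

lemma hidden_convexity_max:
  assumes u: "u \<in> W1_0 \<Omega> p"
  defines "F \<equiv> \<lambda>t. ereal (t * (1 - t)) * pos_integral \<Omega> (Rp \<Omega> p (\<lambda>x. Lnorm \<Omega> q \<phi> / Lnorm \<Omega> q u * \<bar>u x\<bar>) \<phi> t)"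
  shows "\<exists>s. is_arg_max F (\<lambda>t. t \<in> {0..1}) s \<and>
    ereal (Lnorm \<Omega> p (weak_grad \<Omega> u) powr p - lambda1 \<Omega> p q * Lnorm \<Omega> q u powr p)
      \<ge> ereal (C * (Lnorm \<Omega> q u powr p / Lnorm \<Omega> q \<phi> powr p)) * F s"
proof -
  note su = W1_0_imp_sobolev0[OF u]
  define N where "N = (\<integral>x. \<bar>u x\<bar> powr q \<partial>M)"
  define N\<phi> where "N\<phi> = (\<integral>x. \<bar>\<phi> x\<bar> powr q \<partial>M)"
  have N\<phi>: "N\<phi> > 0" unfolding N\<phi>_def by (rule minimizer_integral_pos)
  have L: "Lnorm \<Omega> q u = N powr (1/q)" "Lnorm \<Omega> q \<phi> = N\<phi> powr (1/q)"
    by (simp_all add: Lnorm_def N_def N\<phi>_def)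
  have Lp: "Lnorm \<Omega> p (weak_grad \<Omega> u) powr p = (\<integral>x. norm (weak_grad \<Omega> u x) powr p \<partial>M)"
    using p_gt_1 by (simp add: Lnorm_def powr_powr)
  define c where "c = Lnorm \<Omega> q \<phi> / Lnorm \<Omega> q u"
  have c0: "c \<ge> 0" by (simp add: c_def L)
  note sc = scaled_abs[OF su c0]
  show ?thesis
  proof (cases "N = 0")
    case True
    \<comment> \<open>Division by 0 yields 0, so for u = 0 the first function in \<open>Rp\<close>
      is zero and the expression to be maximised vanishes for every t.\<close>
    then have c: "c = 0" using q by (simp add: c_def L)
    have "AE x in M. weak_grad \<Omega> (\<lambda>x. c * \<bar>u x\<bar>) x = 0"
      using sobolev0_gradient_zero[OF sc(1)] by eventually_elim (simp add: c)
    then have "pos_integral \<Omega> (Rp \<Omega> p (\<lambda>x. c * \<bar>u x\<bar>) \<phi> t) = 0" for t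
    proof -
      have "(\<integral>\<^sup>+x. ennreal (Rp \<Omega> p (\<lambda>x. c * \<bar>u x\<bar>) \<phi> t x) \<partial>M) = (\<integral>\<^sup>+x. 0 \<partial>M)"
        using \<open>AE x in M. weak_grad \<Omega> (\<lambda>x. c * \<bar>u x\<bar>) x = 0\<close>
        by (intro nn_integral_cong_AE) (auto elim!: eventually_mono simp: Rp_eq_remainder_num c)
      then show ?thesis by (simp add: pos_integral_def zero_ennreal.rep_eq)
    qed
    then have F0: "F t = 0" for t unfolding F_def c_def[symmetric] by simp
    have "is_arg_max F (\<lambda>t. t \<in> {0..1}) 0" by (simp add: is_arg_max_def F0)
    moreover have "Lnorm \<Omega> q u powr p = 0" using True q by (simp add: L)
    ultimately show ?thesis by (intro exI[of _ 0]) (simp add: F0 zero_ereal_def[symmetric])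
  next
    case False
    then have N: "N > 0" by (simp add: N_def less_le)
    have cq: "c powr q * N = N\<phi>"
      using N N\<phi> q by (simp add: c_def L powr_divide powr_powr)
    have cp: "c powr p = N\<phi> powr (p/q) / N powr (p/q)"
      using N N\<phi> q by (simp add: c_def L powr_divide powr_powr)
    have cp0: "c powr p > 0" using N N\<phi> by (simp add: cp)
    have "(\<integral>x. \<bar>c * \<bar>u x\<bar>\<bar> powr q \<partial>M) = (\<integral>x. \<bar>\<phi> x\<bar> powr q \<partial>M)"
      using sc(3) cq by (simp add: N_def N\<phi>_def)
    then have eq: "p = q \<or> (\<integral>x. \<bar>c * \<bar>u x\<bar>\<bar> powr q \<partial>M) = (\<integral>x. \<bar>\<phi> x\<bar> powr q \<partial>M)" ..
    have nn: "0 \<le> c * \<bar>u x\<bar>" for x using c0 by simp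
    obtain s where s: "is_arg_max F (\<lambda>t. t \<in> {0..1}) s" "ereal C * F s \<le> ereal (deficit (\<lambda>x. c * \<bar>u x\<bar>))"
      using remainder_attains_max[OF sc(1) nn eq] unfolding F_def c_def[symmetric] by blast
    define D where "D = Lnorm \<Omega> p (weak_grad \<Omega> u) powr p - lambda1 \<Omega> p q * Lnorm \<Omega> q u powr p"
    have "deficit (\<lambda>x. c * \<bar>u x\<bar>) = c powr p * D"
    proof -
      have "(c powr q * N) powr (p / q) = c powr p * N powr (p / q)"
        using c0 N q by (simp add: powr_mult powr_powr)
      then show ?thesis
        unfolding deficit_def sc(2,3) D_def Lp Lnorm_powr_p N_def[symmetric] by (simp add: algebra_simps)
    qed
    then have "ereal (1 / c powr p) * (ereal C * F s) \<le> ereal (1 / c powr p) * ereal (c powr p * D)"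
      using s(2) cp0 by (intro ereal_mult_left_mono) auto
    also have "\<dots> = ereal D" using cp0 by simp
    also have "ereal (1 / c powr p) * (ereal C * F s) = ereal (1 / c powr p * C) * F s"
      by (simp only: mult.assoc[symmetric] times_ereal.simps)
    also have "1 / c powr p * C = C * (Lnorm \<Omega> q u powr p / Lnorm \<Omega> q \<phi> powr p)"
      unfolding Lnorm_powr_p cp N_def[symmetric] N\<phi>_def[symmetric] by simp
    finally show ?thesis using s(1) unfolding D_def by blast
  qed
qed

text \<open>For p = q the comparison holds without normalisation, so it is applied to |u| itself,
  the case c = 1 of the scaled function.\<close>

lemma hidden_convexity_endpoint:
  assumes u: "u \<in> W1_0 \<Omega> p" and pq: "p = q"
  shows "ereal C * pos_integral \<Omega> (Rp \<Omega> p (\<lambda>x. \<bar>u x\<bar>) \<phi> 1)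
    \<le> ereal ((\<integral>x. norm (weak_grad \<Omega> u x) powr p \<partial>M) - lambda1 \<Omega> p q * (\<integral>x. \<bar>u x\<bar> powr p \<partial>M))"
proof -
  have C: "C > 0" using p_gt_1 by (rule convexity_const_pos)
  note sc = scaled_abs[OF W1_0_imp_sobolev0[OF u], of 1, simplified]
  have "p = q \<or> (\<integral>x. \<bar>\<bar>u x\<bar>\<bar> powr q \<partial>M) = (\<integral>x. \<bar>\<phi> x\<bar> powr q \<partial>M)" using pq by simp
  note le = remainder_endpoint_le_deficit[OF sc(1) abs_ge_zero this]
    and d0 = deficit_nonneg[OF sc(1) abs_ge_zero this]
  have "pos_integral \<Omega> (Rp \<Omega> p (\<lambda>x. \<bar>u x\<bar>) \<phi> 1) \<le> enn2ereal (ennreal (deficit (\<lambda>x. \<bar>u x\<bar>) / C))"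
    using le unfolding pos_integral_def less_eq_ennreal.rep_eq .
  also have "\<dots> = ereal (deficit (\<lambda>x. \<bar>u x\<bar>) / C)" using d0 C by (intro enn2ereal_ennreal) simp
  finally have "ereal C * pos_integral \<Omega> (Rp \<Omega> p (\<lambda>x. \<bar>u x\<bar>) \<phi> 1) \<le> ereal C * ereal (deficit (\<lambda>x. \<bar>u x\<bar>) / C)"
    using C by (intro ereal_mult_left_mono) auto
  also have "\<dots> = ereal (deficit (\<lambda>x. \<bar>u x\<bar>))" using C by simp
  also have "deficit (\<lambda>x. \<bar>u x\<bar>) = (\<integral>x. norm (weak_grad \<Omega> u x) powr p \<partial>M) - lambda1 \<Omega> p q * (\<integral>x. \<bar>u x\<bar> powr p \<partial>M)"
    using q unfolding deficit_def sc(2) by (simp add: pq)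
  finally show ?thesis .
qed

end

text \<open>One constant, \<open>convexity_const p\<close>, serves all three inequalities; being
  fixed before \<phi>, it does not depend on which positive minimizer is taken. Using
  \<open>is_arg_max\<close> makes the existence of the maximum part of the claim.\<close>

theorem theorem1p5:
  fixes \<Omega> :: "'a::euclidean_space set" and p q :: real
  assumes "1 < q" and "q \<le> p"
    and "open \<Omega>" and "connected \<Omega>" and "\<Omega> \<noteq> {}" and "emeasure lebesgue \<Omega> < \<infinity>"
  shows
    "(\<exists>C>0. \<forall>\<phi>. positive_minimizer \<Omega> p q \<phi> \<longrightarrow> (\<forall>u\<in>W1_0 \<Omega> p.
        let F = (\<lambda>t. ereal (t * (1 - t)) *
              pos_integral \<Omega> (Rp \<Omega> p (\<lambda>x. Lnorm \<Omega> q \<phi> / Lnorm \<Omega> q u * \<bar>u x\<bar>) \<phi> t))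
        in \<exists>s. is_arg_max F (\<lambda>t. t \<in> {0..1}) s \<and>
          ereal (Lnorm \<Omega> p (weak_grad \<Omega> u) powr p - lambda1 \<Omega> p q * Lnorm \<Omega> q u powr p)
            \<ge> ereal (C * (Lnorm \<Omega> q u powr p / Lnorm \<Omega> q \<phi> powr p)) * F s))
     \<and> (p = q \<longrightarrow>
        (\<exists>C>0. \<forall>\<phi>. positive_minimizer \<Omega> p p \<phi> \<longrightarrow> (\<forall>u\<in>W1_0 \<Omega> p.
          ereal ((\<integral>x. norm (weak_grad \<Omega> u x) powr p \<partial>lebesgue_on \<Omega>)
              - lambda1 \<Omega> p p * (\<integral>x. \<bar>u x\<bar> powr p \<partial>lebesgue_on \<Omega>))
            \<ge> ereal C * pos_integral \<Omega> (Rp \<Omega> p (\<lambda>x. \<bar>u x\<bar>) \<phi> 1))))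
     \<and> (p = q \<and> p \<ge> 2 \<longrightarrow>
        (\<exists>C>0. \<forall>\<phi>. positive_minimizer \<Omega> p p \<phi> \<longrightarrow> (\<forall>u\<in>W1_0 \<Omega> p.
          ereal ((\<integral>x. norm (weak_grad \<Omega> u x) powr p \<partial>lebesgue_on \<Omega>)
              - lambda1 \<Omega> p p * (\<integral>x. \<bar>u x\<bar> powr p \<partial>lebesgue_on \<Omega>))
            \<ge> ereal C * pos_integral \<Omega>
                (\<lambda>x. norm (weak_grad \<Omega> (\<lambda>y. u y / \<phi> y) x) powr p * \<phi> x powr p))))"
proof -
  have p: "1 < p" using assms(1,2) by simp
  then have C: "convexity_const p > 0" by (rule convexity_const_pos)
  have min: "minimizer \<Omega> p r \<phi>" if "positive_minimizer \<Omega> p r \<phi>" "1 < r" "r \<le> p" for r \<phi>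
    using that assms p by unfold_locales auto
  have max: "\<exists>s. is_arg_max (\<lambda>t. ereal (t * (1 - t)) *
              pos_integral \<Omega> (Rp \<Omega> p (\<lambda>x. Lnorm \<Omega> q \<phi> / Lnorm \<Omega> q u * \<bar>u x\<bar>) \<phi> t)) (\<lambda>t. t \<in> {0..1}) s \<and>
          ereal (Lnorm \<Omega> p (weak_grad \<Omega> u) powr p - lambda1 \<Omega> p q * Lnorm \<Omega> q u powr p)
            \<ge> ereal (convexity_const p * (Lnorm \<Omega> q u powr p / Lnorm \<Omega> q \<phi> powr p)) *
              (ereal (s * (1 - s)) * pos_integral \<Omega> (Rp \<Omega> p (\<lambda>x. Lnorm \<Omega> q \<phi> / Lnorm \<Omega> q u * \<bar>u x\<bar>) \<phi> s))"
    if "positive_minimizer \<Omega> p q \<phi>" "u \<in> W1_0 \<Omega> p" for \<phi> u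
    by (rule minimizer.hidden_convexity_max[OF min[OF that(1) assms(1,2)] that(2)])
  have endpoint: "ereal (convexity_const p) * pos_integral \<Omega> (Rp \<Omega> p (\<lambda>x. \<bar>u x\<bar>) \<phi> 1)
      \<le> ereal ((\<integral>x. norm (weak_grad \<Omega> u x) powr p \<partial>lebesgue_on \<Omega>)
              - lambda1 \<Omega> p p * (\<integral>x. \<bar>u x\<bar> powr p \<partial>lebesgue_on \<Omega>))"
    if "positive_minimizer \<Omega> p p \<phi>" "u \<in> W1_0 \<Omega> p" for \<phi> u
    by (rule minimizer.hidden_convexity_endpoint[OF min[OF that(1) p order_refl] that(2) refl])
  have eq: "pos_integral \<Omega> (\<lambda>x. norm (weak_grad \<Omega> (\<lambda>y. u y / \<phi> y) x) powr p * \<phi> x powr p)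
      = pos_integral \<Omega> (Rp \<Omega> p (\<lambda>x. \<bar>u x\<bar>) \<phi> 1)"
    if \<phi>: "positive_minimizer \<Omega> p p \<phi>" and u: "u \<in> W1_0 \<Omega> p" and p2: "p \<ge> 2" for \<phi> u
  proof -
    interpret minimizer \<Omega> p p \<phi> using min[OF \<phi> p order_refl] .
    show ?thesis unfolding pos_integral_def
      using quotient_gradient_eq_Rp[OF W1_0_imp_sobolev0[OF u] p2]
      by (intro arg_cong[where f = enn2ereal] nn_integral_cong_AE) (auto elim!: eventually_mono)
  qed
  have quotient: "ereal (convexity_const p) * pos_integral \<Omega>
        (\<lambda>x. norm (weak_grad \<Omega> (\<lambda>y. u y / \<phi> y) x) powr p * \<phi> x powr p)
      \<le> ereal ((\<integral>x. norm (weak_grad \<Omega> u x) powr p \<partial>lebesgue_on \<Omega>)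
              - lambda1 \<Omega> p p * (\<integral>x. \<bar>u x\<bar> powr p \<partial>lebesgue_on \<Omega>))"
    if "positive_minimizer \<Omega> p p \<phi>" "u \<in> W1_0 \<Omega> p" "p \<ge> 2" for \<phi> u
    unfolding eq[OF that] by (rule endpoint[OF that(1,2)])
  show ?thesis
  proof (intro conjI impI, goal_cases)
    case 1 show ?case unfolding Let_def using C max by blast
  next
    case 2 show ?case using C endpoint by blast
  next
    case 3 then show ?case using C quotient by blast
  qed
qed

end
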